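(* Let $L>0$, $\mathcal{T}_L:=\{(x,y)\in(0,L)^2\colon y<x\}$ and $\mathcal{P}_L:=\mathcal{T}_L\times(0,L)$. Let $\Omega\in\{\mathcal{T}_L,\mathcal{P}_L\}$, with $d=2$ if $\Omega=\mathcal{T}_L$ and $d=3$ if $\Omega=\mathcal{P}_L$, and let $\bullet\in\{D,N\}$. Let $S\subset\mathbb{R}^d$ be $(\gamma,a)$-thick with $\gamma\in(0,1]$ and $a=(a_1,\dots,a_d)\in(0,+\infty)^d$ satisfying $2\sqrt{a_1^2+a_2^2}\le L$ and $a_j\le L$ for $j\in\{3,\dots,d\}$, and let $\omega=\Omega\cap S$. Then the system $$\partial_tu(t)-\Delta^\bullet_\Omega u(t)=\chi_\omega v(t)\quad(0<t<T),\qquad u(0)=u_0\in L^2(\Omega),$$ is null-controllable in any time $T>0$ with control cost $$C_T\le\frac{1}{\sqrt T}\left(\frac{K^d}{\tilde\gamma}\right)^{Kd/2}\exp\left(\frac{K\|\tilde a\|_1^2\ln^2(K^d/\tilde\gamma)}{2T}\right),$$ where $$\tilde\gamma=\frac{\gamma a_1a_2}{4(a_1^2+a_2^2)},\qquad\tilde a=\Bigl(2\sqrt{a_1^2+a_2^2},\,2\sqrt{a_1^2+a_2^2},\,a_3,\dots,a_d\Bigr),$$ $\|\tilde a\|_1=\tilde a_1+\dots+\tilde a_d$, and $K>0$ is the universal constant described in the context.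
   Context: Thick sets: a measurable set $S\subset\mathbb{R}^d$ is $(\gamma,a)$-thick, with $\gamma\in(0,1]$ and $a\in(0,+\infty)^d$, if $|S\cap(x+[0,a_1]\times\dots\times[0,a_d])|\ge\gamma\prod_{j=1}^da_j$ for all $x\in\mathbb{R}^d$, where $|\cdot|$ is Lebesgue measure. $\Delta_\Omega^D$ and $\Delta_\Omega^N$ are the Dirichlet and Neumann Laplacians on $L^2(\Omega)$: $-\Delta_\Omega^\bullet$ is the self-adjoint operator associated with the form $\int_\Omega\langle\nabla f,\nabla g\rangle_{\mathbb{C}^d}\,dx$ with form domain $H_0^1(\Omega)$ (for $D$) or $H^1(\Omega)$ (for $N$). The system $\partial_tu-\Delta_\Omega^\bullet u=\chi_\omega v$, $u(0)=u_0$, is null-controllable in time $T>0$ if for every $u_0\in L^2(\Omega)$ there is $v\in L^2((0,T),L^2(\Omega))$ with $(\ast)$ $e^{T\Delta_\Omega^\bullet}u_0+\int_0^Te^{(T-s)\Delta_\Omega^\bullet}\chi_\omega v(s)\,ds=0$. Its control cost is $C_T=\sup_{\|u_0\|_{L^2(\Omega)}=1}\inf\{\|v\|_{L^2((0,T),L^2(\omega))}\colon v\text{ satisfies }(\ast)\}$. The constant $K$: $K>0$ is a universal constant with the following property (such a constant is known to exist from earlier work). For every $d\in\mathbb{N}$, every $L>0$, every $\tilde\Omega\in\{\mathbb{R}^d,(0,L)^d\}$, every $\bullet\in\{D,N\}$, every $(\gamma,a)$-thick set $S\subset\mathbb{R}^d$ (with $a_j\le L$ for all $j$ if $\tilde\Omega=(0,L)^d$),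 the system $\partial_tu-\Delta_{\tilde\Omega}^\bullet u=\chi_{\tilde\Omega\cap S}v$ is null-controllable in any time $T>0$ with control cost $$C_T\le\frac1{\sqrt T}\left(\frac{K^d}{\gamma}\right)^{Kd/2}\exp\left(\frac{K\|a\|_1^2\ln^2(K^d/\gamma)}{2T}\right),\qquad\|a\|_1=a_1+\dots+a_d.$$ *)

theory Defs
  imports "HOL-Analysis.Analysis"
begin

section \<open>Euclidean space of variable dimension\<close>

text \<open>
  The dimension is quantified inside the statement, so a point of d-dimensional space is an
  extensional function on \<open>{..<d}\<close>; coordinates are numbered from 0. On this set the topology of
  \<^typ>\<open>nat \<Rightarrow> real\<close> is the Euclidean one.
\<close>

type_synonym point = "nat \<Rightarrow> real"

definition euclid :: "nat \<Rightarrow> point set" where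
  "euclid d = (\<Pi>\<^sub>E i\<in>{..<d}. UNIV)"

definition leb :: "nat \<Rightarrow> point measure" where
  "leb d = completion (\<Pi>\<^sub>M i\<in>{..<d}. lborel)"

definition leb_on :: "nat \<Rightarrow> point set \<Rightarrow> point measure" where
  "leb_on d \<Omega> = restrict_space (leb d) \<Omega>"

definition cube :: "nat \<Rightarrow> real \<Rightarrow> point set" where
  "cube d L = {x \<in> euclid d. \<forall>i<d. 0 < x i \<and> x i < L}"

definition triangle_domain :: "real \<Rightarrow> point set" where
  "triangle_domain L = {x \<in> cube 2 L. x 1 < x 0}"

definition prism_domain :: "real \<Rightarrow> point set" where
  "prism_domain L = {x \<in> euclid 3. restrict x {..<2} \<in> triangle_domain L \<and> 0 < x 2 \<and> x 2 < L}"

definition thick :: "nat \<Rightarrow> real \<Rightarrow> point \<Rightarrow> point set \<Rightarrow> bool" where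
  "thick d \<gamma> a S \<longleftrightarrow>
     0 < \<gamma> \<and> \<gamma> \<le> 1 \<and> (\<forall>j<d. 0 < a j) \<and> S \<in> sets (leb d) \<and>
     (\<forall>x\<in>euclid d.
        measure (leb d) (S \<inter> {y \<in> euclid d. \<forall>j<d. x j \<le> y j \<and> y j \<le> x j + a j})
          \<ge> \<gamma> * (\<Prod>j<d. a j))"


section \<open>Square-integrable functions\<close>

text \<open>
  Elements of the Hilbert space are represented by functions; two functions represent the same
  element iff they agree almost everywhere, i.e. iff their distance in \<open>L2_norm\<close> is 0.
\<close>

definition L2 :: "'a measure \<Rightarrow> ('a \<Rightarrow> complex) set" where
  "L2 M = {f \<in> borel_measurable M. integrable M (\<lambda>x. (cmod (f x))\<^sup>2)}"

definition L2_norm :: "'a measure \<Rightarrow> ('a \<Rightarrow> complex) \<Rightarrow> real" where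
  "L2_norm M f = sqrt (\<integral>x. (cmod (f x))\<^sup>2 \<partial>M)"

definition L2_inner :: "'a measure \<Rightarrow> ('a \<Rightarrow> complex) \<Rightarrow> ('a \<Rightarrow> complex) \<Rightarrow> complex" where
  "L2_inner M f g = (\<integral>x. f x * cnj (g x) \<partial>M)"


section \<open>Bochner measurability and Bochner integral with values in \<open>L2 M\<close>\<close>

text \<open>
  As \<open>L2 M\<close> depends on the measure, it is not a type and the Bochner integral of the library does
  not apply; the definitions below repeat the usual ones (approximation by simple functions) for
  the seminorm \<open>L2_norm M\<close>. The measure \<open>N\<close> is meant to be finite.
\<close>

definition L2_simple ::
    "'t measure \<Rightarrow> 'a measure \<Rightarrow> ('t \<Rightarrow> 'a \<Rightarrow> complex) \<Rightarrow> bool" where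
  "L2_simple N M s \<longleftrightarrow>
     finite (s ` space N) \<and> s ` space N \<subseteq> L2 M \<and>
     (\<forall>y \<in> s ` space N. {t \<in> space N. s t = y} \<in> sets N)"

definition L2_simple_integral ::
    "'t measure \<Rightarrow> ('t \<Rightarrow> 'a \<Rightarrow> complex) \<Rightarrow> 'a \<Rightarrow> complex" where
  "L2_simple_integral N s =
     (\<lambda>x. \<Sum>y \<in> s ` space N. of_real (measure N {t \<in> space N. s t = y}) * y x)"

definition L2_strongly_measurable ::
    "'t measure \<Rightarrow> 'a measure \<Rightarrow> ('t \<Rightarrow> 'a \<Rightarrow> complex) \<Rightarrow> bool" where
  "L2_strongly_measurable N M w \<longleftrightarrow>
     (\<forall>t \<in> space N. w t \<in> L2 M) \<and>
     (\<exists>s. (\<forall>n::nat. L2_simple N M (s n)) \<and>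
          (AE t in N. (\<lambda>n. L2_norm M (\<lambda>x. s n t x - w t x)) \<longlonglongrightarrow> 0))"

definition has_L2_integral ::
    "'t measure \<Rightarrow> 'a measure \<Rightarrow> ('t \<Rightarrow> 'a \<Rightarrow> complex) \<Rightarrow> ('a \<Rightarrow> complex) \<Rightarrow> bool" where
  "has_L2_integral N M w h \<longleftrightarrow>
     L2_strongly_measurable N M w \<and> h \<in> L2 M \<and>
     (\<exists>s. (\<forall>n::nat. L2_simple N M (s n)) \<and>
          (\<lambda>n. \<integral>\<^sup>+t. ennreal (L2_norm M (\<lambda>x. s n t x - w t x)) \<partial>N) \<longlonglongrightarrow> 0 \<and>
          (\<lambda>n. L2_norm M (\<lambda>x. L2_simple_integral N (s n) x - h x)) \<longlonglongrightarrow> 0)"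

definition L2_L2 :: "'t measure \<Rightarrow> 'a measure \<Rightarrow> ('t \<Rightarrow> 'a \<Rightarrow> complex) set" where
  "L2_L2 N M =
     {v. L2_strongly_measurable N M v \<and> integrable N (\<lambda>t. (L2_norm M (v t))\<^sup>2)}"


section \<open>Sobolev spaces\<close>

definition partial :: "nat \<Rightarrow> (point \<Rightarrow> complex) \<Rightarrow> point \<Rightarrow> complex" where
  "partial i \<phi> x = vector_derivative (\<lambda>t. \<phi> (x(i := t))) (at (x i))"

definition smooth :: "nat \<Rightarrow> (point \<Rightarrow> complex) \<Rightarrow> bool" where
  "smooth d \<phi> \<longleftrightarrow>
     (\<forall>is. set is \<subseteq> {..<d} \<longrightarrow>
        continuous_on (euclid d) (foldr partial is \<phi>) \<and>
        (\<forall>i<d. \<forall>x\<in>euclid d. (\<lambda>t. foldr partial is \<phi> (x(i := t))) differentiable at (x i)))"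

definition test_fun :: "nat \<Rightarrow> point set \<Rightarrow> (point \<Rightarrow> complex) set" where
  "test_fun d \<Omega> =
     {\<phi>. smooth d \<phi> \<and> (\<exists>C. compact C \<and> C \<subseteq> \<Omega> \<and> (\<forall>x \<in> euclid d - C. \<phi> x = 0))}"

definition weak_gradient ::
    "nat \<Rightarrow> point set \<Rightarrow> (point \<Rightarrow> complex) \<Rightarrow> (nat \<Rightarrow> point \<Rightarrow> complex) \<Rightarrow> bool" where
  "weak_gradient d \<Omega> f F \<longleftrightarrow>
     f \<in> L2 (leb_on d \<Omega>) \<and>
     (\<forall>i<d. F i \<in> L2 (leb_on d \<Omega>) \<and>
        (\<forall>\<phi> \<in> test_fun d \<Omega>.
           (\<integral>x. f x * partial i \<phi> x \<partial>leb_on d \<Omega>) = - (\<integral>x. F i x * \<phi> x \<partial>leb_on d \<Omega>)))"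

definition H1 :: "nat \<Rightarrow> point set \<Rightarrow> (point \<Rightarrow> complex) set" where
  "H1 d \<Omega> = {f. \<exists>F. weak_gradient d \<Omega> f F}"

text \<open>The closure of the test functions in the norm of \<open>H1\<close>.\<close>

definition H10 :: "nat \<Rightarrow> point set \<Rightarrow> (point \<Rightarrow> complex) set" where
  "H10 d \<Omega> =
     {f. \<exists>F \<phi>. weak_gradient d \<Omega> f F \<and> (\<forall>n::nat. \<phi> n \<in> test_fun d \<Omega>) \<and>
           (\<lambda>n. L2_norm (leb_on d \<Omega>) (\<lambda>x. \<phi> n x - f x)) \<longlonglongrightarrow> 0 \<and>
           (\<forall>i<d. (\<lambda>n. L2_norm (leb_on d \<Omega>) (\<lambda>x. partial i (\<phi> n) x - F i x)) \<longlonglongrightarrow> 0)}"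


section \<open>Dirichlet and Neumann Laplacians and their semigroups\<close>

datatype boundary_cond = Dirichlet | Neumann

fun form_domain :: "boundary_cond \<Rightarrow> nat \<Rightarrow> point set \<Rightarrow> (point \<Rightarrow> complex) set" where
  "form_domain Dirichlet d \<Omega> = H10 d \<Omega>"
| "form_domain Neumann d \<Omega> = H1 d \<Omega>"

text \<open>
  The graph of the Laplacian: its negative is the operator associated with the form
  \<open>\<integral>\<langle>\<nabla>f, \<nabla>g\<rangle>\<close>. Weak gradients are unique almost everywhere, so the quantifiers over \<open>F\<close> and \<open>G\<close>
  only pick representatives of \<open>\<nabla>f\<close> and \<open>\<nabla>g\<close>.
\<close>

definition laplacian ::
    "boundary_cond \<Rightarrow> nat \<Rightarrow> point set \<Rightarrow> ((point \<Rightarrow> complex) \<times> (point \<Rightarrow> complex)) set" where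
  "laplacian bc d \<Omega> =
     {(f, h). f \<in> form_domain bc d \<Omega> \<and> h \<in> L2 (leb_on d \<Omega>) \<and>
        (\<exists>F. weak_gradient d \<Omega> f F \<and>
           (\<forall>g \<in> form_domain bc d \<Omega>. \<forall>G. weak_gradient d \<Omega> g G \<longrightarrow>
              (\<integral>x. (\<Sum>i<d. F i x * cnj (G i x)) \<partial>leb_on d \<Omega>) = - L2_inner (leb_on d \<Omega>) h g))}"

text \<open>
  \<open>E\<close> is a strongly continuous contraction semigroup on \<open>L2 M\<close> with generator (given by its graph)
  exactly \<open>A\<close>. Such an \<open>E\<close> is determined by \<open>A\<close> up to null sets, and it exists for the nonpositive
  self-adjoint operators \<open>A\<close> considered here.
\<close>

definition generates ::
    "'a measure \<Rightarrow> (('a \<Rightarrow> complex) \<times> ('a \<Rightarrow> complex)) set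
      \<Rightarrow> (real \<Rightarrow> ('a \<Rightarrow> complex) \<Rightarrow> 'a \<Rightarrow> complex) \<Rightarrow> bool" where
  "generates M A E \<longleftrightarrow>
     (\<forall>t\<ge>0. \<forall>f\<in>L2 M. E t f \<in> L2 M \<and> L2_norm M (E t f) \<le> L2_norm M f) \<and>
     (\<forall>t\<ge>0. \<forall>f\<in>L2 M. \<forall>g\<in>L2 M. \<forall>c.
        AE x in M. E t (\<lambda>x. f x + c * g x) x = E t f x + c * E t g x) \<and>
     (\<forall>f\<in>L2 M. AE x in M. E 0 f x = f x) \<and>
     (\<forall>s\<ge>0. \<forall>t\<ge>0. \<forall>f\<in>L2 M. AE x in M. E (s + t) f x = E s (E t f) x) \<and>
     (\<forall>f\<in>L2 M. ((\<lambda>t. L2_norm M (\<lambda>x. E t f x - f x)) \<longlongrightarrow> 0) (at_right 0)) \<and>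
     (\<forall>f\<in>L2 M. \<forall>h\<in>L2 M. (f, h) \<in> A \<longleftrightarrow>
        ((\<lambda>t. L2_norm M (\<lambda>x. (E t f x - f x) / of_real t - h x)) \<longlongrightarrow> 0) (at_right 0))"

definition heat_semigroup ::
    "boundary_cond \<Rightarrow> nat \<Rightarrow> point set \<Rightarrow> (real \<Rightarrow> (point \<Rightarrow> complex) \<Rightarrow> point \<Rightarrow> complex) \<Rightarrow> bool" where
  "heat_semigroup bc d \<Omega> E \<longleftrightarrow> generates (leb_on d \<Omega>) (laplacian bc d \<Omega>) E"


section \<open>Null-controllability and control cost\<close>

text \<open>
  \<open>v\<close> is a control that steers \<open>u0\<close> to 0 in time \<open>T\<close>; the value at time \<open>T\<close> of the mild solution is
  \<open>E T u0 + h\<close>. By uniqueness of the semigroup the choice of \<open>E\<close> is immaterial.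
\<close>

definition steers_to_zero ::
    "boundary_cond \<Rightarrow> nat \<Rightarrow> point set \<Rightarrow> point set \<Rightarrow> real
      \<Rightarrow> (point \<Rightarrow> complex) \<Rightarrow> (real \<Rightarrow> point \<Rightarrow> complex) \<Rightarrow> bool" where
  "steers_to_zero bc d \<Omega> \<omega> T u0 v \<longleftrightarrow>
     v \<in> L2_L2 (lebesgue_on {0<..<T}) (leb_on d \<Omega>) \<and>
     (\<exists>E h. heat_semigroup bc d \<Omega> E \<and>
        has_L2_integral (lebesgue_on {0<..<T}) (leb_on d \<Omega>)
          (\<lambda>s. E (T - s) (\<lambda>x. indicator \<omega> x * v s x)) h \<and>
        (AE x in leb_on d \<Omega>. E T u0 x + h x = 0))"

definition null_controllable ::
    "boundary_cond \<Rightarrow> nat \<Rightarrow> point set \<Rightarrow> point set \<Rightarrow> real \<Rightarrow> bool" where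
  "null_controllable bc d \<Omega> \<omega> T \<longleftrightarrow>
     (\<forall>u0 \<in> L2 (leb_on d \<Omega>). \<exists>v. steers_to_zero bc d \<Omega> \<omega> T u0 v)"

definition control_cost ::
    "boundary_cond \<Rightarrow> nat \<Rightarrow> point set \<Rightarrow> point set \<Rightarrow> real \<Rightarrow> ennreal" where
  "control_cost bc d \<Omega> \<omega> T =
     (SUP u0 \<in> {u0 \<in> L2 (leb_on d \<Omega>). L2_norm (leb_on d \<Omega>) u0 = 1}.
        INF v \<in> {v. steers_to_zero bc d \<Omega> \<omega> T u0 v}.
          ennreal (sqrt (\<integral>t. (L2_norm (leb_on d \<omega>) (v t))\<^sup>2 \<partial>lebesgue_on {0<..<T})))"

definition cost_bound :: "real \<Rightarrow> nat \<Rightarrow> real \<Rightarrow> point \<Rightarrow> real \<Rightarrow> real" where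
  "cost_bound K d \<gamma> a T =
     1 / sqrt T * (K ^ d / \<gamma>) powr (K * real d / 2) *
     exp (K * (\<Sum>j<d. a j)\<^sup>2 * (ln (K ^ d / \<gamma>))\<^sup>2 / (2 * T))"

definition universal_control_constant :: "real \<Rightarrow> bool" where
  "universal_control_constant K \<longleftrightarrow> K > 0 \<and>
     (\<forall>d L \<Omega> bc \<gamma> a S T.
        d \<ge> 1 \<longrightarrow> L > 0 \<longrightarrow> \<Omega> \<in> {euclid d, cube d L} \<longrightarrow> thick d \<gamma> a S \<longrightarrow>
        (\<Omega> = cube d L \<longrightarrow> (\<forall>j<d. a j \<le> L)) \<longrightarrow> T > 0 \<longrightarrow>
        null_controllable bc d \<Omega> (\<Omega> \<inter> S) T \<and>
        control_cost bc d \<Omega> (\<Omega> \<inter> S) T \<le> ennreal (cost_bound K d \<gamma> a T))"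

end

theory Submission
  imports Defs "HOL-Computational_Algebra.Polynomial"
begin

text \<open>
  Reflecting at the diagonal \<open>x 0 = x 1\<close> maps \<open>\<Omega>\<close> onto the other half of the cube. The even (Neumann)
  or odd (Dirichlet) extension \<open>V\<close>, divided by \<open>\<surd>2\<close>, is an isometry from \<open>L2(\<Omega>)\<close> into \<open>L2\<close> of the
  cube, whose adjoint \<open>W\<close> averages over the reflection. Both maps respect the form domains and hence
  the Laplacians, so \<open>V W\<close> commutes with the heat semigroup \<open>E\<close> of the cube, \<open>W E V\<close> is the heat
  semigroup of \<open>\<Omega>\<close>, and \<open>W\<close> maps a control for \<open>V u0\<close> on the cube to a control for \<open>u0\<close> on \<open>\<Omega>\<close>
  without increasing its norm. The control set on the cube is the reflection of \<open>S\<close>, which is thick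
  with the parameters \<open>\<gamma>'\<close> and \<open>a'\<close>.
\<close>

section \<open>Square-integrable functions\<close>

text \<open>The semigroup is tied to the Laplacian only by its difference quotients at time 0, so
  its properties must be drawn from the generator. Commutation with \<open>V W\<close> follows from
  a differential inequality for the norm of the commutator on the domain and extends by density;
  test functions, which lie in the domain for both boundary conditions, supply the density. A
  semigroup on the cube is part of what steering on the cube provides, and the one on \<Omega> is
  built from it. The analytic obstacle is the diagonal. A test function of the cube need not vanish
  there, so it cannot be used directly as a test function of \<Omega>. Traces are avoided by
  cut-offs that vanish within 1/(n+1) of the diagonal: their derivatives grow at most like the
  inverse distance, but they always meet a factor that is odd under the reflection and hence
  vanishes linearly there. The constant \<gamma>' is a ratio of volumes: it compares a rectangle
  with sides \<open>a 0\<close>, \<open>a 1\<close> to a square of area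
  \<open>4 * ((a 0)^2 + (a 1)^2)\<close> around it.\<close>

lemma L2_measurable [measurable_dest]: "f \<in> L2 M \<Longrightarrow> f \<in> borel_measurable M"
  by (simp add: L2_def)

lemma L2_square_integrable: "f \<in> L2 M \<Longrightarrow> integrable M (\<lambda>x. (cmod (f x))\<^sup>2)"
  by (simp add: L2_def)

lemma L2_norm_nonneg [simp]: "0 \<le> L2_norm M f"
  by (simp add: L2_norm_def)

lemma L2_norm_power2: "(L2_norm M f)\<^sup>2 = (\<integral>x. (cmod (f x))\<^sup>2 \<partial>M)"
  by (simp add: L2_norm_def)

lemma L2_bounded_by:
  assumes "g \<in> L2 M" "f \<in> borel_measurable M" "\<And>x. x \<in> space M \<Longrightarrow> cmod (f x) \<le> cmod (g x)"
  shows "f \<in> L2 M"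
proof -
  have "integrable M (\<lambda>x. (cmod (f x))\<^sup>2)"
    by (rule Bochner_Integration.integrable_bound[OF L2_square_integrable[OF assms(1)]])
      (use assms in \<open>auto intro!: AE_I2 power_mono\<close>)
  then show ?thesis using assms by (simp add: L2_def)
qed

lemma cmod_add_power2_le: "(cmod (a + b))\<^sup>2 \<le> 2 * (cmod a)\<^sup>2 + 2 * (cmod b)\<^sup>2"
proof -
  have "(cmod (a + b))\<^sup>2 \<le> (cmod a + cmod b)\<^sup>2"
    by (simp add: norm_triangle_ineq power_mono)
  also have "\<dots> \<le> 2 * (cmod a)\<^sup>2 + 2 * (cmod b)\<^sup>2"
    using sum_squares_bound[of "cmod a" "cmod b"] by (simp add: power2_sum)
  finally show ?thesis .
qed

lemma L2_add: assumes "f \<in> L2 M" "g \<in> L2 M" shows "(\<lambda>x. f x + g x) \<in> L2 M"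
proof -
  have "integrable M (\<lambda>x. 2 * (cmod (f x))\<^sup>2 + 2 * (cmod (g x))\<^sup>2)"
    using assms by (simp add: L2_square_integrable)
  then have "integrable M (\<lambda>x. (cmod (f x + g x))\<^sup>2)"
    by (rule Bochner_Integration.integrable_bound)
      (use assms in \<open>auto intro!: AE_I2 cmod_add_power2_le simp: L2_def\<close>)
  then show ?thesis using assms by (auto simp: L2_def)
qed

lemma L2_scale: "f \<in> L2 M \<Longrightarrow> (\<lambda>x. c * f x) \<in> L2 M"
  by (auto simp: L2_def norm_mult power_mult_distrib)

lemma L2_divide: "f \<in> L2 M \<Longrightarrow> (\<lambda>x. f x / c) \<in> L2 M"
  using L2_scale[of f M "inverse c"] by (simp add: field_simps)

lemma L2_uminus: "f \<in> L2 M \<Longrightarrow> (\<lambda>x. - f x) \<in> L2 M"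
  using L2_scale[of f M "-1"] by simp

lemma L2_diff: "f \<in> L2 M \<Longrightarrow> g \<in> L2 M \<Longrightarrow> (\<lambda>x. f x - g x) \<in> L2 M"
  using L2_add[OF _ L2_uminus, of f M g] by simp

lemma L2_zero: "(\<lambda>x. 0) \<in> L2 M"
  by (simp add: L2_def)

lemma L2_cnj: "f \<in> L2 M \<Longrightarrow> (\<lambda>x. cnj (f x)) \<in> L2 M"
  using borel_measurable_continuous_onI[OF continuous_on_cnj[OF continuous_on_id]]
  by (auto simp: L2_def intro: measurable_compose)

lemma L2_sum: "(\<And>i. i \<in> I \<Longrightarrow> f i \<in> L2 M) \<Longrightarrow> (\<lambda>x. \<Sum>i\<in>I. f i x) \<in> L2 M"
  by (induction I rule: infinite_finite_induct) (auto intro: L2_zero L2_add)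

lemma L2_cong: "(\<And>x. x \<in> space M \<Longrightarrow> f x = g x) \<Longrightarrow> f \<in> L2 M \<longleftrightarrow> g \<in> L2 M"
  unfolding L2_def by (simp cong: measurable_cong Bochner_Integration.integrable_cong)

lemma L2_norm_scale: "L2_norm M (\<lambda>x. c * f x) = cmod c * L2_norm M f"
  by (simp add: L2_norm_def norm_mult power_mult_distrib real_sqrt_mult)

lemma L2_norm_minus: "L2_norm M (\<lambda>x. - f x) = L2_norm M f"
  by (simp add: L2_norm_def)

lemma L2_norm_minus_commute: "L2_norm M (\<lambda>x. f x - g x) = L2_norm M (\<lambda>x. g x - f x)"
  by (simp add: L2_norm_def norm_minus_commute)

lemma L2_norm_zero [simp]: "L2_norm M (\<lambda>x. 0) = 0"
  by (simp add: L2_norm_def)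

lemma L2_norm_cong: "(\<And>x. x \<in> space M \<Longrightarrow> f x = g x) \<Longrightarrow> L2_norm M f = L2_norm M g"
  unfolding L2_norm_def by (simp cong: Bochner_Integration.integral_cong)

lemma L2_norm_cong_AE:
  assumes "f \<in> borel_measurable M" "g \<in> borel_measurable M" "AE x in M. f x = g x"
  shows "L2_norm M f = L2_norm M g"
  unfolding L2_norm_def using assms by (intro arg_cong[where f=sqrt] integral_cong_AE) auto

lemma L2_norm_mono:
  assumes "g \<in> L2 M" "\<And>x. x \<in> space M \<Longrightarrow> cmod (f x) \<le> cmod (g x)"
  shows "L2_norm M f \<le> L2_norm M g"
proof (cases "integrable M (\<lambda>x. (cmod (f x))\<^sup>2)")
  case True
  then show ?thesis unfolding L2_norm_def
    by (intro real_sqrt_le_mono integral_mono) (auto intro!: power_mono assms L2_square_integrable)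
next
  \<comment> \<open>A Bochner integral that does not exist has the default value 0, and so does the
    left-hand norm.\<close>
  case False
  then show ?thesis by (simp add: L2_norm_def not_integrable_integral_eq)
qed

lemma L2_norm_eq_0_iff:
  assumes "f \<in> L2 M" shows "L2_norm M f = 0 \<longleftrightarrow> (AE x in M. f x = 0)"
  using integral_nonneg_eq_0_iff_AE[OF L2_square_integrable[OF assms]]
  by (simp add: L2_norm_def)

lemma L2_dist_eq_0_iff:
  assumes "f \<in> L2 M" "g \<in> L2 M"
  shows "L2_norm M (\<lambda>x. f x - g x) = 0 \<longleftrightarrow> (AE x in M. f x = g x)"
  using L2_norm_eq_0_iff[OF L2_diff[OF assms]] by simp

lemma L2_mult_integrable:
  assumes "f \<in> L2 M" "g \<in> L2 M" shows "integrable M (\<lambda>x. f x * g x)"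
proof -
  have "integrable M (\<lambda>x. (cmod (f x))\<^sup>2 + (cmod (g x))\<^sup>2)"
    using assms by (auto dest: L2_square_integrable)
  then show ?thesis
  proof (rule Bochner_Integration.integrable_bound)
    have "cmod (f x * g x) \<le> (cmod (f x))\<^sup>2 + (cmod (g x))\<^sup>2" for x
      using sum_squares_bound[of "cmod (f x)" "cmod (g x)"]
        mult_nonneg_nonneg[OF norm_ge_zero[of "f x"] norm_ge_zero[of "g x"]]
      unfolding norm_mult by linarith
    then show "AE x in M. norm (f x * g x) \<le> norm ((cmod (f x))\<^sup>2 + (cmod (g x))\<^sup>2)"
      by auto
  qed (use assms in measurable)
qed

text \<open>Integrate \<open>2 s t \<le> (b / a) s^2 + (a / b) t^2\<close> with \<open>a\<close>,
  \<open>b\<close> the two norms; these weights make both terms contribute \<open>a * b\<close>.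
  Norms equal to 0 are treated apart, since the weights divide by them.\<close>

lemma L2_Cauchy_Schwarz_norm:
  assumes f: "f \<in> L2 M" and g: "g \<in> L2 M"
  shows "(\<integral>x. cmod (f x) * cmod (g x) \<partial>M) \<le> L2_norm M f * L2_norm M g"
proof (cases "L2_norm M f = 0 \<or> L2_norm M g = 0")
  case True
  then have "AE x in M. cmod (f x) * cmod (g x) = 0"
    using L2_norm_eq_0_iff[OF f] L2_norm_eq_0_iff[OF g] by auto
  then have "(\<integral>x. cmod (f x) * cmod (g x) \<partial>M) = 0"
    by (rule integral_eq_zero_AE)
  then show ?thesis by simp
next
  case False
  define a b where "a = L2_norm M f" and "b = L2_norm M g"
  have ab: "a > 0" "b > 0" using False by (simp_all add: a_def b_def less_le)
  have "(\<integral>x. cmod (f x) * cmod (g x) \<partial>M)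
      \<le> (\<integral>x. (b / a * (cmod (f x))\<^sup>2 + a / b * (cmod (g x))\<^sup>2) / 2 \<partial>M)"
  proof (rule integral_mono)
    show "integrable M (\<lambda>x. cmod (f x) * cmod (g x))"
      using integrable_norm[OF L2_mult_integrable[OF f g]] by (simp add: norm_mult)
    show "integrable M (\<lambda>x. (b / a * (cmod (f x))\<^sup>2 + a / b * (cmod (g x))\<^sup>2) / 2)"
      using f g by (intro integrable_divide Bochner_Integration.integrable_add integrable_mult_right
          L2_square_integrable)
    fix x
    have "0 \<le> (b * cmod (f x) - a * cmod (g x))\<^sup>2 / (a * b)" using ab by simp
    also have "\<dots> = b / a * (cmod (f x))\<^sup>2 + a / b * (cmod (g x))\<^sup>2 - 2 * (cmod (f x) * cmod (g x))"
      using ab by (simp add: field_simps power2_eq_square)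
    finally show "cmod (f x) * cmod (g x) \<le> (b / a * (cmod (f x))\<^sup>2 + a / b * (cmod (g x))\<^sup>2) / 2"
      by simp
  qed
  also have "\<dots> = (b / a * a\<^sup>2 + a / b * b\<^sup>2) / 2"
    using f g by (simp add: L2_square_integrable a_def b_def L2_norm_power2)
  also have "\<dots> = a * b" using ab by (simp add: power2_eq_square)
  finally show ?thesis by (simp add: a_def b_def)
qed

lemma L2_Cauchy_Schwarz:
  assumes f: "f \<in> L2 M" and g: "g \<in> L2 M"
  shows "cmod (\<integral>x. f x * g x \<partial>M) \<le> L2_norm M f * L2_norm M g"
  using order_trans[OF integral_norm_bound[of M "\<lambda>x. f x * g x"]] L2_Cauchy_Schwarz_norm[OF f g]
  by (simp add: norm_mult)

lemma L2_norm_triangle: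
  assumes f: "f \<in> L2 M" and g: "g \<in> L2 M"
  shows "L2_norm M (\<lambda>x. f x + g x) \<le> L2_norm M f + L2_norm M g"
proof -
  have i: "integrable M (\<lambda>x. cmod (f x) * cmod (g x))"
    using integrable_norm[OF L2_mult_integrable[OF f g]] by (simp add: norm_mult)
  have "(L2_norm M (\<lambda>x. f x + g x))\<^sup>2
      \<le> (\<integral>x. (cmod (f x))\<^sup>2 + 2 * (cmod (f x) * cmod (g x)) + (cmod (g x))\<^sup>2 \<partial>M)"
    unfolding L2_norm_power2
  proof (rule integral_mono)
    show "integrable M (\<lambda>x. (cmod (f x + g x))\<^sup>2)" by (rule L2_square_integrable[OF L2_add[OF f g]])
    show "integrable M (\<lambda>x. (cmod (f x))\<^sup>2 + 2 * (cmod (f x) * cmod (g x)) + (cmod (g x))\<^sup>2)"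
      using i f g by (simp add: L2_square_integrable)
    fix x
    have "(cmod (f x + g x))\<^sup>2 \<le> (cmod (f x) + cmod (g x))\<^sup>2"
      by (simp add: norm_triangle_ineq power_mono)
    then show "(cmod (f x + g x))\<^sup>2 \<le> (cmod (f x))\<^sup>2 + 2 * (cmod (f x) * cmod (g x)) + (cmod (g x))\<^sup>2"
      by (simp add: power2_sum)
  qed
  also have "\<dots> = (L2_norm M f)\<^sup>2 + 2 * (\<integral>x. cmod (f x) * cmod (g x) \<partial>M) + (L2_norm M g)\<^sup>2"
    using i f g by (simp add: L2_square_integrable L2_norm_power2)
  also have "\<dots> \<le> (L2_norm M f + L2_norm M g)\<^sup>2"
    using L2_Cauchy_Schwarz_norm[OF f g] by (simp add: power2_sum)
  finally show ?thesis by (rule power2_le_imp_le) simp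
qed

lemma L2_norm_triangle3:
  assumes "f \<in> L2 M" "g \<in> L2 M" "h \<in> L2 M"
  shows "L2_norm M (\<lambda>x. f x - h x) \<le> L2_norm M (\<lambda>x. f x - g x) + L2_norm M (\<lambda>x. g x - h x)"
  using L2_norm_triangle[OF L2_diff[OF assms(1,2)] L2_diff[OF assms(2,3)]] by simp

lemma L2_norm_triangle_diff:
  assumes "f \<in> L2 M" "g \<in> L2 M"
  shows "\<bar>L2_norm M f - L2_norm M g\<bar> \<le> L2_norm M (\<lambda>x. f x - g x)"
  using L2_norm_triangle3[OF assms(1,2) L2_zero] L2_norm_triangle3[OF assms(2,1) L2_zero]
    L2_norm_minus_commute[of M f g] by simp

lemma L2_tendsto_add:
  assumes "\<And>n. f n \<in> L2 M" "\<And>n. g n \<in> L2 M" "a \<in> L2 M" "b \<in> L2 M"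
    and "((\<lambda>n. L2_norm M (\<lambda>x. f n x - a x)) \<longlongrightarrow> 0) F" "((\<lambda>n. L2_norm M (\<lambda>x. g n x - b x)) \<longlongrightarrow> 0) F"
  shows "((\<lambda>n. L2_norm M (\<lambda>x. (f n x + g n x) - (a x + b x))) \<longlongrightarrow> 0) F"
proof (rule tendsto_sandwich[OF _ _ tendsto_const])
  show "((\<lambda>n. L2_norm M (\<lambda>x. f n x - a x) + L2_norm M (\<lambda>x. g n x - b x)) \<longlongrightarrow> 0) F"
    using tendsto_add[OF assms(5,6)] by simp
  show "\<forall>\<^sub>F n in F. L2_norm M (\<lambda>x. f n x + g n x - (a x + b x))
      \<le> L2_norm M (\<lambda>x. f n x - a x) + L2_norm M (\<lambda>x. g n x - b x)"
    using L2_norm_triangle[OF L2_diff[OF assms(1,3)] L2_diff[OF assms(2,4)]]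
    by (intro always_eventually) (simp add: algebra_simps)
qed simp

lemma L2_integral_mult_tendsto:
  assumes f: "\<And>n. f n \<in> L2 M" "f' \<in> L2 M" and g: "g \<in> L2 M"
    and lim: "((\<lambda>n. L2_norm M (\<lambda>x. f n x - f' x)) \<longlongrightarrow> 0) F"
  shows "((\<lambda>n. \<integral>x. f n x * g x \<partial>M) \<longlongrightarrow> (\<integral>x. f' x * g x \<partial>M)) F"
proof -
  have "((\<lambda>n. (\<integral>x. f n x * g x \<partial>M) - (\<integral>x. f' x * g x \<partial>M)) \<longlongrightarrow> 0) F"
  proof (rule Lim_null_comparison)
    show "\<forall>\<^sub>F n in F. norm ((\<integral>x. f n x * g x \<partial>M) - (\<integral>x. f' x * g x \<partial>M))
        \<le> L2_norm M (\<lambda>x. f n x - f' x) * L2_norm M g"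
    proof (rule always_eventually, rule allI)
      fix n
      have "(\<integral>x. f n x * g x \<partial>M) - (\<integral>x. f' x * g x \<partial>M) = (\<integral>x. (f n x - f' x) * g x \<partial>M)"
        using f g by (simp add: left_diff_distrib L2_mult_integrable)
      then show "norm ((\<integral>x. f n x * g x \<partial>M) - (\<integral>x. f' x * g x \<partial>M))
          \<le> L2_norm M (\<lambda>x. f n x - f' x) * L2_norm M g"
        using L2_Cauchy_Schwarz[OF L2_diff[OF f] g] by metis
    qed
    show "((\<lambda>n. L2_norm M (\<lambda>x. f n x - f' x) * L2_norm M g) \<longlongrightarrow> 0) F"
      using tendsto_mult_right[OF lim, of "L2_norm M g"] by simp
  qed
  then show ?thesis by (rule Lim_null[THEN iffD2])
qed

text \<open>The limit inherits the bound by \<open>w\<close>, so the squared distance is dominated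
  by the square of twice that bound.\<close>

lemma L2_dominated_convergence:
  fixes w :: "'a \<Rightarrow> complex"
  assumes m: "\<And>n. s n \<in> borel_measurable M" "f \<in> borel_measurable M" and w: "w \<in> L2 M"
    and lim: "AE x in M. (\<lambda>n. s n x) \<longlonglongrightarrow> f x"
    and bd: "\<And>n. AE x in M. cmod (s n x) \<le> cmod (w x)"
  shows "(\<lambda>n. L2_norm M (\<lambda>x. s n x - f x)) \<longlonglongrightarrow> 0"
proof -
  have bf: "AE x in M. cmod (f x) \<le> cmod (w x)"
  proof -
    have "AE x in M. \<forall>n. cmod (s n x) \<le> cmod (w x)" using bd by (simp add: AE_all_countable)
    with lim show ?thesis
    proof eventually_elim
      case (elim x)
      then show ?case by (intro LIMSEQ_le_const2[OF tendsto_norm[OF elim(1)]]) auto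
    qed
  qed
  have "(\<lambda>n. \<integral>x. (cmod (s n x - f x))\<^sup>2 \<partial>M) \<longlonglongrightarrow> (\<integral>x. 0 \<partial>M)"
  proof (rule integral_dominated_convergence[where w = "\<lambda>x. 4 * (cmod (w x))\<^sup>2"])
    show "integrable M (\<lambda>x. 4 * (cmod (w x))\<^sup>2)" using L2_square_integrable[OF w] by simp
    show "AE x in M. (\<lambda>n. (cmod (s n x - f x))\<^sup>2) \<longlonglongrightarrow> 0"
      using lim
    proof eventually_elim
      case (elim x)
      have "(\<lambda>n. (cmod (s n x - f x))\<^sup>2) \<longlonglongrightarrow> (cmod (f x - f x))\<^sup>2"
        by (intro tendsto_intros elim)
      then show ?case by simp
    qed
    show "AE x in M. norm ((cmod (s n x - f x))\<^sup>2) \<le> 4 * (cmod (w x))\<^sup>2" for n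
      using bd[of n] bf
    proof eventually_elim
      case (elim x)
      have "cmod (s n x - f x) \<le> 2 * cmod (w x)"
        using norm_triangle_ineq4[of "s n x" "f x"] elim by simp
      then have "(cmod (s n x - f x))\<^sup>2 \<le> (2 * cmod (w x))\<^sup>2" by (intro power_mono) auto
      then show ?case by (simp add: power_mult_distrib)
    qed
  qed (use m in measurable)
  then show ?thesis unfolding L2_norm_def using tendsto_real_sqrt by fastforce
qed

section \<open>Contraction semigroups\<close>

text \<open>Continuous induction in place of differentiation: fix a slope \<epsilon> and take the
  supremum of the times up to which \<open>\<phi> q \<le> \<epsilon> * q\<close> holds. The
  hypothesis \<open>right\<close> pushes the bound beyond any such time; the modulus
  \<open>\<rho>\<close>, uniform in \<open>t\<close>, lets it survive at the supremum.\<close>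

lemma nonpos_if_right_Dini_nonpos:
  fixes \<phi> \<rho> :: "real \<Rightarrow> real"
  assumes init: "\<phi> 0 \<le> 0"
    and right: "\<And>t \<epsilon>. t \<ge> 0 \<Longrightarrow> \<epsilon> > 0 \<Longrightarrow> \<forall>\<^sub>F s in at_right 0. \<phi> (t + s) \<le> \<phi> t + \<epsilon> * s"
    and left: "\<And>s t. 0 \<le> s \<Longrightarrow> 0 \<le> t \<Longrightarrow> \<phi> (t + s) \<le> \<phi> t + \<rho> s"
    and \<rho>: "(\<rho> \<longlongrightarrow> 0) (at_right 0)"
    and "t \<ge> 0"
  shows "\<phi> t \<le> 0"
proof (rule field_le_epsilon)
  fix e :: real assume "e > 0"
  \<comment> \<open>With \<open>t + 1\<close> instead of \<open>t\<close> the quotient also makes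
    sense for \<open>t = 0\<close>, and \<open>\<epsilon> * t \<le> e\<close> still holds.\<close>
  define \<epsilon> where "\<epsilon> = e / (t + 1)"
  have \<epsilon>: "\<epsilon> > 0" using \<open>e > 0\<close> \<open>t \<ge> 0\<close> by (simp add: \<epsilon>_def)
  define S where "S = {r. 0 \<le> r \<and> r \<le> t \<and> (\<forall>q. 0 \<le> q \<longrightarrow> q \<le> r \<longrightarrow> \<phi> q \<le> \<epsilon> * q)}"
  have S0: "0 \<in> S" using init \<open>t \<ge> 0\<close> unfolding S_def by (auto dest: antisym)
  have bdd: "bdd_above S" unfolding S_def by auto
  define u where "u = Sup S"
  have u: "0 \<le> u" "u \<le> t"
  proof -
    show "0 \<le> u" unfolding u_def by (rule cSup_upper[OF S0 bdd])
    have "S \<noteq> {}" using S0 by blast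
    then show "u \<le> t" unfolding u_def by (rule cSup_least) (simp add: S_def)
  qed
  have below: "\<phi> q \<le> \<epsilon> * q" if "0 \<le> q" "q < u" for q
  proof -
    obtain r where "r \<in> S" "q < r"
      using \<open>q < u\<close> S0 unfolding u_def by (metis less_cSup_iff bdd empty_iff)
    then show ?thesis using \<open>0 \<le> q\<close> by (auto simp: S_def)
  qed
  \<comment> \<open>Just to the left of \<open>u\<close> the bound holds, and \<open>left\<close>
    carries it to \<open>u\<close> with an error \<open>\<rho> s\<close> that tends to 0.\<close>
  have at_u: "\<phi> u \<le> \<epsilon> * u"
  proof (cases "u = 0")
    case False
    then have "u > 0" using u by simp
    have "((\<lambda>s. \<epsilon> * u + \<rho> s) \<longlongrightarrow> \<epsilon> * u + 0) (at_right 0)"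
      by (intro tendsto_intros \<rho>)
    moreover have "\<forall>\<^sub>F s in at_right 0. \<phi> u \<le> \<epsilon> * u + \<rho> s"
      using eventually_at_right_real[OF \<open>u > 0\<close>]
    proof eventually_elim
      case (elim s)
      then have s: "0 < s" "s < u" by auto
      have "\<phi> u \<le> \<phi> (u - s) + \<rho> s" using left[of s "u - s"] s by simp
      also have "\<phi> (u - s) \<le> \<epsilon> * (u - s)" using below s by simp
      also have "\<dots> \<le> \<epsilon> * u" using s \<epsilon> by simp
      finally show ?case by simp
    qed
    ultimately show ?thesis
      by (intro tendsto_lowerbound[where F="at_right 0" and f="\<lambda>s. \<epsilon> * u + \<rho> s"]) auto
  qed (use init in simp)
  have "u = t"
  proof (rule ccontr)
    assume "u \<noteq> t"
    then have "u < t" using u by simp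
    obtain b where b: "b > 0" "\<And>s. 0 < s \<Longrightarrow> s < b \<Longrightarrow> \<phi> (u + s) \<le> \<phi> u + \<epsilon> * s"
      using right[OF u(1) \<epsilon>] unfolding eventually_at_right_field by auto
    define r where "r = u + min (b / 2) (t - u)"
    have r: "u < r" "r \<le> t" "r < u + b" using b \<open>u < t\<close> by (auto simp: r_def)
    have "r \<in> S" unfolding S_def
    proof safe
      fix q assume q: "0 \<le> q" "q \<le> r"
      consider "q < u" | "q = u" | "q > u" by linarith
      then show "\<phi> q \<le> \<epsilon> * q"
      proof cases
        case 3
        then show ?thesis using b(2)[of "q - u"] at_u q r by (simp add: algebra_simps)
      qed (use below q at_u in auto)
    qed (use u r in auto)
    then have "r \<le> u" unfolding u_def using bdd by (rule cSup_upper)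
    then show False using r by simp
  qed
  then have "\<phi> t \<le> \<epsilon> * t" using at_u by simp
  also have "\<dots> \<le> e" using \<open>t \<ge> 0\<close> \<open>e > 0\<close> unfolding \<epsilon>_def by (simp add: field_simps)
  finally show "\<phi> t \<le> 0 + e" by simp
qed

text \<open>Linearity is an equation between functions, not one up to null sets, because the maps
  meant here are pointwise formulas. The semigroup operators are linear only almost everywhere and
  do not fit this locale.\<close>

locale L2_contraction =
  fixes M :: "'a measure" and N :: "'b measure" and J :: "('a \<Rightarrow> complex) \<Rightarrow> 'b \<Rightarrow> complex"
  assumes closed: "f \<in> L2 M \<Longrightarrow> J f \<in> L2 N"
    and contractive: "f \<in> L2 M \<Longrightarrow> L2_norm N (J f) \<le> L2_norm M f"
    and linear: "J (\<lambda>x. f x + c * g x) = (\<lambda>x. J f x + c * J g x)"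
begin

lemma add: "J (\<lambda>x. f x + g x) = (\<lambda>x. J f x + J g x)"
  using linear[of f 1 g] by simp

lemma diff: "J (\<lambda>x. f x - g x) = (\<lambda>x. J f x - J g x)"
  using linear[of f "-1" g] by simp

lemma zero: "J (\<lambda>x. 0) = (\<lambda>x. 0)"
  using linear[of "\<lambda>x. 0" "-1" "\<lambda>x. 0"] by simp

lemma scale: "J (\<lambda>x. c * f x) = (\<lambda>x. c * J f x)"
  using linear[of "\<lambda>x. 0" c f] by (simp add: zero)

lemma divide: "J (\<lambda>x. f x / c) = (\<lambda>x. J f x / c)"
  using scale[of "inverse c" f] by (simp add: field_simps)

lemma sum: "J (\<lambda>x. \<Sum>i\<in>I. c i * f i x) = (\<lambda>x. \<Sum>i\<in>I. c i * J (f i) x)"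
  by (induction I rule: infinite_finite_induct) (simp_all add: zero add scale)

lemma dist:
  assumes "f \<in> L2 M" "g \<in> L2 M"
  shows "L2_norm N (\<lambda>x. J f x - J g x) \<le> L2_norm M (\<lambda>x. f x - g x)"
  using contractive[OF L2_diff[OF assms]] by (simp add: diff)

text \<open>A map on representatives need not respect null sets by itself; being a linear
  contraction forces it, since the distance of the images is 0.\<close>

lemma cong_AE:
  assumes "f \<in> L2 M" "g \<in> L2 M" "AE x in M. f x = g x"
  shows "AE x in N. J f x = J g x"
  using dist[OF assms(1,2)] L2_dist_eq_0_iff[OF assms(1,2)] assms(3)
    L2_dist_eq_0_iff[OF closed[OF assms(1)] closed[OF assms(2)]]
  by (metis L2_norm_nonneg order_antisym)

end

locale contraction_semigroup =
  fixes M :: "'a measure" and A E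
  assumes generates: "generates M A E"
begin

lemma E_L2: "t \<ge> 0 \<Longrightarrow> f \<in> L2 M \<Longrightarrow> E t f \<in> L2 M"
  and E_contractive: "t \<ge> 0 \<Longrightarrow> f \<in> L2 M \<Longrightarrow> L2_norm M (E t f) \<le> L2_norm M f"
  and E_linear: "t \<ge> 0 \<Longrightarrow> f \<in> L2 M \<Longrightarrow> g \<in> L2 M \<Longrightarrow>
    AE x in M. E t (\<lambda>x. f x + c * g x) x = E t f x + c * E t g x"
  and E_0: "f \<in> L2 M \<Longrightarrow> AE x in M. E 0 f x = f x"
  and E_add: "s \<ge> 0 \<Longrightarrow> t \<ge> 0 \<Longrightarrow> f \<in> L2 M \<Longrightarrow> AE x in M. E (s + t) f x = E s (E t f) x"
  and E_continuous: "f \<in> L2 M \<Longrightarrow> ((\<lambda>t. L2_norm M (\<lambda>x. E t f x - f x)) \<longlongrightarrow> 0) (at_right 0)"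
  and E_generator: "f \<in> L2 M \<Longrightarrow> h \<in> L2 M \<Longrightarrow> (f, h) \<in> A \<longleftrightarrow>
    ((\<lambda>t. L2_norm M (\<lambda>x. (E t f x - f x) / of_real t - h x)) \<longlongrightarrow> 0) (at_right 0)"
  using generates unfolding generates_def by blast+

lemma E_diff:
  assumes "t \<ge> 0" "f \<in> L2 M" "g \<in> L2 M"
  shows "AE x in M. E t (\<lambda>x. f x - g x) x = E t f x - E t g x"
  using E_linear[OF assms, of "-1"] by simp

lemma E_zero:
  assumes "t \<ge> 0" shows "AE x in M. E t (\<lambda>x. 0) x = 0"
  using E_diff[OF assms L2_zero L2_zero] by simp

lemma E_scale:
  assumes "t \<ge> 0" "f \<in> L2 M"
  shows "AE x in M. E t (\<lambda>x. c * f x) x = c * E t f x"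
  using E_linear[OF assms(1) L2_zero assms(2), of c] E_zero[OF assms(1)] by eventually_elim simp

lemma E_dist:
  assumes "t \<ge> 0" "f \<in> L2 M" "g \<in> L2 M"
  shows "L2_norm M (\<lambda>x. E t f x - E t g x) \<le> L2_norm M (\<lambda>x. f x - g x)"
proof -
  have "L2_norm M (\<lambda>x. E t f x - E t g x) = L2_norm M (E t (\<lambda>x. f x - g x))"
  proof (intro L2_norm_cong_AE L2_measurable L2_diff E_L2 assms)
    show "AE x in M. E t f x - E t g x = E t (\<lambda>x. f x - g x) x"
      using E_diff[OF assms] by eventually_elim simp
  qed
  also have "\<dots> \<le> L2_norm M (\<lambda>x. f x - g x)"
    by (intro E_contractive L2_diff assms)
  finally show ?thesis .
qed

lemma E_cong_AE:
  assumes "t \<ge> 0" "f \<in> L2 M" "g \<in> L2 M" "AE x in M. f x = g x"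
  shows "AE x in M. E t f x = E t g x"
  using E_dist[OF assms(1-3)] L2_dist_eq_0_iff[OF assms(2,3)] assms(4)
    L2_dist_eq_0_iff[OF E_L2[OF assms(1,2)] E_L2[OF assms(1,3)]]
  by (metis L2_norm_nonneg order_antisym)

lemma E_commute:
  assumes "s \<ge> 0" "t \<ge> 0" "f \<in> L2 M"
  shows "AE x in M. E s (E t f) x = E t (E s f) x"
  using E_add[OF assms] E_add[OF assms(2,1,3)] by eventually_elim (simp add: add.commute)

text \<open>\<open>E t\<close> commutes with \<open>E s\<close>, so up to a null set the difference
  quotient of \<open>E t f\<close> is \<open>E t\<close> applied to that of \<open>f\<close>;
  contractivity carries the convergence over.\<close>

lemma E_preserves_domain:
  assumes "t \<ge> 0" "f \<in> L2 M" "h \<in> L2 M" "(f, h) \<in> A"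
  shows "(E t f, E t h) \<in> A"
proof -
  note L = E_L2[OF \<open>t \<ge> 0\<close>]
  have "((\<lambda>s. L2_norm M (\<lambda>x. (E s f x - f x) / of_real s - h x)) \<longlongrightarrow> 0) (at_right 0)"
    using assms E_generator by blast
  then have "((\<lambda>s. L2_norm M (\<lambda>x. (E s (E t f) x - E t f x) / of_real s - E t h x)) \<longlongrightarrow> 0) (at_right 0)"
  proof (rule Lim_null_comparison[rotated])
    show "\<forall>\<^sub>F s in at_right 0. norm (L2_norm M (\<lambda>x. (E s (E t f) x - E t f x) / of_real s - E t h x))
        \<le> L2_norm M (\<lambda>x. (E s f x - f x) / of_real s - h x)"
      using eventually_at_right_less[of "0::real"]
    proof eventually_elim
      case (elim s)
      then have s: "s \<ge> 0" by simp
      note Ls = E_L2[OF s]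
      let ?q = "\<lambda>x. (E s f x - f x) / of_real s"
      have q: "?q \<in> L2 M" by (intro L2_divide L2_diff Ls assms)
      have "AE x in M. (E s (E t f) x - E t f x) / of_real s - E t h x = E t (\<lambda>x. ?q x - h x) x"
        using E_diff[OF \<open>t \<ge> 0\<close> q \<open>h \<in> L2 M\<close>] E_commute[OF s \<open>t \<ge> 0\<close> \<open>f \<in> L2 M\<close>]
          E_scale[OF \<open>t \<ge> 0\<close> L2_diff[OF Ls[OF \<open>f \<in> L2 M\<close>] \<open>f \<in> L2 M\<close>], of "inverse (of_real s)"]
          E_diff[OF \<open>t \<ge> 0\<close> Ls[OF \<open>f \<in> L2 M\<close>] \<open>f \<in> L2 M\<close>]
        by eventually_elim (simp add: divide_inverse mult.commute)
      then have "L2_norm M (\<lambda>x. (E s (E t f) x - E t f x) / of_real s - E t h x)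
          = L2_norm M (E t (\<lambda>x. ?q x - h x))"
        by (intro L2_norm_cong_AE L2_measurable L2_diff L2_divide L Ls q assms)
      also have "\<dots> \<le> L2_norm M (\<lambda>x. ?q x - h x)"
        by (intro E_contractive L2_diff q assms)
      finally show ?case by simp
    qed
  qed
  then show ?thesis using E_generator L assms by blast
qed

text \<open>
  For \<open>f\<close> in the domain, \<open>\<phi> t = \<parallel>E t (J f) - J (E t f)\<parallel>\<close> has right derivative at most 0, because
  \<open>E s (J u) - J (E s u) = o(s)\<close> for \<open>u = E t f\<close>; no derivative from the left is needed.
\<close>

lemma intertwine_on_domain:
  assumes J: "L2_contraction M M J"
    and JA: "\<And>f h. f \<in> L2 M \<Longrightarrow> h \<in> L2 M \<Longrightarrow> (f, h) \<in> A \<Longrightarrow> (J f, J h) \<in> A"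
    and f: "f \<in> L2 M" "h \<in> L2 M" "(f, h) \<in> A" and t: "t \<ge> 0"
  shows "L2_norm M (\<lambda>x. E t (J f) x - J (E t f) x) = 0"
proof -
  interpret J: L2_contraction M M J by fact
  define \<phi> where "\<phi> t = L2_norm M (\<lambda>x. E t (J f) x - J (E t f) x)" for t
  define \<rho> where "\<rho> s = L2_norm M (\<lambda>x. E s (J f) x - J f x) + L2_norm M (\<lambda>x. E s f x - f x)" for s
  note Jf = J.closed[OF f(1)]
  have wL: "(\<lambda>x. E t (J f) x - J (E t f) x) \<in> L2 M" if "t \<ge> 0" for t
    using that by (intro L2_diff E_L2 J.closed f)
  have "\<phi> t \<le> 0"
  proof (rule nonpos_if_right_Dini_nonpos[where \<phi> = \<phi> and \<rho> = \<rho>])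
    have "AE x in M. J (E 0 f) x = J f x"
      by (intro J.cong_AE E_L2 E_0 f) simp
    then have "AE x in M. E 0 (J f) x - J (E 0 f) x = 0"
      using E_0[OF Jf] by eventually_elim simp
    then show "\<phi> 0 \<le> 0" using L2_norm_eq_0_iff[OF wL[of 0]] by (simp add: \<phi>_def)
  next
    fix t \<epsilon> :: real assume t: "t \<ge> 0" and "\<epsilon> > 0"
    define u k where "u = E t f" and "k = E t h"
    have u: "u \<in> L2 M" "k \<in> L2 M" "(u, k) \<in> A"
      unfolding u_def k_def using t f E_L2 E_preserves_domain by auto
    note Ju = J.closed[OF u(1)] J.closed[OF u(2)]
    have "(J u, J k) \<in> A" using JA u by blast
    then have "((\<lambda>s. L2_norm M (\<lambda>x. (E s (J u) x - J u x) / of_real s - J k x)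
        + L2_norm M (\<lambda>x. (E s u x - u x) / of_real s - k x)) \<longlongrightarrow> 0) (at_right 0)"
      using E_generator[OF u(1,2)] E_generator[OF Ju] u tendsto_add_zero by blast
    then have "\<forall>\<^sub>F s in at_right 0. L2_norm M (\<lambda>x. (E s (J u) x - J u x) / of_real s - J k x)
        + L2_norm M (\<lambda>x. (E s u x - u x) / of_real s - k x) < \<epsilon>"
      using \<open>\<epsilon> > 0\<close> by (rule order_tendstoD)
    then show "\<forall>\<^sub>F s in at_right 0. \<phi> (t + s) \<le> \<phi> t + \<epsilon> * s"
      using eventually_at_right_less[of "0::real"]
    proof eventually_elim
      case (elim s)
      then have s: "s \<ge> 0" "s > 0" by auto
      let ?p = "\<lambda>x. (E s (J u) x - J u x) / of_real s - J k x"
      let ?q = "\<lambda>x. (E s u x - u x) / of_real s - k x"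
      have pq: "?p \<in> L2 M" "?q \<in> L2 M"
        by (intro L2_diff L2_divide E_L2 Ju u s)+
      have Jq: "J ?q = (\<lambda>x. (J (E s u) x - J u x) / of_real s - J k x)"
        by (simp add: J.diff J.divide)
      have E1: "E t (J f) \<in> L2 M" using t Jf E_L2 by blast
      \<comment> \<open>The commutator at time \<open>t + s\<close> is \<open>E s\<close> applied to
        the one at time \<open>t\<close>, plus the commutator of \<open>E s\<close> and
        \<open>J\<close> at \<open>u\<close>. Contractivity bounds the first by
        \<open>\<phi> t\<close>; the second is small compared with \<open>s\<close>, because the
        difference quotient of \<open>J u\<close> and the image under \<open>J\<close> of that of
        \<open>u\<close> both tend to \<open>J k\<close>.\<close>
      have "AE x in M. E (t + s) (J f) x - J (E (t + s) f) x
          = (E s (E t (J f)) x - E s (J u) x) + (E s (J u) x - J (E s u) x)"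
        using E_add[OF s(1) t Jf] J.cong_AE[OF _ _ E_add[OF s(1) t f(1)]] s t f
        by (auto simp: u_def add.commute E_L2)
      then have "\<phi> (t + s) = L2_norm M (\<lambda>x. (E s (E t (J f)) x - E s (J u) x) + (E s (J u) x - J (E s u) x))"
        unfolding \<phi>_def using s t
        by (intro L2_norm_cong_AE L2_measurable L2_diff L2_add E_L2 J.closed Jf Ju f u) auto
      moreover have "\<dots> \<le> L2_norm M (\<lambda>x. E s (E t (J f)) x - E s (J u) x)
          + L2_norm M (\<lambda>x. E s (J u) x - J (E s u) x)"
        by (intro L2_norm_triangle L2_diff E_L2 J.closed Jf u s t)
      moreover have "L2_norm M (\<lambda>x. E s (E t (J f)) x - E s (J u) x) \<le> \<phi> t"
        unfolding \<phi>_def u_def[symmetric] by (rule E_dist[OF s(1) E1 Ju(1)])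
      moreover have "L2_norm M (\<lambda>x. E s (J u) x - J (E s u) x) \<le> \<epsilon> * s"
      proof -
        have "(\<lambda>x. E s (J u) x - J (E s u) x) = (\<lambda>x. of_real s * (?p x - J ?q x))"
          unfolding Jq using s by (auto simp: field_simps)
        then have eq: "L2_norm M (\<lambda>x. E s (J u) x - J (E s u) x) = s * L2_norm M (\<lambda>x. ?p x - J ?q x)"
          using L2_norm_scale[of M "of_real s" "\<lambda>x. ?p x - J ?q x"] s by simp
        have "L2_norm M (\<lambda>x. ?p x - J ?q x) \<le> L2_norm M ?p + L2_norm M (J ?q)"
          using L2_norm_triangle[OF pq(1) L2_uminus[OF J.closed[OF pq(2)]]]
          by (simp add: L2_norm_minus)
        moreover have "L2_norm M (J ?q) \<le> L2_norm M ?q" by (rule J.contractive[OF pq(2)])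
        ultimately have "L2_norm M (\<lambda>x. ?p x - J ?q x) \<le> \<epsilon>"
          using elim(1) by linarith
        then have "L2_norm M (\<lambda>x. E s (J u) x - J (E s u) x) \<le> s * \<epsilon>"
          unfolding eq using s(1) by (rule mult_left_mono)
        then show ?thesis by (simp only: mult.commute)
      qed
      ultimately show ?case by linarith
    qed
  next
    fix s t :: real assume s: "0 \<le> s" and t: "0 \<le> t"
    \<comment> \<open>The increment from \<open>t\<close> to \<open>t + s\<close> is dominated by
      the one from 0 to \<open>s\<close>; hence \<open>\<rho>\<close> can be chosen independently of
      \<open>t\<close>.\<close>
    have comm: "L2_norm M (\<lambda>x. E (t + s) g x - E t g x) \<le> L2_norm M (\<lambda>x. E s g x - g x)"
      if g: "g \<in> L2 M" for g
    proof -
      have "L2_norm M (\<lambda>x. E (t + s) g x - E t g x) = L2_norm M (\<lambda>x. E t (E s g) x - E t g x)"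
        using E_add[OF t s g] s t g
        by (intro L2_norm_cong_AE L2_measurable L2_diff E_L2) auto
      also have "\<dots> \<le> L2_norm M (\<lambda>x. E s g x - g x)"
        by (intro E_dist E_L2 s t g)
      finally show ?thesis .
    qed
    have ts: "t + s \<ge> 0" using s t by simp
    have "\<phi> (t + s) = L2_norm M (\<lambda>x. (E t (J f) x - J (E t f) x)
        + ((E (t + s) (J f) x - E t (J f) x) + (J (E t f) x - J (E (t + s) f) x)))"
      by (simp add: \<phi>_def)
    moreover have "\<dots> \<le> \<phi> t + (L2_norm M (\<lambda>x. E (t + s) (J f) x - E t (J f) x)
        + L2_norm M (\<lambda>x. J (E t f) x - J (E (t + s) f) x))"
      unfolding \<phi>_def
      by (intro order_trans[OF L2_norm_triangle] add_mono order_refl L2_norm_triangle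
          L2_add L2_diff E_L2 J.closed f Jf t ts)
    moreover have "L2_norm M (\<lambda>x. J (E t f) x - J (E (t + s) f) x) \<le> L2_norm M (\<lambda>x. E (t + s) f x - E t f x)"
      unfolding L2_norm_minus_commute[of M "J (E t f)"] by (intro J.dist E_L2 t ts f)
    ultimately show "\<phi> (t + s) \<le> \<phi> t + \<rho> s"
      unfolding \<rho>_def using comm[OF Jf] comm[OF f(1)] by linarith
  next
    show "(\<rho> \<longlongrightarrow> 0) (at_right 0)"
      unfolding \<rho>_def using tendsto_add[OF E_continuous[OF Jf] E_continuous[OF f(1)]] by simp
  qed fact
  then show ?thesis unfolding \<phi>_def by (rule order_antisym) simp
qed

text \<open>Both sides are contractions in \<open>f\<close>, so the equality extends from the dense
  domain: replacing \<open>f\<close> by a domain element closer than \<open>e / 2\<close> costs less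
  than that on either side.\<close>

lemma intertwine:
  assumes J: "L2_contraction M M J"
    and JA: "\<And>f h. f \<in> L2 M \<Longrightarrow> h \<in> L2 M \<Longrightarrow> (f, h) \<in> A \<Longrightarrow> (J f, J h) \<in> A"
    and dense: "\<And>f e. f \<in> L2 M \<Longrightarrow> e > 0 \<Longrightarrow>
      \<exists>g h. g \<in> L2 M \<and> h \<in> L2 M \<and> (g, h) \<in> A \<and> L2_norm M (\<lambda>x. f x - g x) < e"
    and f: "f \<in> L2 M" and t: "t \<ge> 0"
  shows "AE x in M. E t (J f) x = J (E t f) x"
proof -
  interpret J: L2_contraction M M J by fact
  have "L2_norm M (\<lambda>x. E t (J f) x - J (E t f) x) \<le> 0"
  proof (rule field_le_epsilon)
    fix e :: real assume "e > 0"
    then obtain g h where g: "g \<in> L2 M" "h \<in> L2 M" "(g, h) \<in> A"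
        and fg: "L2_norm M (\<lambda>x. f x - g x) < e / 2"
      using dense[OF f, of "e / 2"] by auto
    have "L2_norm M (\<lambda>x. E t (J f) x - J (E t f) x)
       \<le> L2_norm M (\<lambda>x. E t (J f) x - E t (J g) x) + (L2_norm M (\<lambda>x. E t (J g) x - J (E t g) x)
          + L2_norm M (\<lambda>x. J (E t g) x - J (E t f) x))"
      by (intro order_trans[OF L2_norm_triangle3[of _ _ "E t (J g)"]] add_mono order_refl
          L2_norm_triangle3 E_L2 J.closed f g t)
    moreover have "L2_norm M (\<lambda>x. E t (J g) x - J (E t g) x) = 0"
      by (rule intertwine_on_domain[OF J JA g t])
    moreover have "L2_norm M (\<lambda>x. E t (J f) x - E t (J g) x) \<le> L2_norm M (\<lambda>x. f x - g x)"
      by (rule order_trans[OF E_dist[OF t] J.dist]) (intro J.closed f g)+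
    moreover have "L2_norm M (\<lambda>x. J (E t g) x - J (E t f) x) \<le> L2_norm M (\<lambda>x. f x - g x)"
      unfolding L2_norm_minus_commute[of M "J (E t g)"]
      by (rule order_trans[OF J.dist E_dist[OF t]]) (intro E_L2 f g t)+
    ultimately show "L2_norm M (\<lambda>x. E t (J f) x - J (E t f) x) \<le> 0 + e" using fg by linarith
  qed
  then have "L2_norm M (\<lambda>x. E t (J f) x - J (E t f) x) = 0"
    by (rule order_antisym) simp
  then show ?thesis
    using L2_dist_eq_0_iff E_L2 J.closed f t by blast
qed

end

section \<open>Transfer along a coisometry\<close>

lemma L2_dist_cong:
  assumes "f \<in> L2 M" "g \<in> L2 M" "g' \<in> L2 M" "AE x in M. g x = g' x"
  shows "L2_norm M (\<lambda>x. f x - g x) = L2_norm M (\<lambda>x. f x - g' x)"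
  using assms by (intro L2_norm_cong_AE L2_measurable L2_diff) (auto elim: eventually_mono)

text \<open>\<open>left_inverse\<close> is asked for on \<open>space N\<close> only: outside of it
  the values of a representative are arbitrary and cannot be recovered.\<close>

locale L2_coisometry =
  V: L2_contraction N M V + W: L2_contraction M N W
  for M :: "'a measure" and N :: "'b measure" and V W +
  assumes isometry: "f \<in> L2 N \<Longrightarrow> L2_norm M (V f) = L2_norm N f"
    and left_inverse: "x \<in> space N \<Longrightarrow> W (V f) x = f x"
begin

lemma projection: "L2_contraction M M (\<lambda>f. V (W f))"
proof
  show "f \<in> L2 M \<Longrightarrow> L2_norm M (V (W f)) \<le> L2_norm M f" for f
    using W.contractive W.closed isometry by simp
qed (simp_all add: V.closed W.closed V.linear W.linear)

end

text \<open>The first two assumptions make \<open>V W\<close> map the generator \<open>A\<close>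
  into itself, which is the input of \<open>intertwine\<close>. \<open>generator_cong\<close> closes
  the gap left by \<open>W (V f)\<close> returning \<open>f\<close> only on
  \<open>space N\<close>.\<close>

locale semigroup_reduction =
  L2_coisometry M N V W + contraction_semigroup M A E
  for M :: "'a measure" and N :: "'b measure" and V W A E +
  fixes B
  assumes V_generator: "f \<in> L2 N \<Longrightarrow> h \<in> L2 N \<Longrightarrow> (f, h) \<in> B \<Longrightarrow> (V f, V h) \<in> A"
    and W_generator: "g \<in> L2 M \<Longrightarrow> k \<in> L2 M \<Longrightarrow> (g, k) \<in> A \<Longrightarrow> (W g, W k) \<in> B"
    and generator_cong: "(f, h) \<in> B \<Longrightarrow> (\<And>x. x \<in> space N \<Longrightarrow> f x = f' x) \<Longrightarrow>
      (\<And>x. x \<in> space N \<Longrightarrow> h x = h' x) \<Longrightarrow> (f', h') \<in> B"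
    and dense: "g \<in> L2 M \<Longrightarrow> e > 0 \<Longrightarrow>
      \<exists>p q. p \<in> L2 M \<and> q \<in> L2 M \<and> (p, q) \<in> A \<and> L2_norm M (\<lambda>x. g x - p x) < e"
begin

definition reduced where "reduced t f = W (E t (V f))"

lemma E_projection:
  assumes "t \<ge> 0" "f \<in> L2 M"
  shows "AE x in M. E t (V (W f)) x = V (W (E t f)) x"
proof (rule intertwine[OF projection _ dense assms(2,1)])
  fix f h assume "f \<in> L2 M" "h \<in> L2 M" "(f, h) \<in> A"
  then show "(V (W f), V (W h)) \<in> A"
    by (intro V_generator W_generator W.closed)
qed

text \<open>\<open>V W\<close> is the identity on the range of \<open>V\<close> and commutes with
  \<open>E t\<close>, so the range of \<open>V\<close> is invariant under the semigroup.\<close>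

lemma V_reduced:
  assumes t: "t \<ge> 0" and f: "f \<in> L2 N"
  shows "AE x in M. V (reduced t f) x = E t (V f) x"
proof -
  have "AE x in M. V (W (V f)) x = V f x"
    by (intro V.cong_AE W.closed V.closed f AE_I2 left_inverse)
  then have "AE x in M. E t (V (W (V f))) x = E t (V f) x"
    by (intro E_cong_AE W.closed V.closed f t)
  with E_projection[OF t V.closed[OF f]] show ?thesis
    unfolding reduced_def by eventually_elim simp
qed

text \<open>Insert \<open>V\<close> and \<open>W\<close> in front, where they cancel, and move the
  projection \<open>V W\<close> through \<open>E t\<close>.\<close>

lemma W_intertwines:
  assumes t: "t \<ge> 0" and f: "f \<in> L2 M"
  shows "AE x in N. W (E t f) x = reduced t (W f) x"
proof -
  have "AE x in N. W (V (W (E t f))) x = reduced t (W f) x"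
    unfolding reduced_def using E_projection[OF t f]
    by (intro W.cong_AE E_L2 V.closed W.closed t f) (auto elim: eventually_mono)
  then show ?thesis
    using AE_space by eventually_elim (simp add: left_inverse)
qed

lemma reduced_L2: "t \<ge> 0 \<Longrightarrow> f \<in> L2 N \<Longrightarrow> reduced t f \<in> L2 N"
  unfolding reduced_def by (intro W.closed E_L2 V.closed)

lemma dist_reduced:
  assumes "t \<ge> 0" "f \<in> L2 N"
  shows "L2_norm N (\<lambda>x. reduced t f x - f x) \<le> L2_norm M (\<lambda>x. E t (V f) x - V f x)"
proof -
  have "L2_norm N (\<lambda>x. reduced t f x - f x) = L2_norm N (\<lambda>x. W (E t (V f)) x - W (V f) x)"
    by (intro L2_norm_cong) (simp add: reduced_def left_inverse)
  also have "\<dots> \<le> L2_norm M (\<lambda>x. E t (V f) x - V f x)"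
    by (intro W.dist E_L2 V.closed assms)
  finally show ?thesis .
qed

lemma generates_reduced: "generates N B reduced"
  unfolding generates_def
proof (intro conjI ballI allI impI)
  fix t :: real and f assume t: "0 \<le> t" and f: "f \<in> L2 N"
  show "reduced t f \<in> L2 N" by (rule reduced_L2[OF t f])
  have "L2_norm N (reduced t f) \<le> L2_norm M (E t (V f))"
    unfolding reduced_def by (intro W.contractive E_L2 V.closed t f)
  also have "\<dots> \<le> L2_norm M (V f)" by (intro E_contractive V.closed t f)
  finally show "L2_norm N (reduced t f) \<le> L2_norm N f" by (simp add: isometry f)
next
  fix t :: real and f g c assume t: "0 \<le> t" and f: "f \<in> L2 N" and g: "g \<in> L2 N"
  have "AE x in N. W (E t (\<lambda>x. V f x + c * V g x)) x = W (\<lambda>x. E t (V f) x + c * E t (V g) x) x"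
    by (intro W.cong_AE E_linear E_L2 V.closed L2_add L2_scale t f g)
  then show "AE x in N. reduced t (\<lambda>x. f x + c * g x) x = reduced t f x + c * reduced t g x"
    unfolding reduced_def V.linear W.linear .
next
  fix f assume f: "f \<in> L2 N"
  have "AE x in N. reduced 0 f x = W (V f) x"
    unfolding reduced_def by (intro W.cong_AE E_0 E_L2 V.closed f) simp
  then show "AE x in N. reduced 0 f x = f x"
    using AE_space by eventually_elim (simp add: left_inverse)
next
  fix s t :: real and f assume s: "0 \<le> s" and t: "0 \<le> t" and f: "f \<in> L2 N"
  have "AE x in N. reduced (s + t) f x = W (E s (E t (V f))) x"
    unfolding reduced_def using s t by (intro W.cong_AE E_add E_L2 V.closed f) simp_all
  \<comment> \<open>Composing two reduced operators leaves a \<open>V W\<close> between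
    \<open>E s\<close> and \<open>E t\<close>; it is absorbed because the range of \<open>V\<close>
    is invariant.\<close>
  moreover have "AE x in N. W (E s (V (reduced t f))) x = W (E s (E t (V f))) x"
    by (intro W.cong_AE E_cong_AE E_L2 V.closed reduced_L2 V_reduced f s t)
  ultimately show "AE x in N. reduced (s + t) f x = reduced s (reduced t f) x"
    unfolding reduced_def[of s] by eventually_elim simp
next
  fix f assume f: "f \<in> L2 N"
  show "((\<lambda>t. L2_norm N (\<lambda>x. reduced t f x - f x)) \<longlongrightarrow> 0) (at_right 0)"
  proof (rule Lim_null_comparison[OF _ E_continuous[OF V.closed[OF f]]])
    show "\<forall>\<^sub>F t in at_right 0. norm (L2_norm N (\<lambda>x. reduced t f x - f x))
        \<le> L2_norm M (\<lambda>x. E t (V f) x - V f x)"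
      using eventually_at_right_less[of "0::real"] by eventually_elim (simp add: dist_reduced f)
  qed
next
  fix f h assume f: "f \<in> L2 N" and h: "h \<in> L2 N"
  let ?q = "\<lambda>t x. (reduced t f x - f x) / of_real t - h x"
  let ?Q = "\<lambda>t x. (E t (V f) x - V f x) / of_real t - V h x"
  have Q: "?q t \<in> L2 N" "?Q t \<in> L2 M" "AE x in M. V (?q t) x = ?Q t x" if "t \<ge> 0" for t
  proof -
    show "?q t \<in> L2 N" using that by (intro L2_diff L2_divide reduced_L2 f h)
    show "?Q t \<in> L2 M" using that by (intro L2_diff L2_divide E_L2 V.closed f h)
    show "AE x in M. V (?q t) x = ?Q t x"
      using V_reduced[OF that f] unfolding V.diff V.divide by eventually_elim simp
  qed
  \<comment> \<open>\<open>V\<close> is isometric and maps the difference quotient on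
    \<open>N\<close> to the one on \<open>M\<close>, so one tends to 0 exactly when the other
    does.\<close>
  have VQ: "L2_norm N (?q t) = L2_norm M (?Q t)" if "t \<ge> 0" for t
  proof -
    have "L2_norm N (?q t) = L2_norm M (V (?q t))"
      using isometry[OF Q(1)[OF that]] by simp
    also have "\<dots> = L2_norm M (?Q t)"
      by (intro L2_norm_cong_AE L2_measurable V.closed Q that)
    finally show ?thesis .
  qed
  have ev: "\<forall>\<^sub>F t in at_right 0. L2_norm N (?q t) = L2_norm M (?Q t)"
    using eventually_at_right_less[of "0::real"] by eventually_elim (simp add: VQ)
  have "(f, h) \<in> B \<longleftrightarrow> (V f, V h) \<in> A"
  proof
    assume "(V f, V h) \<in> A"
    then have "(W (V f), W (V h)) \<in> B" by (intro W_generator V.closed f h)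
    then show "(f, h) \<in> B" by (rule generator_cong) (simp_all add: left_inverse)
  qed (rule V_generator[OF f h])
  also have "\<dots> \<longleftrightarrow> ((\<lambda>t. L2_norm M (?Q t)) \<longlongrightarrow> 0) (at_right 0)"
    by (rule E_generator) (intro V.closed f h)+
  also have "\<dots> \<longleftrightarrow> ((\<lambda>t. L2_norm N (?q t)) \<longlongrightarrow> 0) (at_right 0)"
    using tendsto_cong[OF ev] by simp
  finally show "(f, h) \<in> B \<longleftrightarrow> ((\<lambda>t. L2_norm N (?q t)) \<longlongrightarrow> 0) (at_right 0)" .
qed

end

section \<open>Bochner integrals under contractions\<close>

lemma (in L2_contraction) simple:
  assumes "L2_simple T M s" shows "L2_simple T N (\<lambda>t. J (s t))"
proof -
  have "{t \<in> space T. J (s t) = y} = (\<Union>z \<in> {z \<in> s ` space T. J z = y}. {t \<in> space T. s t = z})" for y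
    by auto
  moreover have "(\<Union>z \<in> {z \<in> s ` space T. J z = y}. {t \<in> space T. s t = z}) \<in> sets T" for y
    using assms unfolding L2_simple_def by (intro sets.finite_UN) auto
  ultimately show ?thesis
    using assms finite_imageI[of "s ` space T" J] closed
    unfolding L2_simple_def by (auto simp: image_image)
qed

text \<open>\<open>J\<close> may identify different values of \<open>s\<close>, so a level set of
  the image is a finite disjoint union of level sets of \<open>s\<close>. Regrouping the sum along
  the fibres of \<open>J\<close> and using linearity gives the claim.\<close>

lemma (in L2_contraction) simple_integral:
  assumes "finite_measure T" and s: "L2_simple T M s"
  shows "L2_simple_integral T (\<lambda>t. J (s t)) = J (L2_simple_integral T s)"
proof
  interpret finite_measure T by fact
  fix x
  let ?S = "s ` space T"
  have fin: "finite ?S" using s by (simp add: L2_simple_def)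
  have "measure T {t \<in> space T. J (s t) = y} = (\<Sum>z \<in> {z \<in> ?S. J z = y}. measure T {t \<in> space T. s t = z})" for y
  proof -
    have "{t \<in> space T. J (s t) = y} = (\<Union>z \<in> {z \<in> ?S. J z = y}. {t \<in> space T. s t = z})"
      by auto
    moreover have "measure T (\<Union>z \<in> {z \<in> ?S. J z = y}. {t \<in> space T. s t = z})
        = (\<Sum>z \<in> {z \<in> ?S. J z = y}. measure T {t \<in> space T. s t = z})"
      using s fin by (intro finite_measure_finite_Union) (auto simp: L2_simple_def disjoint_family_on_def)
    ultimately show ?thesis by simp
  qed
  then have "L2_simple_integral T (\<lambda>t. J (s t)) x
      = (\<Sum>y \<in> J ` ?S. \<Sum>z \<in> {z \<in> ?S. J z = y}. of_real (measure T {t \<in> space T. s t = z}) * J z x)"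
    unfolding L2_simple_integral_def
    by (auto simp: image_image sum_distrib_right intro!: sum.cong)
  also have "\<dots> = (\<Sum>z \<in> ?S. of_real (measure T {t \<in> space T. s t = z}) * J z x)"
    by (rule sum.group) (use fin in auto)
  also have "\<dots> = J (L2_simple_integral T s) x"
    using sum[of "\<lambda>z. of_real (measure T {t \<in> space T. s t = z})" "\<lambda>z. z" ?S]
    unfolding L2_simple_integral_def by (rule fun_cong[symmetric])
  finally show "L2_simple_integral T (\<lambda>t. J (s t)) x = J (L2_simple_integral T s) x" .
qed

lemma L2_simple_L2: "L2_simple T M s \<Longrightarrow> t \<in> space T \<Longrightarrow> s t \<in> L2 M"
  by (auto simp: L2_simple_def)

lemma (in L2_contraction) strongly_measurable:
  assumes "L2_strongly_measurable T M w"
  shows "L2_strongly_measurable T N (\<lambda>t. J (w t))"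
proof -
  obtain s where s: "\<And>n::nat. L2_simple T M (s n)"
    and lim: "AE t in T. (\<lambda>n. L2_norm M (\<lambda>x. s n t x - w t x)) \<longlonglongrightarrow> 0"
    and w: "\<And>t. t \<in> space T \<Longrightarrow> w t \<in> L2 M"
    using assms unfolding L2_strongly_measurable_def by blast
  have "AE t in T. (\<lambda>n. L2_norm N (\<lambda>x. J (s n t) x - J (w t) x)) \<longlonglongrightarrow> 0"
    using lim AE_space
  proof eventually_elim
    case (elim t)
    then show ?case
      using dist[OF L2_simple_L2[OF s] w] by (intro Lim_null_comparison[OF _ elim(1)]) auto
  qed
  then show ?thesis
    unfolding L2_strongly_measurable_def using simple[OF s] closed w
    by (intro conjI exI[where x = "\<lambda>n t. J (s n t)"] allI ballI) auto
qed

lemma L2_strongly_measurable_cong: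
  assumes "L2_strongly_measurable T M w"
    and w': "\<And>t. t \<in> space T \<Longrightarrow> w' t \<in> L2 M" "\<And>t. t \<in> space T \<Longrightarrow> AE x in M. w t x = w' t x"
  shows "L2_strongly_measurable T M w'"
proof -
  obtain s where s: "\<And>n::nat. L2_simple T M (s n)"
    and lim: "AE t in T. (\<lambda>n. L2_norm M (\<lambda>x. s n t x - w t x)) \<longlonglongrightarrow> 0"
    and w: "\<And>t. t \<in> space T \<Longrightarrow> w t \<in> L2 M"
    using assms unfolding L2_strongly_measurable_def by blast
  have "AE t in T. (\<lambda>n. L2_norm M (\<lambda>x. s n t x - w' t x)) \<longlonglongrightarrow> 0"
    using lim AE_space
  proof eventually_elim
    case (elim t)
    then show ?case using L2_dist_cong[OF L2_simple_L2[OF s] w w'] by simp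
  qed
  with s w' show ?thesis unfolding L2_strongly_measurable_def by blast
qed

lemma (in L2_contraction) has_integral:
  assumes "finite_measure T" and "has_L2_integral T M w h"
  shows "has_L2_integral T N (\<lambda>t. J (w t)) (J h)"
proof -
  obtain s where s: "\<And>n::nat. L2_simple T M (s n)"
    and lim: "(\<lambda>n. \<integral>\<^sup>+t. ennreal (L2_norm M (\<lambda>x. s n t x - w t x)) \<partial>T) \<longlonglongrightarrow> 0"
      "(\<lambda>n. L2_norm M (\<lambda>x. L2_simple_integral T (s n) x - h x)) \<longlonglongrightarrow> 0"
    and sm: "L2_strongly_measurable T M w" and h: "h \<in> L2 M"
    using assms unfolding has_L2_integral_def by blast
  have w: "\<And>t. t \<in> space T \<Longrightarrow> w t \<in> L2 M" using sm by (simp add: L2_strongly_measurable_def)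
  have "(\<lambda>n. \<integral>\<^sup>+t. ennreal (L2_norm N (\<lambda>x. J (s n t) x - J (w t) x)) \<partial>T) \<longlonglongrightarrow> 0"
  proof (rule tendsto_sandwich[OF _ _ tendsto_const lim(1)])
    show "\<forall>\<^sub>F n in sequentially. (\<integral>\<^sup>+t. ennreal (L2_norm N (\<lambda>x. J (s n t) x - J (w t) x)) \<partial>T)
        \<le> (\<integral>\<^sup>+t. ennreal (L2_norm M (\<lambda>x. s n t x - w t x)) \<partial>T)"
      by (intro always_eventually allI nn_integral_mono ennreal_leI dist L2_simple_L2[OF s] w)
  qed simp
  moreover have "(\<lambda>n. L2_norm N (\<lambda>x. L2_simple_integral T (\<lambda>t. J (s n t)) x - J h x)) \<longlonglongrightarrow> 0"
  proof (rule Lim_null_comparison[OF _ lim(2)])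
    have "L2_simple_integral T (s n) \<in> L2 M" for n
      using s[of n] unfolding L2_simple_integral_def L2_simple_def by (intro L2_sum L2_scale) auto
    then show "\<forall>\<^sub>F n in sequentially. norm (L2_norm N (\<lambda>x. L2_simple_integral T (\<lambda>t. J (s n t)) x - J h x))
        \<le> L2_norm M (\<lambda>x. L2_simple_integral T (s n) x - h x)"
      using dist h by (simp add: simple_integral[OF assms(1) s])
  qed
  ultimately show ?thesis
    unfolding has_L2_integral_def using strongly_measurable[OF sm] closed[OF h] simple[OF s]
    by (intro conjI exI[where x = "\<lambda>n t. J (s n t)"] allI)
qed

lemma has_L2_integral_cong:
  assumes "has_L2_integral T M w h"
    and w': "\<And>t. t \<in> space T \<Longrightarrow> w' t \<in> L2 M" "\<And>t. t \<in> space T \<Longrightarrow> AE x in M. w t x = w' t x"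
  shows "has_L2_integral T M w' h"
proof -
  have sm: "L2_strongly_measurable T M w" using assms(1) by (simp add: has_L2_integral_def)
  then have w: "\<And>t. t \<in> space T \<Longrightarrow> w t \<in> L2 M" by (simp add: L2_strongly_measurable_def)
  have "(\<integral>\<^sup>+t. ennreal (L2_norm M (\<lambda>x. s t x - w' t x)) \<partial>T)
      = (\<integral>\<^sup>+t. ennreal (L2_norm M (\<lambda>x. s t x - w t x)) \<partial>T)" if "L2_simple T M s" for s
    by (intro nn_integral_cong arg_cong[where f=ennreal] L2_dist_cong[symmetric] L2_simple_L2[OF that] w w')
  then have "(\<lambda>n. \<integral>\<^sup>+t. ennreal (L2_norm M (\<lambda>x. s n t x - w' t x)) \<partial>T)
      = (\<lambda>n. \<integral>\<^sup>+t. ennreal (L2_norm M (\<lambda>x. s n t x - w t x)) \<partial>T)" if "\<forall>n. L2_simple T M (s n)"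
    for s :: "nat \<Rightarrow> _"
    using that by simp
  with assms(1) L2_strongly_measurable_cong[OF sm w'] show ?thesis
    unfolding has_L2_integral_def by force
qed

lemma (in complete_measure) borel_measurable_cong_AE:
  fixes f g :: "'a \<Rightarrow> 'b::topological_space"
  assumes f: "f \<in> borel_measurable M" and ae: "AE x in M. f x = g x"
  shows "g \<in> borel_measurable M"
proof (rule measurableI)
  fix A :: "'b set" assume A: "A \<in> sets borel"
  show "g -` A \<inter> space M \<in> sets M"
  proof (rule in_sets_AE)
    show "f -` A \<inter> space M \<in> sets M" using f A by (rule measurable_sets)
    show "AE x in M. x \<in> f -` A \<inter> space M \<longleftrightarrow> x \<in> g -` A \<inter> space M"
      using ae by eventually_elim auto
  qed auto
qed simp

lemma complete_measure_lebesgue_on: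
  assumes "S \<in> sets lebesgue" shows "complete_measure (lebesgue_on S)"
proof
  fix A B assume "B \<subseteq> A" "A \<in> null_sets (lebesgue_on S)"
  then show "B \<in> sets (lebesgue_on S)"
    using assms null_sets_restrict_space[of S lebesgue A] completion.complete2[of B A lborel]
    by (auto simp: sets_restrict_space_iff)
qed

text \<open>Strong measurability yields the norm only as an almost-everywhere limit of simple
  functions; completeness of the time measure makes such a limit measurable.
  \<open>lebesgue_on\<close> has this completeness.\<close>

lemma borel_measurable_L2_norm:
  assumes T: "complete_measure T" and w: "L2_strongly_measurable T M w"
  shows "(\<lambda>t. L2_norm M (w t)) \<in> borel_measurable T"
proof -
  obtain s where s: "\<And>n::nat. L2_simple T M (s n)"
    and lim: "AE t in T. (\<lambda>n. L2_norm M (\<lambda>x. s n t x - w t x)) \<longlonglongrightarrow> 0"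
    and w: "\<And>t. t \<in> space T \<Longrightarrow> w t \<in> L2 M"
    using w unfolding L2_strongly_measurable_def by blast
  have ms: "(\<lambda>t. L2_norm M (s n t)) \<in> borel_measurable T" for n
  proof -
    have "{t \<in> space T. s n t = y} = s n -` {y} \<inter> space T" for y by auto
    then have "simple_function T (s n)"
      using s[of n] unfolding simple_function_def L2_simple_def by simp
    then have "simple_function T (L2_norm M \<circ> s n)" by (rule simple_function_compose)
    then show ?thesis using borel_measurable_simple_function by (simp add: o_def)
  qed
  have "AE t in T. lim (\<lambda>n. L2_norm M (s n t)) = L2_norm M (w t)"
    using lim AE_space
  proof eventually_elim
    case (elim t)
    have "(\<lambda>n. L2_norm M (s n t) - L2_norm M (w t)) \<longlonglongrightarrow> 0"
      by (rule Lim_null_comparison[OF _ elim(1)], intro always_eventually allI)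
        (unfold real_norm_def, rule L2_norm_triangle_diff[OF L2_simple_L2[OF s elim(2)] w[OF elim(2)]])
    then show ?case by (intro limI) (rule Lim_null[THEN iffD2])
  qed
  moreover have "(\<lambda>t. lim (\<lambda>n. L2_norm M (s n t))) \<in> borel_measurable T"
    by (rule borel_measurable_lim_metric[OF ms])
  ultimately show ?thesis by (rule complete_measure.borel_measurable_cong_AE[OF T, rotated])
qed

lemma (in L2_contraction) L2_L2:
  assumes T: "complete_measure T" and v: "v \<in> L2_L2 T M"
  shows "(\<lambda>t. J (v t)) \<in> L2_L2 T N"
proof -
  have sm: "L2_strongly_measurable T M v" and i: "integrable T (\<lambda>t. (L2_norm M (v t))\<^sup>2)"
    using v by (simp_all add: L2_L2_def)
  then have w: "\<And>t. t \<in> space T \<Longrightarrow> v t \<in> L2 M" by (simp add: L2_strongly_measurable_def)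
  have "integrable T (\<lambda>t. (L2_norm N (J (v t)))\<^sup>2)"
    using borel_measurable_L2_norm[OF T strongly_measurable[OF sm]] contractive w
    by (intro Bochner_Integration.integrable_bound[OF i]) (auto intro!: AE_I2 power_mono)
  then show ?thesis using strongly_measurable[OF sm] by (simp add: L2_L2_def)
qed

section \<open>Smooth functions and test functions\<close>

abbreviation flip :: "nat \<Rightarrow> nat" where
  "flip \<equiv> Transposition.transpose 0 (Suc 0)"

text \<open>As composition with a permutation of all indices this is an involution on arbitrary
  functions, and it preserves \<open>euclid d\<close> for every \<open>d \<ge> 2\<close>, so both
  dimensions are served by one map.\<close>

definition swap :: "point \<Rightarrow> point" where
  "swap x = x \<circ> flip"

lemma swap_apply: "swap x i = x (flip i)"
  by (simp add: swap_def)

lemma swap_0 [simp]: "swap x 0 = x 1"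
  and swap_1 [simp]: "swap x (Suc 0) = x 0"
  by (simp_all add: swap_apply Transposition.transpose_def)

lemma swap_swap [simp]: "swap (swap x) = x"
  by (simp add: swap_def fun_eq_iff)

lemma flip_less_iff [simp]: "2 \<le> d \<Longrightarrow> flip i < d \<longleftrightarrow> i < (d::nat)"
  by (auto simp: Transposition.transpose_def)

lemma swap_in_euclid_iff [simp]: "2 \<le> d \<Longrightarrow> swap x \<in> euclid d \<longleftrightarrow> x \<in> euclid d"
  unfolding euclid_def PiE_iff extensional_def swap_def
  by (auto simp: Transposition.transpose_def split: if_splits)

lemma swap_fun_upd: "swap (x(i := t)) = (swap x)(flip i := t)"
proof
  fix j
  have "flip j = i \<longleftrightarrow> j = flip i" by auto
  then show "swap (x(i := t)) j = ((swap x)(flip i := t)) j"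
    by (simp add: swap_apply)
qed

lemma fun_upd_in_euclid [simp]: "x \<in> euclid d \<Longrightarrow> i < d \<Longrightarrow> x(i := t) \<in> euclid d"
  by (auto simp: euclid_def PiE_iff extensional_def)

lemma continuous_on_coordinate: "continuous_on S (\<lambda>x::point. x i)"
  by (rule continuous_on_product_then_coordinatewise[OF continuous_on_id])

lemma continuous_on_swap: "continuous_on S swap"
  by (intro continuous_on_coordinatewise_then_product) (simp add: swap_apply continuous_on_coordinate)

lemma continuous_on_fun_upd: "continuous_on S (\<lambda>t. (x::point)(i := t))"
proof (rule continuous_on_coordinatewise_then_product)
  show "continuous_on S (\<lambda>t. (x(i := t)) j)" for j
    by (cases "i = j") (auto intro: continuous_intros)
qed

abbreviation has_partial :: "nat \<Rightarrow> (point \<Rightarrow> complex) \<Rightarrow> complex \<Rightarrow> point \<Rightarrow> bool" where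
  "has_partial i \<phi> D x \<equiv> ((\<lambda>t. \<phi> (x(i := t))) has_vector_derivative D) (at (x i))"

lemma partial_eqI: "has_partial i \<phi> D x \<Longrightarrow> partial i \<phi> x = D"
  unfolding partial_def by (rule vector_derivative_at)

text \<open>\<open>smooth\<close> speaks of all iterated partial derivatives at once. Here
  \<open>P\<close> plays the role of an invariant: its members are continuous, and their partial
  derivatives agree on \<open>euclid d\<close> with members again. Agreement there suffices, because
  coordinate lines through points of \<open>euclid d\<close> stay in it.\<close>

lemma smooth_coinduct:
  assumes "P \<phi>"
    and step: "\<And>\<psi>. P \<psi> \<Longrightarrow> continuous_on (euclid d) \<psi> \<and>
      (\<forall>i<d. \<exists>\<zeta>. P \<zeta> \<and> (\<forall>x\<in>euclid d. has_partial i \<psi> (\<zeta> x) x))"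
  shows "smooth d \<phi>"
proof -
  have main: "\<exists>\<zeta>. P \<zeta> \<and> (\<forall>x\<in>euclid d. foldr partial is \<phi> x = \<zeta> x)" if "set is \<subseteq> {..<d}" for "is"
    using that
  proof (induction "is")
    case Nil
    then show ?case using \<open>P \<phi>\<close> by auto
  next
    case (Cons i "is")
    then obtain \<zeta> where \<zeta>: "P \<zeta>" "\<And>x. x \<in> euclid d \<Longrightarrow> foldr partial is \<phi> x = \<zeta> x" by auto
    have "i < d" using Cons.prems by simp
    then obtain \<zeta>' where \<zeta>': "P \<zeta>'" "\<And>x. x \<in> euclid d \<Longrightarrow> has_partial i \<zeta> (\<zeta>' x) x"
      using step[OF \<zeta>(1)] by blast
    have "partial i (foldr partial is \<phi>) x = \<zeta>' x" if "x \<in> euclid d" for x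
    proof (rule partial_eqI)
      have "foldr partial is \<phi> (x(i := t)) = \<zeta> (x(i := t))" for t
        using \<zeta>(2) that \<open>i < d\<close> by simp
      then show "has_partial i (foldr partial is \<phi>) (\<zeta>' x) x" using \<zeta>'(2)[OF that] by simp
    qed
    then show ?case using \<zeta>'(1) by auto
  qed
  show ?thesis unfolding smooth_def
  proof (intro allI impI conjI ballI)
    fix "is" :: "nat list" assume "set is \<subseteq> {..<d}"
    then obtain \<zeta> where \<zeta>: "P \<zeta>" "\<And>x. x \<in> euclid d \<Longrightarrow> foldr partial is \<phi> x = \<zeta> x"
      using main by blast
    then show "continuous_on (euclid d) (foldr partial is \<phi>)"
      using step[OF \<zeta>(1)] continuous_on_cong[OF refl, of "euclid d" "foldr partial is \<phi>" \<zeta>] by simp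
    fix i x assume "i < d" "x \<in> euclid d"
    then have "foldr partial is \<phi> (x(i := t)) = \<zeta> (x(i := t))" for t using \<zeta>(2) by simp
    then show "(\<lambda>t. foldr partial is \<phi> (x(i := t))) differentiable at (x i)"
      using step[OF \<zeta>(1)] \<open>i < d\<close> \<open>x \<in> euclid d\<close> differentiableI_vector
      by (auto; blast)
  qed
qed

lemma smooth_continuous: "smooth d \<phi> \<Longrightarrow> continuous_on (euclid d) \<phi>"
  unfolding smooth_def by (drule spec[of _ "[]"]) simp

lemma smooth_has_partial:
  assumes "smooth d \<phi>" "i < d" "x \<in> euclid d"
  shows "has_partial i \<phi> (partial i \<phi> x) x"
proof -
  have "(\<lambda>t. \<phi> (x(i := t))) differentiable at (x i)"
    using spec[OF assms(1)[unfolded smooth_def], of "[]"] assms by simp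
  then show ?thesis unfolding partial_def by (simp add: vector_derivative_works)
qed

lemma smooth_has_vector_derivative:
  assumes "smooth d \<phi>" "i < d" "x \<in> euclid d"
  shows "((\<lambda>t. \<phi> (x(i := t))) has_vector_derivative partial i \<phi> (x(i := t))) (at t)"
  using smooth_has_partial[OF assms(1,2), of "x(i := t)"] assms by simp

lemma smooth_partial:
  assumes "smooth d \<phi>" "i < d" shows "smooth d (partial i \<phi>)"
  unfolding smooth_def
proof (intro allI impI)
  fix "is" :: "nat list" assume "set is \<subseteq> {..<d}"
  then have "set (is @ [i]) \<subseteq> {..<d}" using assms by simp
  then show "continuous_on (euclid d) (foldr partial is (partial i \<phi>)) \<and>
      (\<forall>j<d. \<forall>x\<in>euclid d. (\<lambda>t. foldr partial is (partial i \<phi>) (x(j := t))) differentiable at (x j))"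
    using spec[OF assms(1)[unfolded smooth_def], of "is @ [i]"] by simp
qed

lemma smooth_const: "smooth d (\<lambda>x. c)"
  by (rule smooth_coinduct[where P = "\<lambda>\<phi>. \<exists>c. \<phi> = (\<lambda>x. c)"]) (auto intro!: exI derivative_eq_intros)

lemma smooth_linear:
  assumes "smooth d \<phi>" "smooth d \<psi>"
  shows "smooth d (\<lambda>x. \<phi> x + c * \<psi> x)"
proof (rule smooth_coinduct[where P = "\<lambda>f. \<exists>\<phi> \<psi>. smooth d \<phi> \<and> smooth d \<psi> \<and> f = (\<lambda>x. \<phi> x + c * \<psi> x)"])
  fix f assume "\<exists>\<phi> \<psi>. smooth d \<phi> \<and> smooth d \<psi> \<and> f = (\<lambda>x. \<phi> x + c * \<psi> x)"
  then obtain \<phi> \<psi> where s: "smooth d \<phi>" "smooth d \<psi>" and f: "f = (\<lambda>x. \<phi> x + c * \<psi> x)" by blast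
  have "has_partial i f (partial i \<phi> x + c * partial i \<psi> x) x" if "i < d" "x \<in> euclid d" for i x
    unfolding f using that s
    by (intro has_vector_derivative_add has_vector_derivative_mult_right smooth_has_partial)
  then show "continuous_on (euclid d) f \<and> (\<forall>i<d. \<exists>\<zeta>. (\<exists>\<phi> \<psi>. smooth d \<phi> \<and> smooth d \<psi> \<and>
      \<zeta> = (\<lambda>x. \<phi> x + c * \<psi> x)) \<and> (\<forall>x\<in>euclid d. has_partial i f (\<zeta> x) x))"
    using s smooth_partial unfolding f
    by (intro conjI allI impI continuous_intros smooth_continuous) blast+
qed (use assms in blast)

text \<open>By the Leibniz rule products alone are not closed under differentiation, but their
  finite sums are; this class is the invariant for \<open>smooth_coinduct\<close>.\<close>

inductive smooth_products :: "nat \<Rightarrow> (point \<Rightarrow> complex) \<Rightarrow> bool" for d where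
  prod: "smooth d \<phi> \<Longrightarrow> smooth d \<psi> \<Longrightarrow> smooth_products d (\<lambda>x. \<phi> x * \<psi> x)"
| add: "smooth_products d f \<Longrightarrow> smooth_products d g \<Longrightarrow> smooth_products d (\<lambda>x. f x + g x)"

lemma smooth_products_step:
  assumes "smooth_products d f"
  shows "continuous_on (euclid d) f \<and>
    (\<forall>i<d. \<exists>\<zeta>. smooth_products d \<zeta> \<and> (\<forall>x\<in>euclid d. has_partial i f (\<zeta> x) x))"
  using assms
proof induction
  case (prod \<phi> \<psi>)
  have "\<exists>\<zeta>. smooth_products d \<zeta> \<and> (\<forall>x\<in>euclid d. has_partial i (\<lambda>x. \<phi> x * \<psi> x) (\<zeta> x) x)" if "i < d" for i
  proof (intro exI conjI ballI)
    show "smooth_products d (\<lambda>x. \<phi> x * partial i \<psi> x + partial i \<phi> x * \<psi> x)"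
      using prod that by (intro smooth_products.intros smooth_partial)
    fix x assume "x \<in> euclid d"
    then show "has_partial i (\<lambda>x. \<phi> x * \<psi> x) (\<phi> x * partial i \<psi> x + partial i \<phi> x * \<psi> x) x"
      using has_vector_derivative_mult[OF smooth_has_partial[OF prod(1) that, of x]
          smooth_has_partial[OF prod(2) that, of x]] by simp
  qed
  then show ?case using continuous_on_mult[OF prod[THEN smooth_continuous]] by blast
next
  case (add f g)
  have "\<exists>\<zeta>. smooth_products d \<zeta> \<and> (\<forall>x\<in>euclid d. has_partial i (\<lambda>x. f x + g x) (\<zeta> x) x)" if i: "i < d" for i
  proof -
    obtain \<zeta> where "smooth_products d \<zeta>" "\<forall>x\<in>euclid d. has_partial i f (\<zeta> x) x"
      using mp[OF spec[OF conjunct2[OF add.IH(1)]] i] by (elim exE conjE)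
    moreover obtain \<xi> where "smooth_products d \<xi>" "\<forall>x\<in>euclid d. has_partial i g (\<xi> x) x"
      using mp[OF spec[OF conjunct2[OF add.IH(2)]] i] by (elim exE conjE)
    ultimately show ?thesis
      by (intro exI[of _ "\<lambda>x. \<zeta> x + \<xi> x"] conjI smooth_products.add ballI has_vector_derivative_add) auto
  qed
  then show ?case using add.IH continuous_on_add by blast
qed

lemma smooth_mult: "smooth d \<phi> \<Longrightarrow> smooth d \<psi> \<Longrightarrow> smooth d (\<lambda>x. \<phi> x * \<psi> x)"
  by (rule smooth_coinduct[of "smooth_products d", OF smooth_products.prod smooth_products_step])

lemma partial_mult:
  assumes "smooth d \<phi>" "smooth d \<psi>" "i < d" "x \<in> euclid d"
  shows "partial i (\<lambda>x. \<phi> x * \<psi> x) x = \<phi> x * partial i \<psi> x + partial i \<phi> x * \<psi> x"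
  using has_vector_derivative_mult[OF smooth_has_partial[OF assms(1,3,4)] smooth_has_partial[OF assms(2,3,4)]]
  by (intro partial_eqI) simp

lemma smooth_prod: "(\<And>k. k \<in> I \<Longrightarrow> smooth d (f k)) \<Longrightarrow> smooth d (\<lambda>x. \<Prod>k\<in>I. f k x)"
  by (induction I rule: infinite_finite_induct) (auto intro: smooth_const smooth_mult)

lemma has_partial_swap:
  assumes "smooth d \<phi>" "2 \<le> d" "i < d" "x \<in> euclid d"
  shows "has_partial i (\<lambda>x. \<phi> (swap x)) (partial (flip i) \<phi> (swap x)) x"
  using smooth_has_partial[OF assms(1), of "flip i" "swap x"] assms
  by (simp add: swap_fun_upd swap_apply)

lemma smooth_swap:
  assumes "smooth d \<phi>" "2 \<le> d" shows "smooth d (\<lambda>x. \<phi> (swap x))"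
proof (rule smooth_coinduct[where P = "\<lambda>f. \<exists>\<phi>. smooth d \<phi> \<and> f = (\<lambda>x. \<phi> (swap x))"])
  fix f assume "\<exists>\<phi>. smooth d \<phi> \<and> f = (\<lambda>x. \<phi> (swap x))"
  then obtain \<phi> where s: "smooth d \<phi>" and f: "f = (\<lambda>x. \<phi> (swap x))" by blast
  have "continuous_on (euclid d) f" unfolding f
    by (rule continuous_on_compose2[OF smooth_continuous[OF s] continuous_on_swap]) (use \<open>2 \<le> d\<close> in auto)
  moreover have "\<exists>\<zeta>. (\<exists>\<phi>. smooth d \<phi> \<and> \<zeta> = (\<lambda>x. \<phi> (swap x))) \<and> (\<forall>x\<in>euclid d. has_partial i f (\<zeta> x) x)"
    if "i < d" for i
    using has_partial_swap[OF s \<open>2 \<le> d\<close> that] smooth_partial[OF s, of "flip i"] that \<open>2 \<le> d\<close>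
    unfolding f by (intro exI[of _ "\<lambda>x. partial (flip i) \<phi> (swap x)"]) auto
  ultimately show "continuous_on (euclid d) f \<and> (\<forall>i<d. \<exists>\<zeta>. (\<exists>\<phi>. smooth d \<phi> \<and>
      \<zeta> = (\<lambda>x. \<phi> (swap x))) \<and> (\<forall>x\<in>euclid d. has_partial i f (\<zeta> x) x))" by blast
qed (use assms in blast)

lemma partial_swap:
  assumes "smooth d \<phi>" "2 \<le> d" "i < d" "x \<in> euclid d"
  shows "partial i (\<lambda>x. \<phi> (swap x)) x = partial (flip i) \<phi> (swap x)"
  using assms by (intro partial_eqI has_partial_swap)

lemma smooth_cnj:
  assumes "smooth d \<phi>" shows "smooth d (\<lambda>x. cnj (\<phi> x))"
proof (rule smooth_coinduct[where P = "\<lambda>f. \<exists>\<phi>. smooth d \<phi> \<and> f = (\<lambda>x. cnj (\<phi> x))"])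
  fix f assume "\<exists>\<phi>. smooth d \<phi> \<and> f = (\<lambda>x. cnj (\<phi> x))"
  then obtain \<phi> where s: "smooth d \<phi>" and f: "f = (\<lambda>x. cnj (\<phi> x))" by blast
  have "\<exists>\<zeta>. (\<exists>\<phi>. smooth d \<phi> \<and> \<zeta> = (\<lambda>x. cnj (\<phi> x))) \<and> (\<forall>x\<in>euclid d. has_partial i f (\<zeta> x) x)"
    if "i < d" for i
    using smooth_has_partial[OF s that] smooth_partial[OF s that]
    unfolding f by (intro exI[of _ "\<lambda>x. cnj (partial i \<phi> x)"]) (auto intro: has_vector_derivative_cnj)
  then show "continuous_on (euclid d) f \<and> (\<forall>i<d. \<exists>\<zeta>. (\<exists>\<phi>. smooth d \<phi> \<and>
      \<zeta> = (\<lambda>x. cnj (\<phi> x))) \<and> (\<forall>x\<in>euclid d. has_partial i f (\<zeta> x) x))"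
    using smooth_continuous[OF s] unfolding f by (auto intro: continuous_on_cnj)
qed (use assms in blast)

lemma partial_cnj:
  assumes "smooth d \<phi>" "i < d" "x \<in> euclid d"
  shows "partial i (\<lambda>x. cnj (\<phi> x)) x = cnj (partial i \<phi> x)"
  using assms by (intro partial_eqI has_vector_derivative_cnj smooth_has_partial)

text \<open>The functions \<open>p(1/t) exp(-1/t)\<close> for a polynomial \<open>p\<close> are closed under differentiation.\<close>

definition flat :: "real poly \<Rightarrow> real \<Rightarrow> real" where
  "flat p t = (if t \<le> 0 then 0 else poly p (1 / t) * exp (- (1 / t)))"

text \<open>With \<open>u = 1 / t\<close> the chain rule contributes the factor \<open>- u^2\<close>
  and the product rule the difference of \<open>pderiv p\<close> and \<open>p\<close>; the
  polynomial \<open>[:0, 0, 1:]\<close> is \<open>u^2\<close>.\<close>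

definition flat_deriv :: "real poly \<Rightarrow> real poly" where
  "flat_deriv p = [:0, 0, 1:] * (p - pderiv p)"

lemma flat_tendsto_0: "(flat p \<longlongrightarrow> 0) (at_right 0)"
proof -
  have "((\<lambda>u. \<Sum>k\<le>degree p. coeff p k * (u ^ k / exp u)) \<longlongrightarrow> (\<Sum>k\<le>degree p. coeff p k * 0)) at_top"
    by (intro tendsto_intros tendsto_power_div_exp_0)
  then have "((\<lambda>u. poly p u * exp (- u)) \<longlongrightarrow> 0) at_top"
    by (simp add: poly_altdef exp_minus sum_distrib_right divide_inverse mult.assoc)
  then have "((\<lambda>t. poly p (inverse t) * exp (- inverse t)) \<longlongrightarrow> 0) (at_right 0)"
    by (rule filterlim_compose[OF _ filterlim_inverse_at_top_right])
  then show ?thesis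
    by (rule Lim_transform_eventually)
      (use eventually_at_right_less[of "0::real"] in \<open>eventually_elim, simp add: flat_def inverse_eq_divide\<close>)
qed

lemma flat_has_derivative: "(flat p has_real_derivative flat (flat_deriv p) t) (at t)"
proof -
  consider "t < 0" | "t = 0" | "t > 0" by linarith
  then show ?thesis
  proof cases
    case 1
    have "(flat p has_real_derivative 0) (at t)"
    proof (rule DERIV_cong_ev[THEN iffD1, OF refl _ refl])
      show "\<forall>\<^sub>F s in nhds t. 0 = flat p s"
        using eventually_nhds_in_open[of "{..<0}" t] 1 by (auto elim!: eventually_mono simp: flat_def)
    qed (rule DERIV_const)
    then show ?thesis using 1 by (simp add: flat_def)
  next
    case 2
    have "((\<lambda>s. flat p s / s) \<longlongrightarrow> 0) (at 0)"
    proof (rule filterlim_split_at)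
      have "((\<lambda>s. 0) \<longlongrightarrow> 0) (at_left (0::real))" by (rule tendsto_const)
      then show "((\<lambda>s. flat p s / s) \<longlongrightarrow> 0) (at_left 0)"
        by (rule Lim_transform_eventually)
          (use eventually_at_left_real[of "-1" "0::real"] in \<open>auto elim!: eventually_mono simp: flat_def\<close>)
      \<comment> \<open>Dividing by \<open>s\<close> multiplies the polynomial in
        \<open>1 / s\<close> by its variable, so to the right of 0 the difference quotient is again
        a flat function and tends to 0.\<close>
      show "((\<lambda>s. flat p s / s) \<longlongrightarrow> 0) (at_right 0)"
        using flat_tendsto_0[of "pCons 0 p"]
        by (rule Lim_transform_eventually)
          (use eventually_at_right_less[of "0::real"] in \<open>eventually_elim, simp add: flat_def\<close>)
    qed
    then show ?thesis using 2 by (simp add: DERIV_def flat_def)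
  next
    case 3
    have "((\<lambda>t. poly p (1 / t) * exp (- (1 / t))) has_real_derivative flat (flat_deriv p) t) (at t)"
      using 3 by (auto intro!: derivative_eq_intros DERIV_chain2[OF poly_DERIV]
          simp: flat_def flat_deriv_def field_simps power2_eq_square)
    then show ?thesis
    proof (rule DERIV_cong_ev[THEN iffD1, OF refl _ refl, rotated])
      show "\<forall>\<^sub>F s in nhds t. poly p (1 / s) * exp (- (1 / s)) = flat p s"
        using eventually_nhds_in_open[of "{0<..}" t] 3 by (auto elim!: eventually_mono simp: flat_def)
    qed
  qed
qed

lemma continuous_on_flat: "continuous_on S (flat p)"
  by (meson DERIV_continuous_on flat_has_derivative has_field_derivative_at_within)

lemma has_partial_flat:
  assumes l: "l = (\<lambda>x. c + (\<Sum>j<d. w j * x j))" and "i < d"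
  shows "has_partial i (\<lambda>x. of_real (flat p (l x))) (of_real (w i * flat (flat_deriv p) (l x))) x"
proof -
  have "l (x(i := t)) = (c + (\<Sum>j\<in>{..<d} - {i}. w j * x j)) + w i * t" for t
  proof -
    have "(\<Sum>j<d. w j * (x(i := t)) j) = w i * t + (\<Sum>j\<in>{..<d} - {i}. w j * (x(i := t)) j)"
      using \<open>i < d\<close> by (subst sum.remove[of _ i]) auto
    also have "(\<Sum>j\<in>{..<d} - {i}. w j * (x(i := t)) j) = (\<Sum>j\<in>{..<d} - {i}. w j * x j)"
      by (intro sum.cong) auto
    finally show ?thesis by (simp add: l)
  qed
  then have "((\<lambda>t. l (x(i := t))) has_real_derivative w i) (at (x i))"
    by (auto intro!: derivative_eq_intros)
  from DERIV_chain2[OF _ this, of "flat p" "flat (flat_deriv p) (l x)"]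
  have "((\<lambda>t. flat p (l (x(i := t)))) has_real_derivative w i * flat (flat_deriv p) (l x)) (at (x i))"
    using flat_has_derivative[of p "l x"] by (simp add: mult.commute)
  then show ?thesis
    by (intro has_vector_derivative_of_real)
qed

text \<open>The invariant consists of the real multiples of \<open>flat p (l x)\<close>:
  differentiation in direction \<open>i\<close> replaces \<open>p\<close> by
  \<open>flat_deriv p\<close> and multiplies by the constant \<open>w i\<close>.\<close>

lemma smooth_flat:
  assumes l: "l = (\<lambda>x. c + (\<Sum>j<d. w j * x j))"
  shows "smooth d (\<lambda>x. of_real (flat p (l x)))"
proof -
  define P where "P f \<longleftrightarrow> (\<exists>a p. f = (\<lambda>x::point. complex_of_real (a * flat p (l x))))" for f
  show ?thesis
  proof (rule smooth_coinduct[of P])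
    fix f assume "P f"
    then obtain a p where f: "f = (\<lambda>x. of_real (a * flat p (l x)))" by (auto simp: P_def)
    have "\<exists>\<zeta>. P \<zeta> \<and> (\<forall>x\<in>euclid d. has_partial i f (\<zeta> x) x)" if "i < d" for i
    proof (intro exI conjI ballI)
      show "P (\<lambda>x. of_real (a * w i * flat (flat_deriv p) (l x)))" unfolding P_def by blast
      show "has_partial i f (of_real (a * w i * flat (flat_deriv p) (l x))) x" for x
        using has_vector_derivative_mult_right[OF has_partial_flat[OF l that, of p x], of "of_real a"]
        by (simp add: f mult.assoc)
    qed
    moreover have "continuous_on (euclid d) f" unfolding f l
      by (intro continuous_intros continuous_on_compose2[OF continuous_on_flat[of UNIV]]
          continuous_on_coordinate subset_UNIV)
    ultimately show "continuous_on (euclid d) f \<and> (\<forall>i<d. \<exists>\<zeta>. P \<zeta> \<and> (\<forall>x\<in>euclid d. has_partial i f (\<zeta> x) x))"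
      by blast
  next
    show "P (\<lambda>x. of_real (flat p (l x)))"
      unfolding P_def by (intro exI[of _ 1] exI[of _ p]) simp
  qed
qed

section \<open>Test functions\<close>

lemma test_fun_smooth: "\<phi> \<in> test_fun d \<Omega> \<Longrightarrow> smooth d \<phi>"
  by (simp add: test_fun_def)

lemma test_funE:
  assumes "\<phi> \<in> test_fun d \<Omega>"
  obtains C where "compact C" "C \<subseteq> \<Omega>" "\<And>x. x \<in> euclid d \<Longrightarrow> x \<notin> C \<Longrightarrow> \<phi> x = 0"
  using assms by (auto simp: test_fun_def)

lemma test_funI:
  assumes "smooth d \<phi>" "compact C" "C \<subseteq> \<Omega>" "\<And>x. x \<in> euclid d \<Longrightarrow> x \<notin> C \<Longrightarrow> \<phi> x = 0"
  shows "\<phi> \<in> test_fun d \<Omega>"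
  using assms by (auto simp: test_fun_def)

lemma test_fun_mono: "\<Omega> \<subseteq> \<Omega>' \<Longrightarrow> \<phi> \<in> test_fun d \<Omega> \<Longrightarrow> \<phi> \<in> test_fun d \<Omega>'"
  by (auto simp: test_fun_def)

lemma test_fun_vanishes: "\<phi> \<in> test_fun d \<Omega> \<Longrightarrow> x \<in> euclid d \<Longrightarrow> x \<notin> \<Omega> \<Longrightarrow> \<phi> x = 0"
  by (auto simp: test_fun_def)

lemma test_fun_partial:
  assumes "\<phi> \<in> test_fun d \<Omega>" "i < d"
  shows "partial i \<phi> \<in> test_fun d \<Omega>"
proof -
  obtain C where C: "compact C" "C \<subseteq> \<Omega>" "\<And>x. x \<in> euclid d \<Longrightarrow> x \<notin> C \<Longrightarrow> \<phi> x = 0"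
    using test_funE[OF assms(1)] by metis
  show ?thesis
  proof (rule test_funI[OF _ C(1,2)])
    show "smooth d (partial i \<phi>)" using test_fun_smooth[OF assms(1)] assms(2) by (rule smooth_partial)
    fix x assume x: "x \<in> euclid d" "x \<notin> C"
    \<comment> \<open>\<open>C\<close> is closed, so the coordinate line through a point outside
      \<open>C\<close> stays outside for nearby parameters, and there \<open>\<phi>\<close> vanishes
      identically.\<close>
    have op: "open ((\<lambda>t. x(i := t)) -` (- C))"
      by (intro open_vimage continuous_on_fun_upd open_Compl compact_imp_closed C)
    have "has_partial i \<phi> 0 x"
    proof (rule has_vector_derivative_transform_within_open[OF _ op])
      show "((\<lambda>t. 0) has_vector_derivative 0) (at (x i))" by (rule has_vector_derivative_const)
    qed (use x C(3) assms(2) in auto)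
    then show "partial i \<phi> x = 0" by (rule partial_eqI)
  qed
qed

lemma test_fun_mult:
  assumes "\<phi> \<in> test_fun d \<Omega>" "smooth d \<psi>"
  shows "(\<lambda>x. \<psi> x * \<phi> x) \<in> test_fun d \<Omega>"
  using test_funE[OF assms(1)] smooth_mult[OF assms(2) test_fun_smooth[OF assms(1)]]
  by (metis (no_types, lifting) mult_zero_right test_funI)

lemma test_fun_linear:
  assumes "\<phi> \<in> test_fun d \<Omega>" "\<psi> \<in> test_fun d \<Omega>"
  shows "(\<lambda>x. \<phi> x + c * \<psi> x) \<in> test_fun d \<Omega>"
proof -
  obtain C D where "compact C" "C \<subseteq> \<Omega>" "\<And>x. x \<in> euclid d \<Longrightarrow> x \<notin> C \<Longrightarrow> \<phi> x = 0"
    and "compact D" "D \<subseteq> \<Omega>" "\<And>x. x \<in> euclid d \<Longrightarrow> x \<notin> D \<Longrightarrow> \<psi> x = 0"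
    using test_funE[OF assms(1)] test_funE[OF assms(2)] by metis
  then show ?thesis
    by (intro test_funI[of _ _ "C \<union> D"] smooth_linear assms[THEN test_fun_smooth] compact_Un) auto
qed

lemma test_fun_zero: "(\<lambda>x. 0) \<in> test_fun d \<Omega>"
  by (rule test_funI[of _ _ "{}"]) (auto intro: smooth_const)

lemma test_fun_cnj: "\<phi> \<in> test_fun d \<Omega> \<Longrightarrow> (\<lambda>x. cnj (\<phi> x)) \<in> test_fun d \<Omega>"
  unfolding test_fun_def using smooth_cnj by fastforce

lemma test_fun_swap:
  assumes "\<phi> \<in> test_fun d \<Omega>" "2 \<le> d" "swap ` \<Omega> \<subseteq> \<Omega>'"
  shows "(\<lambda>x. \<phi> (swap x)) \<in> test_fun d \<Omega>'"
proof -
  obtain C where C: "compact C" "C \<subseteq> \<Omega>" "\<And>x. x \<in> euclid d \<Longrightarrow> x \<notin> C \<Longrightarrow> \<phi> x = 0"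
    using test_funE[OF assms(1)] by metis
  show ?thesis
  proof (rule test_funI[of _ _ "swap ` C"])
    show "compact (swap ` C)" by (intro compact_continuous_image continuous_on_swap C)
    fix x assume "x \<in> euclid d" "x \<notin> swap ` C"
    then have "swap x \<in> euclid d" "swap x \<notin> C"
      using assms(2) image_eqI[of x swap "swap x" C] by auto
    then show "\<phi> (swap x) = 0" by (rule C(3))
  qed (use C assms smooth_swap[OF test_fun_smooth[OF assms(1)]] in auto)
qed

lemma test_fun_bounded:
  assumes "\<phi> \<in> test_fun d \<Omega>" "\<Omega> \<subseteq> euclid d"
  obtains B where "B > 0" "\<And>x. x \<in> euclid d \<Longrightarrow> cmod (\<phi> x) \<le> B"
proof -
  obtain C where C: "compact C" "C \<subseteq> \<Omega>" "\<And>x. x \<in> euclid d \<Longrightarrow> x \<notin> C \<Longrightarrow> \<phi> x = 0"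
    using test_funE[OF assms(1)] by metis
  have "continuous_on C \<phi>"
    using smooth_continuous[OF test_fun_smooth[OF assms(1)]] C(2) assms(2) continuous_on_subset by blast
  then have "bounded (\<phi> ` C)" by (intro compact_imp_bounded compact_continuous_image C)
  then obtain B where "B > 0" "\<And>x. x \<in> C \<Longrightarrow> cmod (\<phi> x) \<le> B"
    unfolding bounded_pos by auto
  then show thesis using that[of B] C(3) by (metis norm_zero order_less_imp_le)
qed

text \<open>From \<open>x\<close> to \<open>swap x\<close> lead two moves parallel to the axes, each
  of length \<open>\<bar>x 0 - x 1\<bar>\<close>, and the partial derivatives of a test function are
  bounded. This linear vanishing at the diagonal is what later absorbs the derivative of the
  cut-off.\<close>

lemma test_fun_swap_Lipschitz:
  assumes "\<phi> \<in> test_fun d \<Omega>" "\<Omega> \<subseteq> euclid d" "2 \<le> d"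
  obtains B where "B > 0" "\<And>x. x \<in> euclid d \<Longrightarrow> cmod (\<phi> x - \<phi> (swap x)) \<le> B * \<bar>x 0 - x 1\<bar>"
proof -
  have partial_bound: "\<exists>B>0. \<forall>x\<in>euclid d. cmod (partial i \<phi> x) \<le> B" if "i < d" for i
    using test_fun_bounded[OF test_fun_partial[OF assms(1) that] assms(2)] by metis
  obtain A B where AB: "A > 0" "\<And>x. x \<in> euclid d \<Longrightarrow> cmod (partial 0 \<phi> x) \<le> A"
    "B > 0" "\<And>x. x \<in> euclid d \<Longrightarrow> cmod (partial 1 \<phi> x) \<le> B"
    using partial_bound[of 0] partial_bound[of 1] assms(3) by auto
  have lip: "cmod (\<phi> (x(i := s)) - \<phi> (x(i := t))) \<le> D * \<bar>s - t\<bar>"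
    if x: "x \<in> euclid d" and i: "i < d" and D: "\<And>x. x \<in> euclid d \<Longrightarrow> cmod (partial i \<phi> x) \<le> D" for x i s t D
  proof -
    have "cmod (\<phi> (x(i := s)) - \<phi> (x(i := t))) \<le> D * norm (s - t)"
    proof (rule differentiable_bound[of UNIV "\<lambda>t. \<phi> (x(i := t))" "\<lambda>t h. h *\<^sub>R partial i \<phi> (x(i := t))"])
      fix t
      show "((\<lambda>t. \<phi> (x(i := t))) has_derivative (\<lambda>h. h *\<^sub>R partial i \<phi> (x(i := t)))) (at t within UNIV)"
        using smooth_has_vector_derivative[OF test_fun_smooth[OF assms(1)] i x]
        by (simp add: has_vector_derivative_def)
      show "onorm (\<lambda>h. h *\<^sub>R partial i \<phi> (x(i := t))) \<le> D"
      proof (rule onorm_le)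
        fix h
        show "norm (h *\<^sub>R partial i \<phi> (x(i := t))) \<le> D * norm h"
          using mult_right_mono[OF D[of "x(i := t)"], of "\<bar>h\<bar>"] x i by (simp add: mult.commute)
      qed
    qed auto
    then show ?thesis by simp
  qed
  show thesis
  proof (rule that[of "A + B"])
    fix x assume x: "x \<in> euclid d"
    \<comment> \<open>The corner between the two moves, a point on the diagonal.\<close>
    define y where "y = x(0 := x 1)"
    have y: "y \<in> euclid d" unfolding y_def using x assms(3) by simp
    have "swap x = y(1 := x 0)" "y(1 := x 1) = y" unfolding y_def swap_def by (auto simp: fun_eq_iff Transposition.transpose_def)
    then have "cmod (\<phi> y - \<phi> (swap x)) \<le> B * \<bar>x 1 - x 0\<bar>"
      using lip[OF y, of 1 B "x 1" "x 0"] AB assms(3) by simp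
    moreover have "cmod (\<phi> x - \<phi> y) \<le> A * \<bar>x 0 - x 1\<bar>"
      using lip[OF x, of 0 A "x 0" "x 1"] AB assms(3) unfolding y_def by simp
    ultimately show "cmod (\<phi> x - \<phi> (swap x)) \<le> (A + B) * \<bar>x 0 - x 1\<bar>"
      using norm_triangle_ineq[of "\<phi> x - \<phi> y" "\<phi> y - \<phi> (swap x)"]
      by (simp add: algebra_simps abs_minus_commute)
  qed (use AB in simp)
qed

section \<open>Lebesgue measure on Euclidean space\<close>

interpretation lborel_product: product_sigma_finite "\<lambda>i::nat. lborel :: real measure"
  by standard

abbreviation lborel_prod :: "nat \<Rightarrow> point measure" where
  "lborel_prod d \<equiv> \<Pi>\<^sub>M i\<in>{..<d}. lborel"

lemma space_lborel_prod: "space (lborel_prod d) = euclid d"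
  by (simp add: space_PiM euclid_def)

lemma space_leb [simp]: "space (leb d) = euclid d"
  by (simp add: leb_def space_lborel_prod)

lemma sets_leb_if_lborel_prod: "A \<in> sets (lborel_prod d) \<Longrightarrow> A \<in> sets (leb d)"
  by (simp add: leb_def)

lemma emeasure_leb: "A \<in> sets (lborel_prod d) \<Longrightarrow> emeasure (leb d) A = emeasure (lborel_prod d) A"
  by (simp add: leb_def)

lemma sets_leb_subset: "A \<in> sets (leb d) \<Longrightarrow> A \<subseteq> euclid d"
  using sets.sets_into_space[of A "leb d"] by simp

lemma space_leb_on [simp]: "\<Omega> \<in> sets (leb d) \<Longrightarrow> space (leb_on d \<Omega>) = \<Omega>"
  by (simp add: leb_on_def)

lemma coordinate_measurable: "i < d \<Longrightarrow> (\<lambda>x. x i) \<in> borel_measurable (lborel_prod d)"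
  using measurable_component_singleton[of i "{..<d}" "\<lambda>_. lborel :: real measure"] by simp

text \<open>Links the product sigma-algebra over \<open>d\<close> coordinates with the Borel sets of
  the function space, in whose topology continuity and compactness are stated. The coordinates from
  \<open>d\<close> on are constantly \<open>undefined\<close> on the space.\<close>

lemma measurable_lborel_prod_borel: "(\<lambda>x. x) \<in> lborel_prod d \<rightarrow>\<^sub>M borel"
proof (rule measurable_coordinatewise_then_product)
  fix i
  show "(\<lambda>x. x i) \<in> borel_measurable (lborel_prod d)"
  proof (cases "i < d")
    case False
    then have "x i = undefined" if "x \<in> space (lborel_prod d)" for x
      using that by (auto simp: space_lborel_prod euclid_def PiE_iff extensional_def)
    then show ?thesis using measurable_cong[of "lborel_prod d" "\<lambda>x. x i" "\<lambda>x. undefined"] by simp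
  qed (rule coordinate_measurable)
qed

lemma continuous_on_measurable_lborel_prod:
  fixes f :: "point \<Rightarrow> 'a::topological_space"
  assumes "continuous_on (euclid d) f"
  shows "f \<in> borel_measurable (lborel_prod d)"
proof -
  have "(\<lambda>x. x) \<in> lborel_prod d \<rightarrow>\<^sub>M restrict_space borel (euclid d)"
    by (rule measurable_restrict_space2[OF _ measurable_lborel_prod_borel]) (simp add: space_lborel_prod)
  from measurable_compose[OF this borel_measurable_continuous_on_restrict[OF assms]]
  show ?thesis .
qed

lemma measurable_leb: "f \<in> borel_measurable (lborel_prod d) \<Longrightarrow> f \<in> borel_measurable (leb d)"
  unfolding leb_def by (rule measurable_completion)

lemma measurable_leb_on: "f \<in> borel_measurable (leb d) \<Longrightarrow> f \<in> borel_measurable (leb_on d \<Omega>)"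
  unfolding leb_on_def by (rule measurable_restrict_space1)

lemma smooth_measurable: "smooth d \<phi> \<Longrightarrow> \<phi> \<in> borel_measurable (leb_on d \<Omega>)"
  by (intro measurable_leb_on measurable_leb continuous_on_measurable_lborel_prod smooth_continuous)

lemma box_eq_PiE: "{x \<in> euclid d. \<forall>i<d. x i \<in> A i} = (\<Pi>\<^sub>E i\<in>{..<d}. A i)"
  unfolding euclid_def PiE_def Pi_def by blast

lemma box_sets:
  assumes "\<And>i. i < d \<Longrightarrow> A i \<in> sets borel"
  shows "{x \<in> euclid d. \<forall>i<d. x i \<in> A i} \<in> sets (lborel_prod d)"
proof -
  have "(\<Pi>\<^sub>E i\<in>{..<d}. A i) \<in> sets (lborel_prod d)"
    by (rule sets_PiM_I_finite) (simp_all add: assms)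
  then show ?thesis by (simp only: box_eq_PiE)
qed

lemma emeasure_box:
  assumes "\<And>i. i < d \<Longrightarrow> A i \<in> sets borel"
  shows "emeasure (leb d) {x \<in> euclid d. \<forall>i<d. x i \<in> A i} = (\<Prod>i<d. emeasure lborel (A i))"
proof -
  have eq: "{x \<in> euclid d. \<forall>i<d. x i \<in> A i} = (\<Pi>\<^sub>E i\<in>{..<d}. A i)"
    by (rule box_eq_PiE)
  have "(\<Pi>\<^sub>E i\<in>{..<d}. A i) \<in> sets (lborel_prod d)"
    by (rule sets_PiM_I_finite) (simp_all add: assms)
  then have "emeasure (leb d) (\<Pi>\<^sub>E i\<in>{..<d}. A i) = emeasure (lborel_prod d) (\<Pi>\<^sub>E i\<in>{..<d}. A i)"
    by (rule emeasure_leb)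
  also have "\<dots> = (\<Prod>i<d. emeasure lborel (A i))"
    by (rule lborel_product.emeasure_PiM) (simp_all add: assms)
  finally show ?thesis by (simp only: eq)
qed

lemma cube_sets_lborel: "cube d L \<in> sets (lborel_prod d)"
proof -
  have "{x \<in> euclid d. \<forall>i<d. x i \<in> {0<..<L}} \<in> sets (lborel_prod d)"
    by (rule box_sets) (rule borel_open[OF open_greaterThanLessThan])
  then show ?thesis by (simp only: cube_def greaterThanLessThan_iff)
qed

lemma cube_sets [simp]: "cube d L \<in> sets (leb d)"
  by (intro sets_leb_if_lborel_prod cube_sets_lborel)

lemma cube_subset_euclid: "cube d L \<subseteq> euclid d"
  by (auto simp: cube_def)

lemma emeasure_cube: "emeasure (leb d) (cube d L) < \<infinity>"
proof -
  have "emeasure (leb d) (cube d L) = (\<Prod>i<d. emeasure lborel {0<..<L})"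
    using emeasure_box[of d "\<lambda>_. {0<..<L}"] by (simp add: cube_def)
  also have "\<dots> < \<infinity>" by (cases "L \<ge> 0") (auto simp: power_less_top_ennreal)
  finally show ?thesis .
qed

lemma finite_leb_on:
  assumes "\<Omega> \<in> sets (leb d)" "\<Omega> \<subseteq> cube d L"
  shows "finite_measure (leb_on d \<Omega>)"
proof
  have "emeasure (leb d) \<Omega> \<le> emeasure (leb d) (cube d L)"
    using assms by (intro emeasure_mono) auto
  then show "emeasure (leb_on d \<Omega>) (space (leb_on d \<Omega>)) \<noteq> \<infinity>"
    using emeasure_cube[of d L] assms(1) sets_leb_subset[OF assms(1)]
    by (auto simp: leb_on_def emeasure_restrict_space Int_absorb2)
qed

lemma bounded_L2:
  assumes "\<Omega> \<in> sets (leb d)" "\<Omega> \<subseteq> cube d L" "f \<in> borel_measurable (leb_on d \<Omega>)"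
    and "\<And>x. x \<in> \<Omega> \<Longrightarrow> cmod (f x) \<le> B"
  shows "f \<in> L2 (leb_on d \<Omega>)"
proof -
  interpret finite_measure "leb_on d \<Omega>" by (rule finite_leb_on[OF assms(1,2)])
  have "integrable (leb_on d \<Omega>) (\<lambda>x. (cmod (f x))\<^sup>2)"
    by (rule integrable_const_bound[of _ "B\<^sup>2"]) (use assms in \<open>auto intro!: AE_I2 power_mono\<close>)
  then show ?thesis using assms(3) by (simp add: L2_def)
qed

lemma test_fun_L2:
  assumes "\<phi> \<in> test_fun d \<Omega>'" "\<Omega>' \<subseteq> euclid d" "\<Omega> \<in> sets (leb d)" "\<Omega> \<subseteq> cube d L"
  shows "\<phi> \<in> L2 (leb_on d \<Omega>)"
proof -
  obtain B where "\<And>x. x \<in> euclid d \<Longrightarrow> cmod (\<phi> x) \<le> B"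
    using test_fun_bounded[OF assms(1,2)] by metis
  then show ?thesis
    using assms sets_leb_subset[OF assms(3)]
    by (intro bounded_L2[OF assms(3,4), of _ B] smooth_measurable test_fun_smooth[OF assms(1)]) auto
qed

lemma L2_norm_leb_on:
  assumes "\<Omega> \<in> sets (leb d)"
  shows "(L2_norm (leb_on d \<Omega>) f)\<^sup>2 = (\<integral>x. indicator \<Omega> x * (cmod (f x))\<^sup>2 \<partial>leb d)"
  unfolding L2_norm_power2 leb_on_def using assms sets_leb_subset[OF assms]
  by (subst integral_restrict_space) (auto simp: Int_absorb2)

lemma integral_leb_on:
  fixes g :: "point \<Rightarrow> complex"
  assumes "\<Omega> \<in> sets (leb d)"
  shows "(\<integral>x. g x \<partial>leb_on d \<Omega>) = (\<integral>x. indicator \<Omega> x *\<^sub>R g x \<partial>leb d)"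
  unfolding leb_on_def using assms sets_leb_subset[OF assms]
  by (subst integral_restrict_space) (auto simp: Int_absorb2)

text \<open>Extension by zero moves questions about subdomains to all of \<open>leb d\<close>, where
  invariance under the reflection is available.\<close>

lemma L2_leb_on_iff:
  assumes "\<Omega> \<in> sets (leb d)"
  shows "f \<in> L2 (leb_on d \<Omega>) \<longleftrightarrow> (\<lambda>x. indicator \<Omega> x *\<^sub>R f x) \<in> L2 (leb d)"
proof -
  have e: "\<Omega> \<inter> space (leb d) \<in> sets (leb d)"
    using assms sets_leb_subset[OF assms] by (simp add: Int_absorb2)
  have "(\<lambda>x. (cmod (indicator \<Omega> x *\<^sub>R f x))\<^sup>2) = (\<lambda>x. indicator \<Omega> x *\<^sub>R (cmod (f x))\<^sup>2)"
    by (auto simp: indicator_def fun_eq_iff)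
  then show ?thesis
    unfolding L2_def leb_on_def
    by (simp add: borel_measurable_restrict_space_iff[OF e] integrable_restrict_space[OF e])
qed

lemma L2_leb_on_mono:
  assumes "f \<in> L2 (leb_on d \<Omega>')" "\<Omega> \<in> sets (leb d)" "\<Omega>' \<in> sets (leb d)" "\<Omega> \<subseteq> \<Omega>'"
  shows "f \<in> L2 (leb_on d \<Omega>)"
  unfolding L2_leb_on_iff[OF assms(2)]
proof (rule L2_bounded_by)
  show "(\<lambda>x. indicator \<Omega>' x *\<^sub>R f x) \<in> L2 (leb d)" using assms L2_leb_on_iff by blast
  then have "(\<lambda>x. indicator \<Omega> x *\<^sub>R (indicator \<Omega>' x *\<^sub>R f x)) \<in> borel_measurable (leb d)"
    by (intro borel_measurable_scaleR borel_measurable_indicator L2_measurable assms)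
  moreover have "(\<lambda>x. indicator \<Omega> x *\<^sub>R (indicator \<Omega>' x *\<^sub>R f x)) = (\<lambda>x. indicator \<Omega> x *\<^sub>R f x)"
    using assms(4) by (auto simp: indicator_def fun_eq_iff)
  ultimately show "(\<lambda>x. indicator \<Omega> x *\<^sub>R f x) \<in> borel_measurable (leb d)" by simp
qed (use assms(4) in \<open>auto simp: indicator_def\<close>)

lemma L2_norm_leb_on_mono:
  assumes "f \<in> L2 (leb_on d \<Omega>')" "\<Omega> \<in> sets (leb d)" "\<Omega>' \<in> sets (leb d)" "\<Omega> \<subseteq> \<Omega>'"
  shows "L2_norm (leb_on d \<Omega>) f \<le> L2_norm (leb_on d \<Omega>') f"
proof -
  have i: "integrable (leb d) (\<lambda>x. indicator \<Omega> x * (cmod (f x))\<^sup>2)" if "f \<in> L2 (leb_on d \<Omega>)" "\<Omega> \<in> sets (leb d)" for \<Omega>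
    using that L2_square_integrable[OF that(1)] sets_leb_subset[OF that(2)] unfolding leb_on_def
    by (subst (asm) integrable_restrict_space) (auto simp: Int_absorb2)
  have "(L2_norm (leb_on d \<Omega>) f)\<^sup>2 \<le> (L2_norm (leb_on d \<Omega>') f)\<^sup>2"
    unfolding L2_norm_leb_on[OF assms(2)] L2_norm_leb_on[OF assms(3)]
    using assms(4) L2_leb_on_mono[OF assms]
    by (intro integral_mono i assms) (auto simp: indicator_def)
  then show ?thesis by (rule power2_le_imp_le) simp
qed

section \<open>Invariance of Lebesgue measure under the reflection\<close>

lemma swap_measurable_lborel_prod:
  assumes "2 \<le> d" shows "swap \<in> lborel_prod d \<rightarrow>\<^sub>M lborel_prod d"
proof (rule measurable_PiM_single')
  fix i assume "i \<in> {..<d}"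
  then show "(\<lambda>x. swap x i) \<in> lborel_prod d \<rightarrow>\<^sub>M lborel"
    using coordinate_measurable[of "flip i" d] assms by (simp add: swap_apply)
next
  show "swap \<in> space (lborel_prod d) \<rightarrow> (\<Pi>\<^sub>E i\<in>{..<d}. space lborel)"
    using assms by (auto simp: space_lborel_prod simp flip: euclid_def)
qed

text \<open>It suffices to compare boxes: the reflection permutes the sides, and the product of the
  side lengths does not depend on their order.\<close>

lemma distr_swap_lborel_prod:
  assumes "2 \<le> d" shows "distr (lborel_prod d) (lborel_prod d) swap = lborel_prod d"
proof (rule lborel_product.PiM_eqI)
  fix A :: "nat \<Rightarrow> real set" assume A: "\<And>i. i \<in> {..<d} \<Longrightarrow> A i \<in> sets lborel"
  have "swap -` (\<Pi>\<^sub>E i\<in>{..<d}. A i) \<inter> space (lborel_prod d) = (\<Pi>\<^sub>E i\<in>{..<d}. A (flip i))"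
  proof (intro set_eqI iffI)
    fix x assume x: "x \<in> swap -` (\<Pi>\<^sub>E i\<in>{..<d}. A i) \<inter> space (lborel_prod d)"
    then have "x i \<in> A (flip i)" if "i < d" for i
      using that assms by (auto simp: PiE_iff swap_apply dest!: bspec[of _ _ "flip i"])
    then show "x \<in> (\<Pi>\<^sub>E i\<in>{..<d}. A (flip i))" using x by (auto simp: space_PiM PiE_iff)
  next
    fix x assume x: "x \<in> (\<Pi>\<^sub>E i\<in>{..<d}. A (flip i))"
    then have "x \<in> euclid d" by (auto simp: euclid_def PiE_iff)
    then have "swap x \<in> euclid d" using assms by simp
    moreover have "swap x i \<in> A i" if "i < d" for i
      using x that assms by (auto simp: PiE_iff swap_apply dest!: bspec[of _ _ "flip i"])
    ultimately show "x \<in> swap -` (\<Pi>\<^sub>E i\<in>{..<d}. A i) \<inter> space (lborel_prod d)"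
      using \<open>x \<in> euclid d\<close> by (auto simp: space_lborel_prod box_eq_PiE[symmetric])
  qed
  then have "emeasure (distr (lborel_prod d) (lborel_prod d) swap) (\<Pi>\<^sub>E i\<in>{..<d}. A i)
      = emeasure (lborel_prod d) (\<Pi>\<^sub>E i\<in>{..<d}. A (flip i))"
    using A by (subst emeasure_distr[OF swap_measurable_lborel_prod[OF assms]]) (auto intro!: sets_PiM_I_finite)
  also have "\<dots> = (\<Prod>i<d. emeasure lborel (A (flip i)))"
    using A assms by (intro lborel_product.emeasure_PiM) auto
  also have "\<dots> = (\<Prod>i<d. emeasure lborel (A i))"
    by (rule prod.reindex_bij_witness[of _ flip flip]) (use assms in auto)
  finally show "emeasure (distr (lborel_prod d) (lborel_prod d) swap) (\<Pi>\<^sub>E i\<in>{..<d}. A i)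
      = (\<Prod>i<d. emeasure lborel (A i))" .
qed auto

lemma distr_completion_swap:
  assumes "2 \<le> d" shows "distr (leb d) (lborel_prod d) swap = lborel_prod d"
  unfolding leb_def using assms
  by (simp add: distr_completion[OF swap_measurable_lborel_prod] distr_swap_lborel_prod)

text \<open>For the completed sigma-algebra in the target, preimages of null sets must be null as
  well; this is the invariance of the uncompleted measure.\<close>

lemma swap_measurable:
  assumes "2 \<le> d" shows "swap \<in> leb d \<rightarrow>\<^sub>M leb d"
  unfolding leb_def
proof (rule completion.measurable_completion2)
  show "swap \<in> completion (lborel_prod d) \<rightarrow>\<^sub>M lborel_prod d"
    by (intro measurable_completion swap_measurable_lborel_prod assms)
  show "null_sets (lborel_prod d) \<subseteq> null_sets (distr (completion (lborel_prod d)) (lborel_prod d) swap)"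
    using distr_completion_swap[OF assms] by (simp add: leb_def)
qed

lemma distr_swap:
  assumes "2 \<le> d" shows "distr (leb d) (leb d) swap = leb d"
proof -
  have "completion (distr (leb d) (lborel_prod d) swap) = distr (leb d) (completion (lborel_prod d)) swap"
    unfolding leb_def
  proof (rule completion.completion_distr_eq)
    show "swap \<in> completion (lborel_prod d) \<rightarrow>\<^sub>M lborel_prod d"
      by (intro measurable_completion swap_measurable_lborel_prod assms)
    show "null_sets (distr (completion (lborel_prod d)) (lborel_prod d) swap) = null_sets (lborel_prod d)"
      using distr_completion_swap[OF assms] by (simp add: leb_def)
  qed
  then show ?thesis using distr_completion_swap[OF assms] by (simp add: leb_def)
qed

lemma integral_swap:
  fixes f :: "point \<Rightarrow> 'a::{banach, second_countable_topology}"
  assumes "2 \<le> d" "f \<in> borel_measurable (leb d)"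
  shows "(\<integral>x. f (swap x) \<partial>leb d) = (\<integral>x. f x \<partial>leb d)"
  using integral_distr[OF swap_measurable[OF assms(1)], of f] assms by (simp add: distr_swap)

lemma integrable_swap:
  fixes f :: "point \<Rightarrow> 'a::{banach, second_countable_topology}"
  assumes "2 \<le> d" "integrable (leb d) f"
  shows "integrable (leb d) (\<lambda>x. f (swap x))"
  using integrable_distr[OF swap_measurable[OF assms(1)], of f] assms by (simp add: distr_swap)

lemma L2_swap:
  assumes "2 \<le> d" "f \<in> L2 (leb d)" shows "(\<lambda>x. f (swap x)) \<in> L2 (leb d)"
  using integrable_swap[OF assms(1) L2_square_integrable[OF assms(2)]] assms
    measurable_compose[OF swap_measurable, of d f borel]
  by (simp add: L2_def)

text \<open>Fubini in coordinate 0: with the other coordinates fixed, the section lies in the single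
  point \<open>x 1\<close>.\<close>

lemma diagonal_null:
  assumes "2 \<le> d" shows "{x \<in> euclid d. x 0 = x 1} \<in> null_sets (leb d)"
proof -
  let ?D = "{x \<in> euclid d. x 0 = x 1}"
  let ?I = "{1..<d}"
  have I: "{..<d} = insert 0 ?I" using assms by auto
  have D: "?D \<in> sets (lborel_prod d)"
  proof -
    have "{x \<in> space (lborel_prod d). x 0 = x 1} \<in> sets (lborel_prod d)"
      using coordinate_measurable[of 0 d] coordinate_measurable[of 1 d] assms
      by (intro borel_measurable_eq) auto
    then show ?thesis by (simp add: space_lborel_prod)
  qed
  have "emeasure (lborel_prod d) ?D = (\<integral>\<^sup>+x. indicator ?D x \<partial>lborel_prod d)"
    using D by simp
  also have "\<dots> = (\<integral>\<^sup>+x. (\<integral>\<^sup>+y. indicator ?D (x(0 := y)) \<partial>lborel) \<partial>(\<Pi>\<^sub>M i\<in>?I. lborel))"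
    using D unfolding I by (intro lborel_product.product_nn_integral_insert) auto
  also have "\<dots> = (\<integral>\<^sup>+x. 0 \<partial>(\<Pi>\<^sub>M i\<in>?I. (lborel :: real measure)))"
  proof (rule nn_integral_cong)
    fix x :: point
    have "(\<integral>\<^sup>+y. indicator ?D (x(0 := y)) \<partial>lborel) \<le> (\<integral>\<^sup>+y. indicator {x 1} y \<partial>lborel)"
      by (intro nn_integral_mono) (auto simp: indicator_def)
    also have "\<dots> = 0" by simp
    finally show "(\<integral>\<^sup>+y. indicator ?D (x(0 := y)) \<partial>lborel) = 0" by simp
  qed
  finally have "?D \<in> null_sets (lborel_prod d)" using D by (auto simp: null_sets_def)
  then show ?thesis unfolding leb_def by (rule null_sets_completionI)
qed

text \<open>Integrate in coordinate \<open>i\<close> first. By the fundamental theorem of calculus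
  the inner integral is a difference of values of \<open>\<phi>\<close> at points with
  \<open>i\<close>-th coordinate \<open>L\<close> and 0, which lie outside the open cube.\<close>

lemma integral_partial_test_fun:
  assumes \<phi>: "\<phi> \<in> test_fun d (cube d L)" and i: "i < d" and L: "L > 0"
  shows "(\<integral>x. partial i \<phi> x \<partial>leb_on d (cube d L)) = 0"
proof -
  let ?g = "partial i \<phi>"
  have g: "?g \<in> test_fun d (cube d L)" by (rule test_fun_partial[OF \<phi> i])
  note sg = test_fun_smooth[OF g]
  have m: "?g \<in> borel_measurable (lborel_prod d)"
    by (intro continuous_on_measurable_lborel_prod smooth_continuous sg)
  have g0: "indicator (cube d L) x *\<^sub>R ?g x = ?g x" if "x \<in> euclid d" for x
    using test_fun_vanishes[OF g that] by (auto simp: indicator_def)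
  interpret finite_measure "leb_on d (cube d L)" by (rule finite_leb_on[of _ _ L]) auto
  obtain B where "\<And>x. x \<in> euclid d \<Longrightarrow> cmod (?g x) \<le> B"
    using test_fun_bounded[OF g cube_subset_euclid] by metis
  then have "integrable (leb_on d (cube d L)) ?g"
    using cube_subset_euclid[of d L] by (intro integrable_const_bound[of _ B] smooth_measurable sg AE_I2) auto
  then have "integrable (leb d) (\<lambda>x. indicator (cube d L) x *\<^sub>R ?g x)"
    unfolding leb_on_def by (subst (asm) integrable_restrict_space) (use cube_subset_euclid[of d L] in \<open>auto simp: Int_absorb2\<close>)
  then have "integrable (leb d) ?g"
    by (rule Bochner_Integration.integrable_cong[THEN iffD1, OF refl, rotated]) (simp add: g0)
  then have int: "integrable (lborel_prod d) ?g"
    using m by (simp add: leb_def integrable_completion)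
  have ins: "{..<d} = insert i ({..<d} - {i})" using i by auto
  have "(\<integral>x. ?g x \<partial>leb_on d (cube d L)) = (\<integral>x. ?g x \<partial>leb d)"
    unfolding integral_leb_on[OF cube_sets] by (intro Bochner_Integration.integral_cong) (auto simp: g0)
  also have "\<dots> = (\<integral>x. ?g x \<partial>lborel_prod d)"
    using m by (simp add: leb_def integral_completion)
  also have "\<dots> = (\<integral>x. (\<integral>t. ?g (x(i := t)) \<partial>lborel) \<partial>(\<Pi>\<^sub>M j\<in>{..<d} - {i}. lborel))"
    using lborel_product.product_integral_insert[of "{..<d} - {i}" i ?g] int
    unfolding ins[symmetric] by simp
  also have "\<dots> = (\<integral>x. 0 \<partial>(\<Pi>\<^sub>M j\<in>{..<d} - {i}. (lborel :: real measure)))"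
  proof (rule Bochner_Integration.integral_cong[OF refl])
    fix x assume "x \<in> space (\<Pi>\<^sub>M j\<in>{..<d} - {i}. (lborel :: real measure))"
    then have x: "x(i := t) \<in> euclid d" for t
      using i by (auto simp: space_PiM euclid_def PiE_iff extensional_def)
    have out: "x(i := t) \<notin> cube d L" if "\<not> (0 < t \<and> t < L)" for t
    proof
      assume "x(i := t) \<in> cube d L"
      then have "0 < (x(i := t)) i \<and> (x(i := t)) i < L" using i unfolding cube_def by blast
      then show False using that by simp
    qed
    have "indicator {0..L} t *\<^sub>R ?g (x(i := t)) = ?g (x(i := t))" for t
      using test_fun_vanishes[OF g x[of t]] out[of t] by (auto simp: indicator_def)
    then have "(\<integral>t. ?g (x(i := t)) \<partial>lborel) = (\<integral>t. indicator {0..L} t *\<^sub>R ?g (x(i := t)) \<partial>lborel)"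
      by simp
    also have "\<dots> = \<phi> (x(i := L)) - \<phi> (x(i := 0))"
    proof (rule integral_FTC_Icc)
      show "((\<lambda>t. \<phi> (x(i := t))) has_vector_derivative ?g (x(i := t))) (at t within {0..L})" for t
        using smooth_has_vector_derivative[OF test_fun_smooth[OF \<phi>] i x[of 0]]
        by (auto intro: has_vector_derivative_at_within)
      show "continuous_on {0..L} (\<lambda>t. ?g (x(i := t)))"
        by (rule continuous_on_compose2[OF smooth_continuous[OF sg] continuous_on_fun_upd]) (use x in auto)
    qed (use L in simp)
    also have "\<dots> = 0"
      using test_fun_vanishes[OF \<phi> x out, of L] test_fun_vanishes[OF \<phi> x out, of 0] by simp
    finally show "(\<integral>t. ?g (x(i := t)) \<partial>lborel) = 0" .
  qed
  finally show ?thesis by simp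
qed

text \<open>The derivative of \<open>\<psi> * \<phi>\<close> has integral 0, the compact support
  being inherited from \<open>\<phi>\<close>.\<close>

lemma integration_by_parts:
  assumes \<phi>: "\<phi> \<in> test_fun d (cube d L)" and \<psi>: "smooth d \<psi>" and i: "i < d" and L: "L > 0"
  shows "(\<integral>x. \<psi> x * partial i \<phi> x \<partial>leb_on d (cube d L)) = - (\<integral>x. partial i \<psi> x * \<phi> x \<partial>leb_on d (cube d L))"
proof -
  have L2s: "(\<lambda>x. \<psi> x * \<phi> x) \<in> L2 (leb_on d (cube d L))"
    if "\<phi> \<in> test_fun d (cube d L)" "smooth d \<psi>" for \<phi> \<psi>
    by (rule test_fun_L2[OF test_fun_mult[OF that] cube_subset_euclid cube_sets order_refl])
  interpret finite_measure "leb_on d (cube d L)" by (rule finite_leb_on[of _ _ L]) auto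
  have "(\<lambda>x. 1) \<in> L2 (leb_on d (cube d L))" by (rule bounded_L2[of _ _ L _ 1]) auto
  from L2_mult_integrable[OF L2s this]
  have int: "integrable (leb_on d (cube d L)) (\<lambda>x. \<psi> x * \<phi> x)"
    if "\<phi> \<in> test_fun d (cube d L)" "smooth d \<psi>" for \<phi> \<psi>
    using that by simp
  have "0 = (\<integral>x. partial i (\<lambda>x. \<psi> x * \<phi> x) x \<partial>leb_on d (cube d L))"
    using integral_partial_test_fun[OF test_fun_mult[OF \<phi> \<psi>] i L] by simp
  also have "\<dots> = (\<integral>x. \<psi> x * partial i \<phi> x + partial i \<psi> x * \<phi> x \<partial>leb_on d (cube d L))"
    using cube_subset_euclid[of d L] partial_mult[OF \<psi> test_fun_smooth[OF \<phi>] i]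
    by (intro Bochner_Integration.integral_cong) auto
  also have "\<dots> = (\<integral>x. \<psi> x * partial i \<phi> x \<partial>leb_on d (cube d L)) + (\<integral>x. partial i \<psi> x * \<phi> x \<partial>leb_on d (cube d L))"
    by (intro Bochner_Integration.integral_add int test_fun_partial \<phi> smooth_partial \<psi> i)
  finally show ?thesis by (simp add: eq_neg_iff_add_eq_0)
qed

section \<open>Density of the test functions\<close>

text \<open>As a product over all of \<open>nat\<close>: on \<open>euclid d\<close> the coordinates
  from \<open>d\<close> on are fixed to \<open>undefined\<close>, so the additional factors are
  singletons and Tychonoff's theorem applies.\<close>

lemma compact_box: "compact {x \<in> euclid d. \<forall>i<d. l i \<le> x i \<and> x i \<le> u i}"
proof -
  let ?S = "\<lambda>i. if i < d then {l i..u i} else {undefined}"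
  have "{x \<in> euclid d. \<forall>i<d. l i \<le> x i \<and> x i \<le> u i} = (\<Pi>\<^sub>E i\<in>UNIV. ?S i)"
    by (auto simp: euclid_def PiE_iff extensional_def split: if_splits)
  moreover have "compactin (product_topology (\<lambda>_. euclidean) UNIV) (\<Pi>\<^sub>E i\<in>UNIV. ?S i)"
    unfolding compactin_PiE by auto
  ultimately show ?thesis by (simp add: euclidean_product_topology)
qed

section \<open>Smooth approximation of boxes\<close>

lemma flat_1_nonneg: "0 \<le> flat 1 t"
  by (simp add: flat_def)

lemma flat_1_le_1: "flat 1 t \<le> 1"
  by (simp add: flat_def)

lemma flat_nonpos [simp]: "t \<le> 0 \<Longrightarrow> flat p t = 0"
  by (simp add: flat_def)

lemma flat_1_tendsto_1: "(flat 1 \<longlongrightarrow> 1) at_top"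
proof -
  have "((\<lambda>t::real. exp (- (1 / t))) \<longlongrightarrow> exp (- 0)) at_top"
    by (intro tendsto_exp tendsto_minus tendsto_divide_0[OF tendsto_const] filterlim_at_top_imp_at_infinity filterlim_ident)
  then have "((\<lambda>t::real. exp (- (1 / t))) \<longlongrightarrow> 1) at_top" by simp
  then show ?thesis
    by (rule Lim_transform_eventually)
      (use eventually_gt_at_top[of "0::real"] in \<open>eventually_elim, simp add: flat_def\<close>)
qed

lemma Suc_mult_at_top:
  assumes "0 < c" shows "filterlim (\<lambda>n. real (Suc n) * c - 1) at_top sequentially"
proof -
  have "filterlim (\<lambda>n. - 1 + c * real (Suc n)) at_top sequentially"
    by (intro filterlim_tendsto_add_at_top[OF tendsto_const] filterlim_tendsto_pos_mult_at_top[OF tendsto_const assms]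
        filterlim_compose[OF filterlim_real_sequentially filterlim_Suc])
  then show ?thesis by (simp add: algebra_simps)
qed

lemma smooth_flat_coordinate:
  assumes "i < d" shows "smooth d (\<lambda>x. of_real (flat p (a * x i + b)))"
proof -
  have "(\<lambda>x::point. a * x i + b) = (\<lambda>x. b + (\<Sum>j<d. (if j = i then a else 0) * x j))"
    using assms by (auto simp: fun_eq_iff if_distrib[of "\<lambda>c. c * _"] cong: if_cong)
  from smooth_flat[OF this] show ?thesis .
qed

text \<open>\<open>flat 1\<close> is positive only at positive arguments, so the shift by -1 keeps
  the support at distance at least \<open>1 / (n + 1)\<close> from the faces of the box, hence
  inside a compact box. Inside the open box all arguments grow to infinity, where
  \<open>flat 1\<close> tends to 1.\<close>

definition bump :: "nat \<Rightarrow> point \<Rightarrow> point \<Rightarrow> nat \<Rightarrow> point \<Rightarrow> real" where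
  "bump d l u n x = (\<Prod>i<d. flat 1 (real (Suc n) * (x i - l i) - 1) * flat 1 (real (Suc n) * (u i - x i) - 1))"

lemma bump_bounds: "0 \<le> bump d l u n x" "bump d l u n x \<le> 1"
  unfolding bump_def
  by (intro prod_nonneg prod_le_1 ballI mult_nonneg_nonneg mult_le_one conjI flat_1_nonneg flat_1_le_1)+

lemma bump_test_fun:
  assumes "\<And>i. i < d \<Longrightarrow> 0 \<le> l i \<and> u i \<le> L"
  shows "(\<lambda>x. of_real (bump d l u n x)) \<in> test_fun d (cube d L)"
proof (rule test_funI)
  let ?N = "real (Suc n)"
  let ?C = "{x \<in> euclid d. \<forall>i<d. l i + 1 / ?N \<le> x i \<and> x i \<le> u i - 1 / ?N}"
  have "smooth d (\<lambda>x. \<Prod>i<d. complex_of_real (flat 1 (?N * x i + (- ?N * l i - 1)))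
      * complex_of_real (flat 1 (- ?N * x i + (?N * u i - 1))))"
    by (intro smooth_prod smooth_mult smooth_flat_coordinate) auto
  then show "smooth d (\<lambda>x. of_real (bump d l u n x))"
    by (simp add: bump_def algebra_simps)
  show "compact ?C" by (rule compact_box)
  have N: "1 / ?N > 0" by simp
  show "?C \<subseteq> cube d L"
  proof
    fix x assume x: "x \<in> ?C"
    have "0 < x i \<and> x i < L" if "i < d" for i
    proof -
      have "l i + 1 / ?N \<le> x i \<and> x i \<le> u i - 1 / ?N" using x that by blast
      then show ?thesis using assms[OF that] N by linarith
    qed
    then show "x \<in> cube d L" using x by (simp add: cube_def)
  qed
  fix x assume "x \<in> euclid d" "x \<notin> ?C"
  then obtain i where i: "i < d" "x i < l i + 1 / ?N \<or> u i - 1 / ?N < x i" by force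
  then have "?N * (x i - l i) - 1 \<le> 0 \<or> ?N * (u i - x i) - 1 \<le> 0"
    by (auto simp: field_simps)
  then have "bump d l u n x = 0"
    unfolding bump_def using i(1) by (intro prod_zero) (auto intro!: bexI[of _ i])
  then show "complex_of_real (bump d l u n x) = 0" by simp
qed

lemma bump_tendsto:
  "(\<lambda>n. bump d l u n x) \<longlonglongrightarrow> (if \<forall>i<d. l i < x i \<and> x i < u i then 1 else 0)"
proof (cases "\<forall>i<d. l i < x i \<and> x i < u i")
  case True
  have lim: "(\<lambda>n. flat 1 (real (Suc n) * c - 1)) \<longlonglongrightarrow> 1" if "c > 0" for c :: real
    by (rule filterlim_compose[OF flat_1_tendsto_1 Suc_mult_at_top[OF that]])
  have "(\<lambda>n. bump d l u n x) \<longlonglongrightarrow> (\<Prod>i<d. 1 * 1)"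
    unfolding bump_def using True by (intro tendsto_prod tendsto_mult lim) auto
  then show ?thesis using True by simp
next
  case False
  then obtain i where i: "i < d" "x i \<le> l i \<or> u i \<le> x i" by force
  have "bump d l u n x = 0" for n
  proof -
    have "real (Suc n) * (x i - l i) - 1 \<le> 0 \<or> real (Suc n) * (u i - x i) - 1 \<le> 0"
      using i(2) mult_nonneg_nonpos[of "real (Suc n)" "x i - l i"] mult_nonneg_nonpos[of "real (Suc n)" "u i - x i"]
      by linarith
    then show ?thesis
      unfolding bump_def using i(1) by (intro prod_zero) (auto intro!: bexI[of _ i])
  qed
  then show ?thesis using False by (simp only: if_False tendsto_const)
qed

text \<open>Membership in \<open>L2\<close> is built in, so that the property can be carried through
  an induction over measurable sets.\<close>

definition approximable :: "nat \<Rightarrow> real \<Rightarrow> (point \<Rightarrow> complex) \<Rightarrow> bool" where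
  "approximable d L f \<longleftrightarrow> f \<in> L2 (leb_on d (cube d L)) \<and>
    (\<forall>e>0. \<exists>\<phi>\<in>test_fun d (cube d L). L2_norm (leb_on d (cube d L)) (\<lambda>x. f x - \<phi> x) < e)"

lemma approximable_test_fun: "\<phi> \<in> test_fun d (cube d L) \<Longrightarrow> approximable d L \<phi>"
  unfolding approximable_def
  using test_fun_L2[OF _ cube_subset_euclid cube_sets order_refl] by (auto intro!: bexI[of _ \<phi>])

lemma approximable_limit:
  assumes s: "\<And>n. approximable d L (s n)" and f: "f \<in> L2 (leb_on d (cube d L))"
    and lim: "(\<lambda>n. L2_norm (leb_on d (cube d L)) (\<lambda>x. s n x - f x)) \<longlonglongrightarrow> 0"
  shows "approximable d L f"
  unfolding approximable_def
proof (intro conjI allI impI f)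
  fix e :: real assume "e > 0"
  let ?M = "leb_on d (cube d L)"
  obtain n where n: "L2_norm ?M (\<lambda>x. s n x - f x) < e / 2"
    using eventually_happens'[OF _ order_tendstoD(2)[OF lim, of "e / 2"]] \<open>e > 0\<close> by auto
  obtain \<phi> where \<phi>: "\<phi> \<in> test_fun d (cube d L)" "L2_norm ?M (\<lambda>x. s n x - \<phi> x) < e / 2"
    using s[of n] \<open>e > 0\<close> unfolding approximable_def by (meson half_gt_zero)
  have "L2_norm ?M (\<lambda>x. f x - \<phi> x) \<le> L2_norm ?M (\<lambda>x. f x - s n x) + L2_norm ?M (\<lambda>x. s n x - \<phi> x)"
    using s[of n] approximable_test_fun[OF \<phi>(1)] f
    by (intro L2_norm_triangle3) (auto simp: approximable_def)
  then have "L2_norm ?M (\<lambda>x. f x - \<phi> x) < e"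
    using n \<phi>(2) L2_norm_minus_commute[of ?M f "s n"] by linarith
  then show "\<exists>\<phi>\<in>test_fun d (cube d L). L2_norm ?M (\<lambda>x. f x - \<phi> x) < e" using \<phi>(1) by blast
qed

lemma approximable_linear:
  assumes f: "approximable d L f" and g: "approximable d L g"
  shows "approximable d L (\<lambda>x. f x + c * g x)"
  unfolding approximable_def
proof (intro conjI allI impI)
  let ?M = "leb_on d (cube d L)"
  have fg: "f \<in> L2 ?M" "g \<in> L2 ?M" using assms by (auto simp: approximable_def)
  then show "(\<lambda>x. f x + c * g x) \<in> L2 ?M" by (intro L2_add L2_scale)
  fix e :: real assume "e > 0"
  \<comment> \<open>The summand 1 keeps the divisor positive when \<open>c = 0\<close>.\<close>
  then have e: "e / 2 / (cmod c + 1) > 0" "e / 2 > 0" by (simp_all add: add_nonneg_pos)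
  obtain \<phi> where \<phi>: "\<phi> \<in> test_fun d (cube d L)" "L2_norm ?M (\<lambda>x. f x - \<phi> x) < e / 2"
    using f e(2) unfolding approximable_def by blast
  obtain \<psi> where \<psi>: "\<psi> \<in> test_fun d (cube d L)" "L2_norm ?M (\<lambda>x. g x - \<psi> x) < e / 2 / (cmod c + 1)"
    using g e(1) unfolding approximable_def by blast
  have "L2_norm ?M (\<lambda>x. (f x - \<phi> x) + c * (g x - \<psi> x))
      \<le> L2_norm ?M (\<lambda>x. f x - \<phi> x) + L2_norm ?M (\<lambda>x. c * (g x - \<psi> x))"
    using approximable_test_fun[OF \<phi>(1)] approximable_test_fun[OF \<psi>(1)] fg
    by (intro L2_norm_triangle L2_diff L2_scale) (auto simp: approximable_def)
  moreover have "L2_norm ?M (\<lambda>x. c * (g x - \<psi> x)) \<le> e / 2"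
  proof -
    have "cmod c * L2_norm ?M (\<lambda>x. g x - \<psi> x) \<le> (cmod c + 1) * (e / 2 / (cmod c + 1))"
      using \<psi>(2) by (intro mult_mono) auto
    also have "\<dots> = e / 2"
    proof -
      have "b * (e / 2 / b) = e / 2" if "b > 0" for b using that by simp
      then show ?thesis using add_nonneg_pos[OF norm_ge_zero[of c] zero_less_one] by blast
    qed
    finally show ?thesis by (simp add: L2_norm_scale)
  qed
  moreover have "(\<lambda>x. (f x + c * g x) - (\<phi> x + c * \<psi> x)) = (\<lambda>x. (f x - \<phi> x) + c * (g x - \<psi> x))"
    by (simp add: algebra_simps)
  ultimately have "L2_norm ?M (\<lambda>x. (f x + c * g x) - (\<phi> x + c * \<psi> x)) < e"
    using \<phi>(2) by simp
  then show "\<exists>\<phi>\<in>test_fun d (cube d L). L2_norm ?M (\<lambda>x. (f x + c * g x) - \<phi> x) < e"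
    using test_fun_linear[OF \<phi>(1) \<psi>(1)] by (intro bexI[of _ "\<lambda>x. \<phi> x + c * \<psi> x"])
qed

lemma approximable_sum:
  "(\<And>i. i \<in> I \<Longrightarrow> approximable d L (f i)) \<Longrightarrow> approximable d L (\<lambda>x. \<Sum>i\<in>I. c i * f i x)"
proof (induction I rule: infinite_finite_induct)
  case (insert i I)
  then show ?case
    using approximable_linear[of d L "\<lambda>x. \<Sum>i\<in>I. c i * f i x" "f i" "c i"] by (simp add: add.commute)
qed (simp_all add: approximable_test_fun test_fun_zero)

lemma approximable_cong_AE:
  assumes f: "approximable d L f" and g: "g \<in> borel_measurable (leb_on d (cube d L))"
    and ae: "AE x in leb_on d (cube d L). f x = g x"
  shows "approximable d L g"
proof (rule approximable_limit[OF f])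
  let ?M = "leb_on d (cube d L)"
  have fL: "f \<in> L2 ?M" using f by (simp add: approximable_def)
  have "integrable ?M (\<lambda>x. (cmod (g x))\<^sup>2)"
    by (rule Bochner_Integration.integrable_bound[OF L2_square_integrable[OF fL]])
      (use g ae in \<open>auto elim!: eventually_mono\<close>)
  then show gL: "g \<in> L2 ?M" using g by (simp add: L2_def)
  have "L2_norm ?M (\<lambda>x. f x - g x) = 0" using L2_dist_eq_0_iff[OF fL gL] ae by simp
  then show "(\<lambda>n. L2_norm ?M (\<lambda>x. f x - g x)) \<longlonglongrightarrow> 0" by simp
qed

text \<open>The cube has finite measure, so the constant 1 is a square-integrable majorant.\<close>

lemma approximable_bounded_limit:
  assumes s: "\<And>n. approximable d L (s n)" and f: "f \<in> borel_measurable (leb_on d (cube d L))"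
    and bd: "\<And>n x. x \<in> cube d L \<Longrightarrow> cmod (s n x) \<le> 1"
    and lim: "\<And>x. x \<in> cube d L \<Longrightarrow> (\<lambda>n. s n x) \<longlonglongrightarrow> f x"
  shows "approximable d L f"
proof (rule approximable_limit[OF s])
  let ?M = "leb_on d (cube d L)"
  have one: "(\<lambda>x. 1) \<in> L2 ?M" by (rule bounded_L2[of _ _ L _ 1]) auto
  have "cmod (f x) \<le> 1" if "x \<in> cube d L" for x
    by (rule LIMSEQ_le_const2[OF tendsto_norm[OF lim[OF that]]]) (use bd that in auto)
  then show "f \<in> L2 ?M" by (intro bounded_L2[OF cube_sets order_refl f])
  show "(\<lambda>n. L2_norm ?M (\<lambda>x. s n x - f x)) \<longlonglongrightarrow> 0"
  proof (rule L2_dominated_convergence[OF _ f one])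
    show "s n \<in> borel_measurable ?M" for n
      using s[of n] by (auto simp: approximable_def dest: L2_measurable)
  qed (use bd lim in \<open>auto intro!: AE_I2\<close>)
qed

lemma indicator_measurable_leb_on:
  assumes "A \<in> sets (leb d)"
  shows "(\<lambda>x. indicator A x :: complex) \<in> borel_measurable (leb_on d \<Omega>)"
  by (intro measurable_leb_on borel_measurable_indicator assms)

lemma approximable_box:
  "approximable d L (indicator {x \<in> euclid d. \<forall>i<d. l i < x i \<and> x i < u i})"
proof (rule approximable_bounded_limit)
  \<comment> \<open>The bumps must have their support in the cube, so the box is intersected with
    it; on the cube this changes nothing.\<close>
  let ?l = "\<lambda>i. max 0 (l i)" and ?u = "\<lambda>i. min L (u i)"
  show "approximable d L (\<lambda>x. of_real (bump d ?l ?u n x))" for n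
    by (intro approximable_test_fun bump_test_fun) auto
  have "{x \<in> euclid d. \<forall>i<d. x i \<in> {l i<..<u i}} \<in> sets (leb d)"
    by (intro sets_leb_if_lborel_prod box_sets borel_open open_greaterThanLessThan)
  then show "(indicator {x \<in> euclid d. \<forall>i<d. l i < x i \<and> x i < u i} :: point \<Rightarrow> complex) \<in> borel_measurable (leb_on d (cube d L))"
    unfolding greaterThanLessThan_iff by (rule indicator_measurable_leb_on)
  show "cmod (of_real (bump d ?l ?u n x)) \<le> 1" for n x
    using bump_bounds[of d ?l ?u n x] by simp
  fix x assume x: "x \<in> cube d L"
  then have "(\<forall>i<d. ?l i < x i \<and> x i < ?u i) \<longleftrightarrow> (\<forall>i<d. l i < x i \<and> x i < u i)" "x \<in> euclid d"
    by (auto simp: cube_def)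
  then have eq: "(if \<forall>i<d. ?l i < x i \<and> x i < ?u i then 1 else 0)
      = (indicator {x \<in> euclid d. \<forall>i<d. l i < x i \<and> x i < u i} x :: real)"
    unfolding indicator_def by auto
  have "(\<lambda>n. bump d ?l ?u n x) \<longlonglongrightarrow> indicator {x \<in> euclid d. \<forall>i<d. l i < x i \<and> x i < u i} x"
    using bump_tendsto[of d ?l ?u x] unfolding eq .
  then show "(\<lambda>n. complex_of_real (bump d ?l ?u n x)) \<longlonglongrightarrow> indicator {x \<in> euclid d. \<forall>i<d. l i < x i \<and> x i < u i} x"
    by (drule_tac tendsto_of_real[where 'a = complex]) (auto simp: indicator_def of_bool_def split: if_splits)
qed

text \<open>Dynkin's argument: open boxes form an intersection-stable generator, and the sets with
  approximable indicator are closed under complements and countable disjoint unions.\<close>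

lemma approximable_indicator_lborel_prod:
  assumes "A \<in> sets (lborel_prod d)"
  shows "approximable d L (indicator A)"
proof -
  define I where "I = range (\<lambda>(a::real, b). box a b)"
  define G where "G = {{x \<in> euclid d. \<forall>i\<in>j. x i \<in> F i} | F j. j \<in> {{..<d}} \<and> F \<in> Pi j (\<lambda>_. I)}"
  have gen: "sets (lborel_prod d) = sigma_sets (euclid d) G"
  proof -
    have "sets (lborel_prod d) = sets (\<Pi>\<^sub>M i\<in>{..<d}. sigma UNIV I)"
    proof (rule sets_PiM_cong)
      show "sets lborel = sets (sigma UNIV I)" unfolding I_def borel_eq_box[symmetric] by simp
    qed simp
    also have "\<dots> = sets (sigma (euclid d) G)"
      unfolding G_def euclid_def
    proof (rule sets_PiM_sigma)
      have "x \<in> (\<Union>n. box (- real n) (real n))" for x :: real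
      proof -
        obtain n where "\<bar>x\<bar> < real n" using reals_Archimedean2 by blast
        then have "x \<in> box (- real n) (real n)" by (auto simp: abs_less_iff)
        then show ?thesis by blast
      qed
      then have "UNIV = \<Union> (range (\<lambda>n. box (- real n) (real n)))" by blast
      then show "\<exists>S\<subseteq>I. countable S \<and> UNIV = \<Union> S"
        by (intro exI[of _ "range (\<lambda>n. box (- real n) (real n))"]) (auto simp: I_def)
    qed auto
    also have "\<dots> = sigma_sets (euclid d) G"
      by (rule sets_measure_of) (auto simp: G_def)
    finally show ?thesis .
  qed
  have box: "\<exists>l u. B = {x \<in> euclid d. \<forall>i<d. l i < x i \<and> x i < u i}" if BG: "B \<in> G" for B
  proof -
    obtain F where B: "B = {x \<in> euclid d. \<forall>i<d. x i \<in> F i}" and F: "\<forall>i<d. F i \<in> I"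
      using BG by (auto simp: G_def Pi_iff)
    have "\<forall>i. \<exists>p. i < d \<longrightarrow> F i = {fst p<..<snd p}" using F by (fastforce simp: I_def box_real)
    then obtain p where p: "\<And>i. i < d \<Longrightarrow> F i = {fst (p i)<..<snd (p i)}" by metis
    have "B = {x \<in> euclid d. \<forall>i<d. fst (p i) < x i \<and> x i < snd (p i)}"
      unfolding B using p by auto
    then show ?thesis by (intro exI)
  qed
  have stable: "Int_stable G"
  proof (rule Int_stableI)
    fix B C assume "B \<in> G" "C \<in> G"
    then obtain F F' where BC: "B = {x \<in> euclid d. \<forall>i\<in>{..<d}. x i \<in> F i}" "F \<in> Pi {..<d} (\<lambda>_. I)"
      "C = {x \<in> euclid d. \<forall>i\<in>{..<d}. x i \<in> F' i}" "F' \<in> Pi {..<d} (\<lambda>_. I)" by (auto simp: G_def)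
    have "X \<inter> Y \<in> I" if XY: "X \<in> I" "Y \<in> I" for X Y
    proof -
      obtain a b a' b' where "X = box a b" "Y = box a' b'" using XY unfolding I_def by auto
      then have "X \<inter> Y = (\<lambda>(a, b). box a b) (max a a', min b b')" by auto
      then show ?thesis unfolding I_def by (rule image_eqI) (rule UNIV_I)
    qed
    then have "(\<lambda>i. F i \<inter> F' i) \<in> Pi {..<d} (\<lambda>_. I)" using BC(2,4) by (simp add: Pi_iff)
    moreover have "B \<inter> C = {x \<in> euclid d. \<forall>i\<in>{..<d}. x i \<in> F i \<inter> F' i}" unfolding BC by auto
    ultimately show "B \<inter> C \<in> G" unfolding G_def
      by (intro CollectI exI[of _ "\<lambda>i. F i \<inter> F' i"] exI[of _ "{..<d}"] conjI singletonI)
  qed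
  moreover have "G \<subseteq> Pow (euclid d)" using box by fastforce
  moreover have "A \<in> sigma_sets (euclid d) G" using assms gen by simp
  ultimately show ?thesis
  proof (induction rule: sigma_sets_induct_disjoint)
    case (basic A)
    then obtain l u where A: "A = {x \<in> euclid d. \<forall>i<d. l i < x i \<and> x i < u i}" using box by blast
    show ?case unfolding A by (rule approximable_box)
  next
    case empty
    then show ?case using approximable_test_fun[OF test_fun_zero] by (simp add: indicator_def)
  next
    case (compl A)
    \<comment> \<open>The constant 1 agrees on the cube with the indicator of the cube, itself an
      open box; subtracting the indicator of \<open>A\<close> from it handles the
      complement.\<close>
    have "approximable d L (indicator {x \<in> euclid d. \<forall>i<d. 0 < x i \<and> x i < L})"
      by (rule approximable_box)
    then have cube: "approximable d L (indicator (cube d L))" by (simp add: cube_def)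
    have "A \<in> sets (leb d)" using compl gen by (intro sets_leb_if_lborel_prod) simp
    then have m: "euclid d - A \<in> sets (leb d)" using sets.compl_sets[of A "leb d"] by simp
    show ?case
    proof (rule approximable_cong_AE[OF approximable_linear[OF cube compl.IH, of "-1"]])
      show "AE x in leb_on d (cube d L). indicator (cube d L) x + - 1 * indicator A x = (indicator (euclid d - A) x :: complex)"
        using cube_subset_euclid[of d L] by (intro AE_I2) (auto simp: indicator_def)
    qed (rule indicator_measurable_leb_on[OF m])
  next
    case (union A)
    have A: "A n \<in> sets (leb d)" for n
      using union gen by (intro sets_leb_if_lborel_prod) auto
    show ?case
    proof (rule approximable_bounded_limit)
      show "approximable d L (\<lambda>x. \<Sum>n<N. 1 * indicator (A n) x)" for N
        by (intro approximable_sum union.IH)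
      show "(indicator (\<Union>n. A n) :: point \<Rightarrow> complex) \<in> borel_measurable (leb_on d (cube d L))"
        using A by (intro indicator_measurable_leb_on) auto
      fix x
      \<comment> \<open>By disjointness the partial sums are again indicators, hence bounded by
        1.\<close>
      have e: "(\<Sum>n<N. 1 * indicator (A n) x) = (indicator (\<Union>n<N. A n) x :: complex)" for N
        using union(1) indicator_UN_disjoint[of "{..<N}" A x, where 'c = complex]
        by (simp add: disjoint_family_on_def)
      show "cmod (\<Sum>n<N. 1 * indicator (A n) x) \<le> 1" for N
        unfolding e by (simp add: indicator_def)
      show "(\<lambda>N. \<Sum>n<N. 1 * indicator (A n) x) \<longlonglongrightarrow> (indicator (\<Union>n. A n) x :: complex)"
        unfolding e by (rule LIMSEQ_indicator_UN)
    qed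
  qed
qed

text \<open>A set of the completion differs from one of the product sigma-algebra only within a null
  set, which \<open>L2\<close> does not see.\<close>

lemma approximable_indicator:
  assumes "A \<in> sets (leb d)"
  shows "approximable d L (indicator A)"
proof -
  obtain S N N' where A: "A = S \<union> N" "N \<subseteq> N'" "N' \<in> null_sets (lborel_prod d)" "S \<in> sets (lborel_prod d)"
    using assms unfolding leb_def by (elim sets_completionE)
  have "AE x in leb d. x \<notin> N'"
    using A(3) null_sets_completionI[of N' "lborel_prod d"] by (intro AE_not_in) (simp add: leb_def)
  then have "AE x in leb_on d (cube d L). x \<notin> N'"
    unfolding leb_on_def using cube_subset_euclid[of d L] by (subst AE_restrict_space_iff) (auto simp: Int_absorb2)
  then have "AE x in leb_on d (cube d L). indicator S x = (indicator A x :: complex)"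
    using A(2) by (auto simp: A(1) indicator_def elim!: eventually_mono)
  then show ?thesis
    by (rule approximable_cong_AE[OF approximable_indicator_lborel_prod[OF A(4)]
          indicator_measurable_leb_on[OF assms]])
qed

text \<open>Simple functions that converge pointwise and stay below twice the modulus of
  \<open>f\<close> converge in \<open>L2\<close>, and each is almost everywhere a finite combination
  of indicators.\<close>

theorem test_fun_dense_cube:
  assumes f: "f \<in> L2 (leb_on d (cube d L))"
  shows "approximable d L f"
proof -
  let ?M = "leb_on d (cube d L)"
  obtain s where s: "\<And>n. simple_function ?M (s n)"
    "\<And>x. x \<in> space ?M \<Longrightarrow> (\<lambda>n. s n x) \<longlonglongrightarrow> f x"
    "\<And>n x. x \<in> space ?M \<Longrightarrow> dist (s n x) 0 \<le> 2 * dist (f x) 0"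
    using borel_measurable_implies_sequence_metric[OF L2_measurable[OF f], of 0] by blast
  have w: "(\<lambda>x. 2 * f x) \<in> L2 ?M" by (rule L2_scale[OF f])
  have sL: "approximable d L (s n)" for n
  proof (rule approximable_cong_AE)
    have "(s n) -` {y} \<inter> space ?M \<in> sets (leb d)" for y
      using simple_functionD(2)[OF s(1), of n "{y}"] cube_subset_euclid[of d L] unfolding leb_on_def
      by (subst (asm) sets_restrict_space_iff) (auto simp: Int_absorb2)
    then show "approximable d L (\<lambda>x. \<Sum>y\<in>s n ` space ?M. y * indicator ((s n) -` {y} \<inter> space ?M) x)"
      by (intro approximable_sum approximable_indicator)
    show "s n \<in> borel_measurable ?M" by (rule borel_measurable_simple_function[OF s(1)])
    show "AE x in ?M. (\<Sum>y\<in>s n ` space ?M. y * indicator ((s n) -` {y} \<inter> space ?M) x) = s n x"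
    proof (rule AE_I2)
      fix x assume x: "x \<in> space ?M"
      have "(\<Sum>y\<in>s n ` space ?M. y * indicator ((s n) -` {y} \<inter> space ?M) x)
          = (\<Sum>y\<in>s n ` space ?M. if y = s n x then y else 0)"
        using x by (intro sum.cong) (auto simp: indicator_def)
      then show "(\<Sum>y\<in>s n ` space ?M. y * indicator ((s n) -` {y} \<inter> space ?M) x) = s n x"
        using x simple_functionD(1)[OF s(1)] by (simp add: sum.delta)
    qed
  qed
  show ?thesis
  proof (rule approximable_limit[OF sL f])
    show "(\<lambda>n. L2_norm ?M (\<lambda>x. s n x - f x)) \<longlonglongrightarrow> 0"
      using s by (intro L2_dominated_convergence[OF _ L2_measurable[OF f] w] AE_I2
          borel_measurable_simple_function) (auto simp: norm_mult)
  qed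
qed

section \<open>Reflection of the cube\<close>

text \<open>Turns test functions of the cube into test functions of the half below the diagonal:
  because of the shift by -1 it vanishes already where
  \<open>x 0 - x 1 \<le> 1 / (n + 1)\<close>.\<close>

definition cutoff :: "nat \<Rightarrow> point \<Rightarrow> real" where
  "cutoff n x = flat 1 (real (Suc n) * (x 0 - x 1) - 1)"

definition cutoff_deriv :: "nat \<Rightarrow> nat \<Rightarrow> point \<Rightarrow> real" where
  "cutoff_deriv i n x = (if i = 0 then 1 else if i = 1 then -1 else 0) *
    (real (Suc n) * flat (flat_deriv 1) (real (Suc n) * (x 0 - x 1) - 1))"

lemma cutoff_linear:
  assumes "2 \<le> d"
  shows "(\<lambda>x::point. a * (x 0 - x 1) - b) =
    (\<lambda>x. - b + (\<Sum>j<d. (a * (if j = 0 then 1 else if j = 1 then -1 else 0)) * x j))"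
proof
  fix x :: point
  have "(\<Sum>j<d. (a * (if j = 0 then 1 else if j = 1 then -1 else 0)) * x j)
      = (\<Sum>j\<in>{0, 1}. (a * (if j = 0 then 1 else if j = 1 then -1 else 0)) * x j)"
    using assms by (intro sum.mono_neutral_right) auto
  then show "a * (x 0 - x 1) - b =
      - b + (\<Sum>j<d. (a * (if j = 0 then 1 else if j = 1 then -1 else 0)) * x j)"
    by (simp add: algebra_simps)
qed

lemma smooth_cutoff: "2 \<le> d \<Longrightarrow> smooth d (\<lambda>x. of_real (cutoff n x))"
  unfolding cutoff_def by (rule smooth_flat[OF cutoff_linear])

lemma partial_cutoff:
  assumes "2 \<le> d" "i < d"
  shows "partial i (\<lambda>x. of_real (cutoff n x)) x = of_real (cutoff_deriv i n x)"
  using has_partial_flat[OF cutoff_linear[OF assms(1), of "real (Suc n)" 1] assms(2), where p = 1 and x = x]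
  unfolding cutoff_def cutoff_deriv_def by (intro partial_eqI) (simp only: mult.assoc mult.left_commute mult.commute)

lemma cutoff_deriv_flip: "cutoff_deriv (flip i) n x = - cutoff_deriv i n x"
  by (auto simp: cutoff_deriv_def Transposition.transpose_def)

lemma cutoff_bounds: "0 \<le> cutoff n x" "cutoff n x \<le> 1"
  by (simp_all add: cutoff_def flat_1_nonneg flat_1_le_1)

lemma cutoff_eq_0: "x 0 - x 1 \<le> 1 / real (Suc n) \<Longrightarrow> cutoff n x = 0"
  unfolding cutoff_def by (intro flat_nonpos) (simp add: field_simps)

lemma cutoff_tendsto: "x 1 < x 0 \<Longrightarrow> (\<lambda>n. cutoff n x) \<longlonglongrightarrow> 1"
  unfolding cutoff_def by (rule filterlim_compose[OF flat_1_tendsto_1 Suc_mult_at_top]) simp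

text \<open>For \<open>y + 1 = (n + 1) * (x 0 - x 1)\<close> the left side is, up to sign,
  \<open>x 0 - x 1\<close> times a derivative of the cut-off in direction 0 or 1. Written in
  \<open>y\<close> it no longer mentions \<open>n\<close>, so one bound and one limit at infinity
  serve all cut-offs.\<close>

lemma flat_deriv_1: "y > 0 \<Longrightarrow> (y + 1) * flat (flat_deriv 1) y = (1 / y + (1 / y)\<^sup>2) * exp (- (1 / y))"
  by (simp add: flat_def flat_deriv_def field_simps power2_eq_square)

lemma flat_deriv_1_bound: "\<bar>(y + 1) * flat (flat_deriv 1) y\<bar> \<le> 3"
proof (cases "y > 0")
  case True
  define u where "u = 1 / y"
  have u: "u > 0" using True by (simp add: u_def)
  have "1 + u + u\<^sup>2 / 2 \<le> exp u" using u by (intro exp_lower_Taylor_quadratic) simp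
  \<comment> \<open>The origin of the 3: the Taylor bound gives \<open>u \<le> exp u\<close> and
    \<open>u^2 \<le> 2 * exp u\<close>.\<close>
  then have "u + u\<^sup>2 \<le> 3 * exp u" using u exp_gt_zero[of u] by linarith
  then have "(u + u\<^sup>2) * exp (- u) \<le> 3" by (simp add: exp_minus field_simps)
  moreover have "0 \<le> (u + u\<^sup>2) * exp (- u)" using u by simp
  ultimately show ?thesis using flat_deriv_1[OF True] by (simp add: u_def)
qed simp

lemma flat_deriv_1_tendsto: "((\<lambda>y. (y + 1) * flat (flat_deriv 1) y) \<longlongrightarrow> 0) at_top"
proof -
  have inv: "((\<lambda>y::real. 1 / y) \<longlongrightarrow> 0) at_top"
    by (intro tendsto_divide_0[OF tendsto_const] filterlim_at_top_imp_at_infinity filterlim_ident)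
  have "((\<lambda>y::real. (1 / y + (1 / y)\<^sup>2) * exp (- (1 / y))) \<longlongrightarrow> (0 + 0\<^sup>2) * exp (- 0)) at_top"
    by (intro tendsto_intros inv)
  then have "((\<lambda>y::real. (1 / y + (1 / y)\<^sup>2) * exp (- (1 / y))) \<longlongrightarrow> 0) at_top" by simp
  then show ?thesis
    by (rule Lim_transform_eventually)
      (use eventually_gt_at_top[of "0::real"] in \<open>eventually_elim, simp add: flat_deriv_1\<close>)
qed

lemma cutoff_deriv_bound: "\<bar>cutoff_deriv i n x\<bar> * \<bar>x 0 - x 1\<bar> \<le> 3"
proof -
  let ?y = "real (Suc n) * (x 0 - x 1) - 1"
  have "\<bar>cutoff_deriv i n x\<bar> * \<bar>x 0 - x 1\<bar> \<le> \<bar>(?y + 1) * flat (flat_deriv 1) ?y\<bar>"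
    by (auto simp: cutoff_deriv_def abs_mult)
  then show ?thesis using flat_deriv_1_bound[of ?y] by linarith
qed

lemma cutoff_deriv_tendsto:
  assumes "x 1 < x 0" shows "(\<lambda>n. cutoff_deriv i n x * (x 0 - x 1)) \<longlonglongrightarrow> 0"
proof -
  let ?y = "\<lambda>n. real (Suc n) * (x 0 - x 1) - 1"
  have "(\<lambda>n. (?y n + 1) * flat (flat_deriv 1) (?y n)) \<longlonglongrightarrow> 0"
    by (rule filterlim_compose[OF flat_deriv_1_tendsto Suc_mult_at_top]) (use assms in simp)
  from tendsto_mult_right_zero[OF this, of "if i = 0 then 1 else if i = 1 then -1 else 0"]
  show ?thesis by (simp add: cutoff_deriv_def mult_ac)
qed

section \<open>The two halves of the cube\<close>

locale reflected_cube =
  fixes d :: nat and L :: real and \<epsilon> :: complex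
  assumes d: "2 \<le> d" and L: "0 < L" and \<epsilon>: "\<epsilon> = 1 \<or> \<epsilon> = -1"
begin

abbreviation "Q \<equiv> cube d L"
definition "T = {x \<in> cube d L. x 1 < x 0}"

abbreviation "MQ \<equiv> leb_on d Q"
abbreviation "MT \<equiv> leb_on d T"

lemma \<epsilon>_simps [simp]: "\<epsilon> * \<epsilon> = 1" "\<epsilon> * (\<epsilon> * z) = z" "cnj \<epsilon> = \<epsilon>" "cmod \<epsilon> = 1"
  using \<epsilon> by auto

lemma T_subset: "T \<subseteq> Q"
  by (auto simp: T_def)

lemma T_euclid: "T \<subseteq> euclid d"
  using T_subset cube_subset_euclid by blast

lemma T_sets [simp]: "T \<in> sets (leb d)"
proof -
  have "{x \<in> space (lborel_prod d). x 1 < x 0} \<in> sets (lborel_prod d)"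
    using coordinate_measurable[of 0 d] coordinate_measurable[of 1 d] d
    by (intro borel_measurable_less) auto
  then have "Q \<inter> {x \<in> space (lborel_prod d). x 1 < x 0} \<in> sets (lborel_prod d)"
    using cube_sets_lborel by blast
  moreover have "Q \<inter> {x \<in> space (lborel_prod d). x 1 < x 0} = T"
    using cube_subset_euclid by (auto simp: T_def space_lborel_prod)
  ultimately show ?thesis by (metis sets_leb_if_lborel_prod)
qed

lemma swap_Q [simp]: "swap x \<in> Q \<longleftrightarrow> x \<in> Q"
proof -
  have *: "swap x \<in> Q" if "x \<in> Q" for x
    using that d unfolding cube_def by (auto simp: swap_apply)
  show ?thesis using *[of x] *[of "swap x"] by auto
qed

lemma swap_image_Q: "swap ` Q \<subseteq> Q"
  by auto

lemma swap_T: "swap x \<in> T \<longleftrightarrow> x \<in> Q \<and> x 0 < x 1"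
  by (auto simp: T_def)

lemma swap_not_T: "x \<in> T \<Longrightarrow> swap x \<notin> T"
  by (auto simp: swap_T) (auto simp: T_def)

lemma L2_swap_Q: "g \<in> L2 MQ \<Longrightarrow> (\<lambda>x. g (swap x)) \<in> L2 MQ"
  using L2_swap[OF d, of "\<lambda>x. indicator Q x *\<^sub>R g x"] by (simp add: L2_leb_on_iff indicator_def)

lemma L2_T: "g \<in> L2 MQ \<Longrightarrow> g \<in> L2 MT"
  by (rule L2_leb_on_mono[OF _ T_sets cube_sets T_subset])

lemma AE_off_diagonal: "AE x in leb d. x 0 \<noteq> x 1"
proof -
  have "AE x in leb d. x \<notin> {x \<in> euclid d. x 0 = x 1}"
    by (rule AE_not_in[OF diagonal_null[OF d]])
  then show ?thesis using AE_space by eventually_elim auto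
qed

text \<open>Up to the diagonal, a null set, \<open>Q\<close> is the union of \<open>T\<close> and
  its mirror image, and \<open>swap\<close> preserves the measure.\<close>

lemma integral_Q_split:
  fixes g :: "point \<Rightarrow> 'a::{banach, second_countable_topology}"
  assumes g: "integrable MQ g"
  shows "(\<integral>x. g x \<partial>MQ) = (\<integral>x. g x + g (swap x) \<partial>MT)"
    and "integrable MT (\<lambda>x. g x + g (swap x))"
proof -
  have Q: "Q \<inter> space (leb d) \<in> sets (leb d)" and T: "T \<inter> space (leb d) \<in> sets (leb d)"
    using cube_subset_euclid[of d L] T_euclid by (auto simp: Int_absorb2)
  let ?g = "\<lambda>x. indicator Q x *\<^sub>R g x"
  have i: "integrable (leb d) ?g"
    using g Q by (simp add: leb_on_def integrable_restrict_space)
  have i1: "integrable (leb d) (\<lambda>x. indicator T x *\<^sub>R ?g x)"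
    by (rule integrable_mult_indicator[OF T_sets i])
  have i2: "integrable (leb d) (\<lambda>x. indicator T x *\<^sub>R ?g (swap x))"
    by (rule integrable_mult_indicator[OF T_sets integrable_swap[OF d i]])
  have i3: "integrable (leb d) (\<lambda>x. indicator T (swap x) *\<^sub>R ?g x)"
    using integrable_swap[OF d i2] by simp
  have eq: "indicator T x *\<^sub>R (g x + g (swap x)) = indicator T x *\<^sub>R ?g x + indicator T x *\<^sub>R ?g (swap x)" for x
    using T_subset by (auto simp: indicator_def)
  have "integrable (leb d) (\<lambda>x. indicator T x *\<^sub>R (g x + g (swap x)))"
    unfolding eq using i1 i2 by simp
  then show "integrable MT (\<lambda>x. g x + g (swap x))"
    using T by (simp add: leb_on_def integrable_restrict_space)
  have "(\<integral>x. g x \<partial>MQ) = (\<integral>x. ?g x \<partial>leb d)"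
    using Q by (simp add: leb_on_def integral_restrict_space)
  also have "\<dots> = (\<integral>x. indicator T x *\<^sub>R ?g x + indicator T (swap x) *\<^sub>R ?g x \<partial>leb d)"
  proof (rule integral_cong_AE)
    show "AE x in leb d. ?g x = indicator T x *\<^sub>R ?g x + indicator T (swap x) *\<^sub>R ?g x"
      using AE_off_diagonal by eventually_elim (auto simp: indicator_def swap_T T_def)
  qed (use i i1 i3 in auto)
  also have "\<dots> = (\<integral>x. indicator T x *\<^sub>R ?g x \<partial>leb d) + (\<integral>x. indicator T (swap x) *\<^sub>R ?g x \<partial>leb d)"
    using i1 i3 by simp
  also have "(\<integral>x. indicator T (swap x) *\<^sub>R ?g x \<partial>leb d) = (\<integral>x. indicator T x *\<^sub>R ?g (swap x) \<partial>leb d)"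
    using integral_swap[OF d borel_measurable_integrable[OF i2]] by simp
  also have "(\<integral>x. indicator T x *\<^sub>R ?g x \<partial>leb d) + \<dots> = (\<integral>x. indicator T x *\<^sub>R (g x + g (swap x)) \<partial>leb d)"
    unfolding eq using i1 i2 by simp
  also have "\<dots> = (\<integral>x. g x + g (swap x) \<partial>MT)"
    using T by (simp add: leb_on_def integral_restrict_space)
  finally show "(\<integral>x. g x \<partial>MQ) = (\<integral>x. g x + g (swap x) \<partial>MT)" .
qed

definition c :: complex where "c = of_real (sqrt (1 / 2))"

lemma c_simps [simp]: "c * c = 1 / 2" "cnj c = c" "(cmod c)\<^sup>2 = 1 / 2"
proof -
  have "c * c = of_real (sqrt (1 / 2) * sqrt (1 / 2))" unfolding c_def of_real_mult ..
  then show "c * c = 1 / 2" by simp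
qed (simp_all add: c_def)

definition extend :: "(point \<Rightarrow> complex) \<Rightarrow> point \<Rightarrow> complex" where
  "extend f x = (if x \<in> T then f x else 0)"

definition V :: "(point \<Rightarrow> complex) \<Rightarrow> point \<Rightarrow> complex" where
  "V f x = c * (extend f x + \<epsilon> * extend f (swap x))"

definition W :: "(point \<Rightarrow> complex) \<Rightarrow> point \<Rightarrow> complex" where
  "W g x = c * (g x + \<epsilon> * g (swap x))"

text \<open>The candidate for the gradient of \<open>V f\<close>. By the chain rule the
  \<open>i\<close>-th derivative of \<open>f \<circ> swap\<close> is the \<open>flip i\<close>-th
  derivative of \<open>f\<close> composed with \<open>swap\<close>, so the reflected part exchanges
  the first two components. The same holds for \<open>grad_W\<close>.\<close>

definition grad_V :: "(nat \<Rightarrow> point \<Rightarrow> complex) \<Rightarrow> nat \<Rightarrow> point \<Rightarrow> complex" where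
  "grad_V F i x = c * (extend (F i) x + \<epsilon> * extend (F (flip i)) (swap x))"

definition grad_W :: "(nat \<Rightarrow> point \<Rightarrow> complex) \<Rightarrow> nat \<Rightarrow> point \<Rightarrow> complex" where
  "grad_W G i x = c * (G i x + \<epsilon> * G (flip i) (swap x))"

lemma extend_T: "x \<in> T \<Longrightarrow> extend f x = f x" "x \<in> T \<Longrightarrow> extend f (swap x) = 0"
  using swap_not_T by (auto simp: extend_def)

lemma extend_L2: "f \<in> L2 MT \<Longrightarrow> extend f \<in> L2 MQ"
proof -
  have "(\<lambda>x. indicator Q x *\<^sub>R extend f x) = (\<lambda>x. indicator T x *\<^sub>R f x)"
    using T_subset by (auto simp: extend_def indicator_def fun_eq_iff)
  then show "f \<in> L2 MT \<Longrightarrow> extend f \<in> L2 MQ" by (simp add: L2_leb_on_iff)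
qed

lemma L2_norm_extend: "L2_norm MQ (extend f) = L2_norm MT f"
proof -
  have "(L2_norm MQ (extend f))\<^sup>2 = (L2_norm MT f)\<^sup>2"
    unfolding L2_norm_leb_on[OF cube_sets] L2_norm_leb_on[OF T_sets]
    using T_subset by (intro Bochner_Integration.integral_cong) (auto simp: extend_def indicator_def)
  then show ?thesis by (simp add: power2_eq_iff_nonneg)
qed

lemma L2_norm_swap:
  assumes "g \<in> L2 MQ" shows "L2_norm MQ (\<lambda>x. g (swap x)) = L2_norm MQ g"
proof -
  have "(\<lambda>x. (cmod (g x))\<^sup>2) \<in> borel_measurable MQ" using L2_square_integrable[OF assms] by blast
  then have "(\<lambda>x. indicator Q x *\<^sub>R (cmod (g x))\<^sup>2) \<in> borel_measurable (leb d)"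
    unfolding leb_on_def using cube_subset_euclid[of d L]
    by (subst (asm) borel_measurable_restrict_space_iff) (auto simp: Int_absorb2)
  then have "(L2_norm MQ (\<lambda>x. g (swap x)))\<^sup>2 = (L2_norm MQ g)\<^sup>2"
    unfolding L2_norm_leb_on[OF cube_sets]
    using integral_swap[OF d, of "\<lambda>x. indicator Q x * (cmod (g x))\<^sup>2"] by (simp add: indicator_def)
  then show ?thesis by (simp add: power2_eq_iff_nonneg)
qed

lemma V_L2: "f \<in> L2 MT \<Longrightarrow> V f \<in> L2 MQ"
  unfolding V_def by (intro L2_scale L2_add L2_swap_Q extend_L2)

lemma W_L2_Q: "g \<in> L2 MQ \<Longrightarrow> W g \<in> L2 MQ"
  unfolding W_def by (intro L2_scale L2_add L2_swap_Q)

lemma W_L2: "g \<in> L2 MQ \<Longrightarrow> W g \<in> L2 MT"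
  by (intro L2_T W_L2_Q)

lemma grad_V_L2: "F i \<in> L2 MT \<Longrightarrow> F (flip i) \<in> L2 MT \<Longrightarrow> grad_V F i \<in> L2 MQ"
  unfolding grad_V_def by (intro L2_scale L2_add L2_swap_Q extend_L2)

lemma grad_W_L2: "G i \<in> L2 MQ \<Longrightarrow> G (flip i) \<in> L2 MQ \<Longrightarrow> grad_W G i \<in> L2 MT"
  unfolding grad_W_def by (intro L2_T L2_scale L2_add L2_swap_Q)

lemma V_T: "x \<in> T \<Longrightarrow> V f x = c * f x" "x \<in> T \<Longrightarrow> V f (swap x) = c * (\<epsilon> * f x)"
  by (simp_all add: V_def extend_T)

lemma grad_V_T:
  "x \<in> T \<Longrightarrow> grad_V F i x = c * F i x"
  "x \<in> T \<Longrightarrow> grad_V F i (swap x) = c * (\<epsilon> * F (flip i) x)"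
  by (simp_all add: grad_V_def extend_T)

text \<open>Under \<open>V\<close> each half of \<open>Q\<close> carries half of the squared norm of
  \<open>f\<close>, because \<open>c\<close> has squared modulus 1/2 and \<open>\<epsilon>\<close>
  modulus 1. For \<open>W\<close> this factor 1/2 cancels the 2 in the elementary bound for the
  square of a sum.\<close>

sublocale L2_coisometry MQ MT V W
proof
  show iso: "L2_norm MQ (V f) = L2_norm MT f" if f: "f \<in> L2 MT" for f
  proof -
    have "(L2_norm MQ (V f))\<^sup>2 = (\<integral>x. (cmod (V f x))\<^sup>2 + (cmod (V f (swap x)))\<^sup>2 \<partial>MT)"
      unfolding L2_norm_power2 by (rule integral_Q_split(1)[OF L2_square_integrable[OF V_L2[OF f]]])
    also have "\<dots> = (\<integral>x. (cmod (f x))\<^sup>2 \<partial>MT)"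
      by (intro Bochner_Integration.integral_cong) (simp_all add: V_T norm_mult power_mult_distrib)
    finally have "(L2_norm MQ (V f))\<^sup>2 = (L2_norm MT f)\<^sup>2" by (simp add: L2_norm_power2)
    then show ?thesis by (simp add: power2_eq_iff_nonneg)
  qed
  show "L2_norm MQ (V f) \<le> L2_norm MT f" if "f \<in> L2 MT" for f using iso[OF that] by simp
  show "L2_norm MT (W g) \<le> L2_norm MQ g" if g: "g \<in> L2 MQ" for g
  proof -
    have "(L2_norm MT (W g))\<^sup>2 \<le> (\<integral>x. (cmod (g x))\<^sup>2 + (cmod (g (swap x)))\<^sup>2 \<partial>MT)"
      unfolding L2_norm_power2
    proof (rule integral_mono)
      show "integrable MT (\<lambda>x. (cmod (g x))\<^sup>2 + (cmod (g (swap x)))\<^sup>2)"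
        by (rule integral_Q_split(2)[OF L2_square_integrable[OF g]])
      show "integrable MT (\<lambda>x. (cmod (W g x))\<^sup>2)" by (rule L2_square_integrable[OF W_L2[OF g]])
      fix x
      have "(cmod (W g x))\<^sup>2 = (cmod (g x + \<epsilon> * g (swap x)))\<^sup>2 / 2"
        by (simp add: W_def norm_mult power_mult_distrib)
      then show "(cmod (W g x))\<^sup>2 \<le> (cmod (g x))\<^sup>2 + (cmod (g (swap x)))\<^sup>2"
        using cmod_add_power2_le[of "g x" "\<epsilon> * g (swap x)"] by (simp add: norm_mult)
    qed
    also have "\<dots> = (L2_norm MQ g)\<^sup>2"
      unfolding L2_norm_power2 by (rule integral_Q_split(1)[OF L2_square_integrable[OF g], symmetric])
    finally show ?thesis by (rule power2_le_imp_le) simp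
  qed
  show "W (V f) x = f x" if "x \<in> space MT" for f x
    using that by (simp add: W_def V_T algebra_simps) (simp add: mult.assoc[symmetric])
qed (auto simp: V_L2 W_L2 V_def W_def extend_def fun_eq_iff algebra_simps)

text \<open>The pairing is bilinear, as in \<open>weak_gradient\<close>, and \<open>W\<close> is the
  transpose of \<open>V\<close>. Since \<open>c\<close> and \<open>\<epsilon>\<close> are real,
  conjugation passes through both maps, and the same identity yields the one for inner
  products.\<close>

lemma integral_V_mult:
  assumes "f \<in> L2 MT" "g \<in> L2 MQ"
  shows "(\<integral>x. V f x * g x \<partial>MQ) = (\<integral>x. f x * W g x \<partial>MT)"
  unfolding integral_Q_split(1)[OF L2_mult_integrable[OF V_L2[OF assms(1)] assms(2)]]
  by (intro Bochner_Integration.integral_cong) (simp_all add: V_T W_def algebra_simps)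

lemma integral_grad_V_mult:
  assumes "F i \<in> L2 MT" "F (flip i) \<in> L2 MT" "g \<in> L2 MQ"
  shows "(\<integral>x. grad_V F i x * g x \<partial>MQ)
    = (\<integral>x. F i x * (c * g x) \<partial>MT) + (\<integral>x. F (flip i) x * (c * \<epsilon> * g (swap x)) \<partial>MT)"
proof -
  have "(\<integral>x. grad_V F i x * g x \<partial>MQ)
      = (\<integral>x. F i x * (c * g x) + F (flip i) x * (c * \<epsilon> * g (swap x)) \<partial>MT)"
    unfolding integral_Q_split(1)[OF L2_mult_integrable[OF grad_V_L2[OF assms(1,2)] assms(3)]]
    by (intro Bochner_Integration.integral_cong) (simp_all add: grad_V_T algebra_simps)
  also have "\<dots> = (\<integral>x. F i x * (c * g x) \<partial>MT) + (\<integral>x. F (flip i) x * (c * \<epsilon> * g (swap x)) \<partial>MT)"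
    by (intro Bochner_Integration.integral_add L2_mult_integrable assms L2_scale L2_T L2_swap_Q)
  finally show ?thesis .
qed

lemma flip_less: "i < d \<Longrightarrow> flip i < d"
  using d by simp

text \<open>A single component is not dual to the same component, because the reflection exchanges
  the first two. In the sum over \<open>i\<close>, reindexing by \<open>flip\<close> moves the
  exchange from \<open>F\<close> to \<open>G\<close>.\<close>

lemma gradient_duality:
  assumes F: "\<And>i. i < d \<Longrightarrow> F i \<in> L2 MT" and G: "\<And>i. i < d \<Longrightarrow> G i \<in> L2 MQ"
  shows "(\<integral>x. (\<Sum>i<d. grad_V F i x * G i x) \<partial>MQ) = (\<integral>x. (\<Sum>i<d. F i x * grad_W G i x) \<partial>MT)"
proof -
  have int: "integrable MT (\<lambda>x. F i x * (c * G i x))" "integrable MT (\<lambda>x. F i x * (c * \<epsilon> * G (flip i) (swap x)))"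
    if "i < d" for i
    using that flip_less by (intro L2_mult_integrable L2_scale L2_T L2_swap_Q F G; simp)+
  have "(\<integral>x. (\<Sum>i<d. grad_V F i x * G i x) \<partial>MQ) = (\<Sum>i<d. \<integral>x. grad_V F i x * G i x \<partial>MQ)"
    using flip_less by (intro Bochner_Integration.integral_sum L2_mult_integrable grad_V_L2 F G) auto
  also have "\<dots> = (\<Sum>i<d. (\<integral>x. F i x * (c * G i x) \<partial>MT))
      + (\<Sum>i<d. (\<integral>x. F (flip i) x * (c * \<epsilon> * G i (swap x)) \<partial>MT))"
    unfolding sum.distrib[symmetric] using flip_less
    by (intro sum.cong integral_grad_V_mult F G) auto
  also have "(\<Sum>i<d. (\<integral>x. F (flip i) x * (c * \<epsilon> * G i (swap x)) \<partial>MT))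
      = (\<Sum>i<d. (\<integral>x. F i x * (c * \<epsilon> * G (flip i) (swap x)) \<partial>MT))"
    by (rule sum.reindex_bij_witness[of _ flip flip]) (use d in auto)
  also have "(\<Sum>i<d. (\<integral>x. F i x * (c * G i x) \<partial>MT)) + \<dots> = (\<Sum>i<d. \<integral>x. F i x * grad_W G i x \<partial>MT)"
    unfolding sum.distrib[symmetric]
  proof (intro sum.cong refl)
    fix i assume "i \<in> {..<d}"
    then show "(\<integral>x. F i x * (c * G i x) \<partial>MT) + (\<integral>x. F i x * (c * \<epsilon> * G (flip i) (swap x)) \<partial>MT)
        = (\<integral>x. F i x * grad_W G i x \<partial>MT)"
      using int[of i] by (subst Bochner_Integration.integral_add[symmetric]) (auto simp: grad_W_def algebra_simps)
  qed
  also have "\<dots> = (\<integral>x. (\<Sum>i<d. F i x * grad_W G i x) \<partial>MT)"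
    using flip_less by (intro Bochner_Integration.integral_sum[symmetric] L2_mult_integrable grad_W_L2 F G) auto
  finally show ?thesis .
qed

lemma test_fun_L2_Q: "\<phi> \<in> test_fun d Q \<Longrightarrow> \<phi> \<in> L2 MQ"
  by (rule test_fun_L2[OF _ cube_subset_euclid cube_sets order_refl])

lemma test_fun_T_Q: "\<phi> \<in> test_fun d T \<Longrightarrow> \<phi> \<in> test_fun d Q"
  by (rule test_fun_mono[OF T_subset])

lemma test_fun_swap_Q: "\<phi> \<in> test_fun d Q \<Longrightarrow> (\<lambda>x. \<phi> (swap x)) \<in> test_fun d Q"
  by (rule test_fun_swap[OF _ d swap_image_Q])

lemma test_fun_vanishes_T: "\<phi> \<in> test_fun d T \<Longrightarrow> x \<in> Q \<Longrightarrow> x \<notin> T \<Longrightarrow> \<phi> x = 0"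
  using test_fun_vanishes[of \<phi> d T x] cube_subset_euclid by blast

lemma extend_test_fun: "\<phi> \<in> test_fun d T \<Longrightarrow> x \<in> Q \<Longrightarrow> extend \<phi> x = \<phi> x"
  using test_fun_vanishes_T by (auto simp: extend_def)

lemma weak_gradientD:
  assumes "weak_gradient d \<Omega> f F"
  shows "f \<in> L2 (leb_on d \<Omega>)" "i < d \<Longrightarrow> F i \<in> L2 (leb_on d \<Omega>)"
    "i < d \<Longrightarrow> \<phi> \<in> test_fun d \<Omega> \<Longrightarrow>
      (\<integral>x. f x * partial i \<phi> x \<partial>leb_on d \<Omega>) = - (\<integral>x. F i x * \<phi> x \<partial>leb_on d \<Omega>)"
  using assms unfolding weak_gradient_def by auto

text \<open>A test function \<open>\<phi>\<close> of \<open>T\<close> and its reflection are both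
  test functions of the cube, and on the cube \<open>V\<close> of a derivative of
  \<open>\<phi>\<close> is a combination of their derivatives. So the weak identities of
  \<open>g\<close> apply directly, for either sign.\<close>

lemma W_weak_gradient:
  assumes g: "weak_gradient d Q g G"
  shows "weak_gradient d T (W g) (grad_W G)"
  unfolding weak_gradient_def
proof (intro conjI allI impI ballI)
  note gL = weak_gradientD(1)[OF g] and GL = weak_gradientD(2)[OF g]
  show "W g \<in> L2 MT" by (rule W_L2[OF gL])
  fix i assume i: "i < d"
  show "grad_W G i \<in> L2 MT" using i flip_less by (intro grad_W_L2 GL)
  fix \<phi> assume \<phi>: "\<phi> \<in> test_fun d T"
  note \<phi>Q = test_fun_T_Q[OF \<phi>]
  let ?\<psi> = "\<lambda>x. \<phi> (swap x)"
  have \<psi>: "?\<psi> \<in> test_fun d Q" by (rule test_fun_swap_Q[OF \<phi>Q])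
  have pL: "partial i \<phi> \<in> L2 MT" by (intro L2_T test_fun_L2_Q test_fun_partial \<phi>Q i)
  have "(\<integral>x. W g x * partial i \<phi> x \<partial>MT) = (\<integral>x. V (partial i \<phi>) x * g x \<partial>MQ)"
    using integral_V_mult[OF pL gL] by (simp add: mult.commute)
  also have "\<dots> = (\<integral>x. c * (g x * partial i \<phi> x) + c * \<epsilon> * (g x * partial (flip i) ?\<psi> x) \<partial>MQ)"
  proof (intro Bochner_Integration.integral_cong refl)
    fix x assume "x \<in> space MQ"
    then have x: "x \<in> Q" "x \<in> euclid d" using cube_subset_euclid[of d L] by auto
    have "extend (partial i \<phi>) x = partial i \<phi> x" "extend (partial i \<phi>) (swap x) = partial i \<phi> (swap x)"
      using extend_test_fun[OF test_fun_partial[OF \<phi> i]] x by auto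
    moreover have "partial (flip i) ?\<psi> x = partial i \<phi> (swap x)"
      using partial_swap[OF test_fun_smooth[OF \<phi>] d flip_less[OF i] x(2)] by simp
    ultimately show "V (partial i \<phi>) x * g x = c * (g x * partial i \<phi> x) + c * \<epsilon> * (g x * partial (flip i) ?\<psi> x)"
      by (simp add: V_def algebra_simps)
  qed
  also have "\<dots> = c * (\<integral>x. g x * partial i \<phi> x \<partial>MQ) + c * \<epsilon> * (\<integral>x. g x * partial (flip i) ?\<psi> x \<partial>MQ)"
    by (subst Bochner_Integration.integral_add)
      (auto intro!: integrable_mult_right L2_mult_integrable[OF gL] test_fun_L2_Q test_fun_partial \<phi>Q \<psi> i flip_less)
  also have "\<dots> = - (c * (\<integral>x. G i x * \<phi> x \<partial>MQ) + c * \<epsilon> * (\<integral>x. G (flip i) x * ?\<psi> x \<partial>MQ))"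
    using weak_gradientD(3)[OF g i \<phi>Q] weak_gradientD(3)[OF g flip_less[OF i] \<psi>] by simp
  also have "c * (\<integral>x. G i x * \<phi> x \<partial>MQ) + c * \<epsilon> * (\<integral>x. G (flip i) x * ?\<psi> x \<partial>MQ)
      = (\<integral>x. c * (G i x * \<phi> x) + c * \<epsilon> * (G (flip i) x * ?\<psi> x) \<partial>MQ)"
    using L2_mult_integrable[OF GL[OF i] test_fun_L2_Q[OF \<phi>Q]]
      L2_mult_integrable[OF GL[OF flip_less[OF i]] test_fun_L2_Q[OF \<psi>]]
    by (subst Bochner_Integration.integral_add) simp_all
  \<comment> \<open>Folding back to \<open>T\<close> gives four terms; the two with the factor
    \<open>\<phi> (swap x)\<close> vanish, since \<open>swap x\<close> is outside
    \<open>T\<close>.\<close>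
  also have "\<dots> = (\<integral>x. (c * (G i x * \<phi> x) + c * \<epsilon> * (G (flip i) x * ?\<psi> x))
      + (c * (G i (swap x) * \<phi> (swap x)) + c * \<epsilon> * (G (flip i) (swap x) * ?\<psi> (swap x))) \<partial>MT)"
    by (rule integral_Q_split(1))
      (intro Bochner_Integration.integrable_add integrable_mult_right L2_mult_integrable GL[OF i]
        GL[OF flip_less[OF i]] test_fun_L2_Q[OF \<phi>Q] test_fun_L2_Q[OF \<psi>])
  also have "\<dots> = (\<integral>x. grad_W G i x * \<phi> x \<partial>MT)"
  proof (intro Bochner_Integration.integral_cong refl)
    fix x assume "x \<in> space MT"
    then have "\<phi> (swap x) = 0"
      using test_fun_vanishes_T[OF \<phi>, of "swap x"] swap_not_T T_subset by auto
    then show "(c * (G i x * \<phi> x) + c * \<epsilon> * (G (flip i) x * ?\<psi> x))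
      + (c * (G i (swap x) * \<phi> (swap x)) + c * \<epsilon> * (G (flip i) (swap x) * ?\<psi> (swap x))) = grad_W G i x * \<phi> x"
      by (simp add: grad_W_def algebra_simps)
  qed
  finally show "(\<integral>x. W g x * partial i \<phi> x \<partial>MT) = - (\<integral>x. grad_W G i x * \<phi> x \<partial>MT)" .
qed

text \<open>The support is cut down by the closed condition
  \<open>1 / (n + 1) \<le> x 0 - x 1\<close>, which keeps it compact and implies the strict
  inequality that defines \<open>T\<close>.\<close>

lemma cutoff_test_fun:
  assumes "\<phi> \<in> test_fun d Q"
  shows "(\<lambda>x. of_real (cutoff n x) * \<phi> x) \<in> test_fun d T"
proof -
  obtain C where C: "compact C" "C \<subseteq> Q" "\<And>x. x \<in> euclid d \<Longrightarrow> x \<notin> C \<Longrightarrow> \<phi> x = 0"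
    using test_funE[OF assms] by metis
  let ?D = "{x::point. 1 / real (Suc n) \<le> x 0 - x 1}"
  have "closed ?D"
    by (intro closed_Collect_le continuous_intros continuous_on_coordinate)
  then have comp: "compact (C \<inter> ?D)" using C(1) by (intro compact_Int_closed)
  have "x 1 < x 0" if "x \<in> ?D" for x
  proof -
    have "0 < 1 / real (Suc n)" by simp
    moreover have "1 / real (Suc n) \<le> x 0 - x 1" using that by blast
    ultimately show ?thesis by linarith
  qed
  then have sub: "C \<inter> ?D \<subseteq> T" using C(2) by (auto simp: T_def)
  show ?thesis
  proof (rule test_funI[OF _ comp sub])
    show "smooth d (\<lambda>x. of_real (cutoff n x) * \<phi> x)"
      by (intro smooth_mult smooth_cutoff d test_fun_smooth[OF assms])
    fix x assume "x \<in> euclid d" "x \<notin> C \<inter> ?D"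
    then show "of_real (cutoff n x) * \<phi> x = 0"
      using C(3) cutoff_eq_0[of x n] by force
  qed
qed

lemma cutoff_L2_limit:
  assumes u: "u \<in> L2 MT"
  shows "(\<lambda>n. L2_norm MT (\<lambda>x. of_real (cutoff n x) * u x - u x)) \<longlonglongrightarrow> 0"
proof (rule L2_dominated_convergence[OF _ L2_measurable[OF u] u])
  show "(\<lambda>x. of_real (cutoff n x) * u x) \<in> borel_measurable MT" for n
    by (intro borel_measurable_times smooth_measurable[OF smooth_cutoff[OF d]] L2_measurable[OF u])
  show "AE x in MT. (\<lambda>n. of_real (cutoff n x) * u x) \<longlonglongrightarrow> u x"
  proof (rule AE_I2)
    fix x assume "x \<in> space MT"
    then have "x \<in> T" by simp
    then have "(\<lambda>n. cutoff n x) \<longlonglongrightarrow> 1" by (intro cutoff_tendsto) (auto simp: T_def)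
    from tendsto_mult_right[OF tendsto_of_real[OF this], of "u x"]
    show "(\<lambda>n. of_real (cutoff n x) * u x) \<longlonglongrightarrow> u x" by simp
  qed
  show "AE x in MT. cmod (of_real (cutoff n x) * u x) \<le> cmod (u x)" for n
    using cutoff_bounds by (intro AE_I2) (auto simp: norm_mult mult_left_le_one_le)
qed

text \<open>Linear vanishing of \<open>u\<close> at the diagonal bounds the product by
  \<open>3 * \<bar>B\<bar>\<close> for all \<open>n\<close>, while pointwise it tends to 0;
  dominated convergence on a set of finite measure does the rest. The absolute value is taken since
  \<open>B\<close> is an arbitrary real.\<close>

lemma cutoff_deriv_L2_limit:
  assumes u: "u \<in> borel_measurable MT" and i: "i < d"
    and B: "\<And>x. x \<in> T \<Longrightarrow> cmod (u x) \<le> B * \<bar>x 0 - x 1\<bar>"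
  shows "(\<lambda>n. L2_norm MT (\<lambda>x. of_real (cutoff_deriv i n x) * u x)) \<longlonglongrightarrow> 0"
    and "(\<lambda>x. of_real (cutoff_deriv i n x) * u x) \<in> L2 MT"
proof -
  have m: "(\<lambda>x. of_real (cutoff_deriv i n x) * u x) \<in> borel_measurable MT" for n
    using smooth_measurable[OF smooth_partial[OF smooth_cutoff[OF d] i]] u
    by (intro borel_measurable_times) (simp_all add: partial_cutoff[OF d i, abs_def])
  have bd: "cmod (of_real (cutoff_deriv i n x) * u x) \<le> 3 * \<bar>B\<bar>" if "x \<in> T" for x n
  proof -
    have "cmod (of_real (cutoff_deriv i n x) * u x) \<le> \<bar>cutoff_deriv i n x\<bar> * (\<bar>B\<bar> * \<bar>x 0 - x 1\<bar>)"
      unfolding norm_mult norm_of_real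
      by (intro mult_left_mono order_trans[OF B[OF that]] mult_right_mono) auto
    also have "\<dots> = (\<bar>cutoff_deriv i n x\<bar> * \<bar>x 0 - x 1\<bar>) * \<bar>B\<bar>" by simp
    also have "\<dots> \<le> 3 * \<bar>B\<bar>" by (intro mult_right_mono cutoff_deriv_bound) simp
    finally show ?thesis .
  qed
  show "(\<lambda>x. of_real (cutoff_deriv i n x) * u x) \<in> L2 MT"
    by (rule bounded_L2[OF T_sets T_subset m bd])
  have "(\<lambda>n. L2_norm MT (\<lambda>x. of_real (cutoff_deriv i n x) * u x - 0)) \<longlonglongrightarrow> 0"
  proof (rule L2_dominated_convergence[OF m])
    show "(\<lambda>x. of_real (3 * \<bar>B\<bar>)) \<in> L2 MT" by (rule bounded_L2[OF T_sets T_subset _ order_refl]) simp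
    show "AE x in MT. cmod (of_real (cutoff_deriv i n x) * u x) \<le> cmod (of_real (3 * \<bar>B\<bar>))" for n
      using bd by (intro AE_I2) (simp add: abs_mult)
    show "AE x in MT. (\<lambda>n. of_real (cutoff_deriv i n x) * u x) \<longlonglongrightarrow> 0"
    proof (rule AE_I2)
      fix x assume "x \<in> space MT"
      then have x: "x \<in> T" by simp
      then have x': "x 1 < x 0" by (simp add: T_def)
      have lim: "(\<lambda>n. \<bar>cutoff_deriv i n x * (x 0 - x 1)\<bar> * \<bar>B\<bar>) \<longlonglongrightarrow> 0"
        by (rule tendsto_mult_left_zero[OF tendsto_rabs_zero[OF cutoff_deriv_tendsto[OF x']]])
      show "(\<lambda>n. of_real (cutoff_deriv i n x) * u x) \<longlonglongrightarrow> 0"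
      proof (rule Lim_null_comparison[OF _ lim])
        show "\<forall>\<^sub>F n in sequentially. norm (of_real (cutoff_deriv i n x) * u x) \<le> \<bar>cutoff_deriv i n x * (x 0 - x 1)\<bar> * \<bar>B\<bar>"
        proof (intro always_eventually allI)
          fix n
          have "cmod (u x) \<le> \<bar>B\<bar> * \<bar>x 0 - x 1\<bar>"
            by (intro order_trans[OF B[OF x]] mult_right_mono) auto
          from mult_left_mono[OF this, of "\<bar>cutoff_deriv i n x\<bar>"]
          show "norm (of_real (cutoff_deriv i n x) * u x) \<le> \<bar>cutoff_deriv i n x * (x 0 - x 1)\<bar> * \<bar>B\<bar>"
            by (simp add: norm_mult abs_mult mult_ac)
        qed
      qed
    qed
  qed simp
  then show "(\<lambda>n. L2_norm MT (\<lambda>x. of_real (cutoff_deriv i n x) * u x)) \<longlonglongrightarrow> 0" by simp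
qed

end

section \<open>Form domains and Laplacians\<close>

text \<open>Integration by parts holds for each \<open>\<phi> n\<close>, and both sides are
  continuous in \<open>L2\<close>. A constant sequence gives the case of a single test
  function.\<close>

lemma weak_gradient_limit:
  assumes L: "0 < L" and \<phi>: "\<And>n::nat. \<phi> n \<in> test_fun d (cube d L)"
    and f: "f \<in> L2 (leb_on d (cube d L))" and F: "\<And>i. i < d \<Longrightarrow> F i \<in> L2 (leb_on d (cube d L))"
    and lim: "(\<lambda>n. L2_norm (leb_on d (cube d L)) (\<lambda>x. \<phi> n x - f x)) \<longlonglongrightarrow> 0"
      "\<And>i. i < d \<Longrightarrow> (\<lambda>n. L2_norm (leb_on d (cube d L)) (\<lambda>x. partial i (\<phi> n) x - F i x)) \<longlonglongrightarrow> 0"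
  shows "weak_gradient d (cube d L) f F"
  unfolding weak_gradient_def
proof (intro conjI allI impI ballI)
  let ?M = "leb_on d (cube d L)"
  have tL: "\<phi> \<in> L2 ?M" if "\<phi> \<in> test_fun d (cube d L)" for \<phi>
    by (rule test_fun_L2[OF that cube_subset_euclid cube_sets order_refl])
  show "f \<in> L2 ?M" by fact
  fix i assume i: "i < d"
  show "F i \<in> L2 ?M" by (rule F[OF i])
  fix \<psi> assume \<psi>: "\<psi> \<in> test_fun d (cube d L)"
  have l1: "(\<lambda>n. \<integral>x. \<phi> n x * partial i \<psi> x \<partial>?M) \<longlonglongrightarrow> (\<integral>x. f x * partial i \<psi> x \<partial>?M)"
    by (intro L2_integral_mult_tendsto lim(1) f tL \<phi> test_fun_partial \<psi> i)
  have eq: "(\<lambda>n. \<integral>x. \<phi> n x * partial i \<psi> x \<partial>?M) = (\<lambda>n. - (\<integral>x. partial i (\<phi> n) x * \<psi> x \<partial>?M))"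
    by (intro ext integration_by_parts[OF \<psi> _ i L] test_fun_smooth[OF \<phi>])
  have l2: "(\<lambda>n. - (\<integral>x. partial i (\<phi> n) x * \<psi> x \<partial>?M)) \<longlonglongrightarrow> - (\<integral>x. F i x * \<psi> x \<partial>?M)"
    by (intro tendsto_minus L2_integral_mult_tendsto lim(2) F tL test_fun_partial \<phi> \<psi> i)
  show "(\<integral>x. f x * partial i \<psi> x \<partial>?M) = - (\<integral>x. F i x * \<psi> x \<partial>?M)"
    by (rule LIMSEQ_unique[OF l1[unfolded eq] l2])
qed

lemma test_fun_weak_gradient:
  assumes "0 < L" "\<phi> \<in> test_fun d (cube d L)"
  shows "weak_gradient d (cube d L) \<phi> (\<lambda>i. partial i \<phi>)"
proof (rule weak_gradient_limit[where \<phi> = "\<lambda>n. \<phi>"])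
  show "partial i \<phi> \<in> L2 (leb_on d (cube d L))" if "i < d" for i
    by (rule test_fun_L2[OF test_fun_partial[OF assms(2) that] cube_subset_euclid cube_sets order_refl])
  show "\<phi> \<in> L2 (leb_on d (cube d L))"
    by (rule test_fun_L2[OF assms(2) cube_subset_euclid cube_sets order_refl])
qed (use assms in simp_all)

lemma test_fun_H10:
  assumes "0 < L" "\<phi> \<in> test_fun d (cube d L)"
  shows "\<phi> \<in> H10 d (cube d L)"
  unfolding H10_def using test_fun_weak_gradient[OF assms] assms(2)
  by (intro CollectI exI[of _ "\<lambda>i. partial i \<phi>"] exI[of _ "\<lambda>n. \<phi>"]) auto

lemma test_fun_form_domain:
  assumes "0 < L" "\<phi> \<in> test_fun d (cube d L)"
  shows "\<phi> \<in> form_domain bc d (cube d L)"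
  using test_fun_H10[OF assms] test_fun_weak_gradient[OF assms]
  by (cases bc) (auto simp: H1_def)

text \<open>Holds for both boundary conditions and so makes both operator domains dense. The weak
  gradient of \<open>g\<close> is tested with the conjugate of \<open>partial i \<phi>\<close>,
  itself a test function.\<close>

lemma test_fun_laplacian:
  assumes L: "0 < L" and \<phi>: "\<phi> \<in> test_fun d (cube d L)"
  defines "h \<equiv> \<lambda>x. \<Sum>i<d. partial i (partial i \<phi>) x"
  shows "h \<in> L2 (leb_on d (cube d L))" "(\<phi>, h) \<in> laplacian bc d (cube d L)"
proof -
  let ?M = "leb_on d (cube d L)"
  have tL: "\<phi> \<in> L2 ?M" if "\<phi> \<in> test_fun d (cube d L)" for \<phi>
    by (rule test_fun_L2[OF that cube_subset_euclid cube_sets order_refl])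
  show hL: "h \<in> L2 ?M" unfolding h_def by (intro L2_sum tL test_fun_partial \<phi>) auto
  have "(\<integral>x. (\<Sum>i<d. partial i \<phi> x * cnj (G i x)) \<partial>?M) = - L2_inner ?M h g"
    if G: "weak_gradient d (cube d L) g G" for g G
  proof -
    have gL: "g \<in> L2 ?M" and GL: "\<And>i. i < d \<Longrightarrow> G i \<in> L2 ?M" using G by (auto simp: weak_gradient_def)
    have one: "(\<integral>x. partial i \<phi> x * cnj (G i x) \<partial>?M) = - (\<integral>x. partial i (partial i \<phi>) x * cnj (g x) \<partial>?M)"
      if i: "i < d" for i
    proof -
      have p: "partial i \<phi> \<in> test_fun d (cube d L)" by (rule test_fun_partial[OF \<phi> i])
      have "(\<integral>x. g x * partial i (\<lambda>x. cnj (partial i \<phi> x)) x \<partial>?M) = - (\<integral>x. G i x * cnj (partial i \<phi> x) \<partial>?M)"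
        using G test_fun_cnj[OF p] i unfolding weak_gradient_def by blast
      moreover have "(\<integral>x. g x * partial i (\<lambda>x. cnj (partial i \<phi> x)) x \<partial>?M)
          = (\<integral>x. g x * cnj (partial i (partial i \<phi>) x) \<partial>?M)"
        using cube_subset_euclid[of d L] partial_cnj[OF test_fun_smooth[OF p] i]
        by (intro Bochner_Integration.integral_cong) auto
      ultimately have "cnj (\<integral>x. g x * cnj (partial i (partial i \<phi>) x) \<partial>?M)
          = - cnj (\<integral>x. G i x * cnj (partial i \<phi> x) \<partial>?M)" by simp
      then show ?thesis unfolding Bochner_Integration.integral_cnj[symmetric] by (simp add: mult.commute)
    qed
    have "(\<integral>x. (\<Sum>i<d. partial i \<phi> x * cnj (G i x)) \<partial>?M) = (\<Sum>i<d. \<integral>x. partial i \<phi> x * cnj (G i x) \<partial>?M)"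
      by (intro Bochner_Integration.integral_sum L2_mult_integrable L2_cnj GL tL test_fun_partial \<phi>) auto
    also have "\<dots> = - (\<Sum>i<d. \<integral>x. partial i (partial i \<phi>) x * cnj (g x) \<partial>?M)"
      unfolding sum_negf[symmetric] by (intro sum.cong refl one) simp
    also have "(\<Sum>i<d. \<integral>x. partial i (partial i \<phi>) x * cnj (g x) \<partial>?M) = L2_inner ?M h g"
      unfolding L2_inner_def h_def sum_distrib_right
      by (intro Bochner_Integration.integral_sum[symmetric] L2_mult_integrable L2_cnj gL tL test_fun_partial \<phi>) auto
    finally show ?thesis .
  qed
  then show "(\<phi>, h) \<in> laplacian bc d (cube d L)"
    unfolding laplacian_def
    using test_fun_form_domain[OF L \<phi>] hL test_fun_weak_gradient[OF L \<phi>] by blast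
qed

lemma laplacian_domain_dense:
  assumes L: "0 < L" and f: "f \<in> L2 (leb_on d (cube d L))" and e: "e > 0"
  shows "\<exists>g h. g \<in> L2 (leb_on d (cube d L)) \<and> h \<in> L2 (leb_on d (cube d L)) \<and>
    (g, h) \<in> laplacian bc d (cube d L) \<and> L2_norm (leb_on d (cube d L)) (\<lambda>x. f x - g x) < e"
proof -
  obtain \<phi> where \<phi>: "\<phi> \<in> test_fun d (cube d L)" "L2_norm (leb_on d (cube d L)) (\<lambda>x. f x - \<phi> x) < e"
    using test_fun_dense_cube[OF f] e by (auto simp: approximable_def)
  then show ?thesis
    using test_fun_laplacian[OF L \<phi>(1)] test_fun_L2[OF \<phi>(1) cube_subset_euclid cube_sets order_refl] by blast
qed

lemma weak_gradient_cong_AE: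
  assumes "weak_gradient d \<Omega> f F" "\<And>i. i < d \<Longrightarrow> F' i \<in> L2 (leb_on d \<Omega>)"
    and "\<And>i. i < d \<Longrightarrow> AE x in leb_on d \<Omega>. F i x = F' i x"
  shows "weak_gradient d \<Omega> f F'"
proof -
  have "(\<integral>x. F i x * \<phi> x \<partial>leb_on d \<Omega>) = (\<integral>x. F' i x * \<phi> x \<partial>leb_on d \<Omega>)"
    if "i < d" "\<phi> \<in> test_fun d \<Omega>" for i \<phi>
  proof (rule integral_cong_AE)
    show "AE x in leb_on d \<Omega>. F i x * \<phi> x = F' i x * \<phi> x"
      using assms(3)[OF that(1)] by eventually_elim simp
    have "\<phi> \<in> borel_measurable (leb_on d \<Omega>)" by (intro smooth_measurable test_fun_smooth[OF that(2)])
    moreover have "F i \<in> borel_measurable (leb_on d \<Omega>)" "F' i \<in> borel_measurable (leb_on d \<Omega>)"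
      using assms(1,2) that(1) by (auto simp: weak_gradient_def intro: L2_measurable)
    ultimately show "(\<lambda>x. F i x * \<phi> x) \<in> borel_measurable (leb_on d \<Omega>)" "(\<lambda>x. F' i x * \<phi> x) \<in> borel_measurable (leb_on d \<Omega>)"
      by (auto intro!: borel_measurable_times)
  qed
  then show ?thesis using assms(1,2) unfolding weak_gradient_def by simp
qed

context reflected_cube
begin

lemma cutoff_partial:
  assumes "\<phi> \<in> test_fun d Q" "i < d" "x \<in> T"
  shows "partial i (\<lambda>x. of_real (cutoff n x) * \<phi> x) x
    = of_real (cutoff n x) * partial i \<phi> x + of_real (cutoff_deriv i n x) * \<phi> x"
  using partial_mult[OF smooth_cutoff[OF d] test_fun_smooth[OF assms(1)] assms(2), of x n] assms(3) T_euclid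
  by (auto simp: partial_cutoff[OF d assms(2)])

lemma cutoff_weak_gradient:
  assumes f: "weak_gradient d T f F" and \<phi>: "\<phi> \<in> test_fun d Q" and i: "i < d"
  shows "(\<integral>x. f x * (of_real (cutoff n x) * partial i \<phi> x + of_real (cutoff_deriv i n x) * \<phi> x) \<partial>MT)
    = - (\<integral>x. F i x * (of_real (cutoff n x) * \<phi> x) \<partial>MT)"
proof -
  have "(\<integral>x. f x * (of_real (cutoff n x) * partial i \<phi> x + of_real (cutoff_deriv i n x) * \<phi> x) \<partial>MT)
      = (\<integral>x. f x * partial i (\<lambda>x. of_real (cutoff n x) * \<phi> x) x \<partial>MT)"
    by (intro Bochner_Integration.integral_cong) (simp_all add: cutoff_partial[OF \<phi> i])
  then show ?thesis using weak_gradientD(3)[OF f i cutoff_test_fun[OF \<phi>]] by simp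
qed

lemma cutoff_mult_L2:
  assumes "u \<in> L2 MT" shows "(\<lambda>x. of_real (cutoff n x) * u x) \<in> L2 MT"
proof (rule L2_bounded_by[OF assms])
  show "(\<lambda>x. of_real (cutoff n x) * u x) \<in> borel_measurable MT"
    by (intro borel_measurable_times smooth_measurable[OF smooth_cutoff[OF d]] L2_measurable[OF assms])
  show "cmod (of_real (cutoff n x) * u x) \<le> cmod (u x)" for x
    using cutoff_bounds[of n x] by (simp add: norm_mult mult_left_le_one_le)
qed

lemma test_fun_L2_T: "\<phi> \<in> test_fun d Q \<Longrightarrow> \<phi> \<in> L2 MT"
  by (intro L2_T test_fun_L2_Q)

text \<open>
  In the weak identities for the cut-off functions \<open>\<chi>\<^sub>n \<phi>\<close> and \<open>\<chi>\<^sub>n (\<phi> \<circ> swap)\<close> the derivatives of the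
  cutoff combine to \<open>\<partial>\<^sub>i \<chi>\<^sub>n (\<phi> - \<phi> \<circ> swap)\<close>. The second factor is at most a multiple of
  \<open>\<bar>x 0 - x 1\<bar>\<close>, which compensates the growth of \<open>\<partial>\<^sub>i \<chi>\<^sub>n\<close> near the diagonal.
\<close>

lemma V_weak_gradient_even:
  assumes even: "\<epsilon> = 1" and f: "weak_gradient d T f F"
  shows "weak_gradient d Q (V f) (grad_V F)"
  unfolding weak_gradient_def
proof (intro conjI allI impI ballI)
  note fL = weak_gradientD(1)[OF f] and FL = weak_gradientD(2)[OF f]
  show "V f \<in> L2 MQ" by (rule V_L2[OF fL])
  fix i assume i: "i < d"
  note j = flip_less[OF i]
  show "grad_V F i \<in> L2 MQ" by (intro grad_V_L2 FL i j)
  fix \<phi> assume \<phi>: "\<phi> \<in> test_fun d Q"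
  let ?\<psi> = "\<lambda>x. \<phi> (swap x)"
  have \<psi>: "?\<psi> \<in> test_fun d Q" by (rule test_fun_swap_Q[OF \<phi>])
  let ?u = "\<lambda>x. partial i \<phi> x + partial (flip i) ?\<psi> x"
  let ?v = "\<lambda>x. \<phi> x - ?\<psi> x"
  let ?s = "\<lambda>n x. of_real (cutoff n x) * ?u x + of_real (cutoff_deriv i n x) * ?v x"
  note pL = test_fun_L2_T[OF test_fun_partial[OF \<phi> i]] test_fun_L2_T[OF test_fun_partial[OF \<psi> j]]
  have uL: "?u \<in> L2 MT" by (intro L2_add pL)
  have vL: "?v \<in> L2 MT" by (intro L2_diff test_fun_L2_T \<phi> \<psi>)
  obtain B where B: "\<And>x. x \<in> euclid d \<Longrightarrow> cmod (?v x) \<le> B * \<bar>x 0 - x 1\<bar>"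
    using test_fun_swap_Lipschitz[OF \<phi> cube_subset_euclid d] by metis
  have BT: "\<And>x. x \<in> T \<Longrightarrow> cmod (?v x) \<le> B * \<bar>x 0 - x 1\<bar>" using B T_euclid by blast
  note dL = cutoff_deriv_L2_limit[OF L2_measurable[OF vL] i BT]
  have sL: "?s n \<in> L2 MT" for n by (intro L2_add cutoff_mult_L2 uL dL(2))
  have sl: "(\<lambda>n. L2_norm MT (\<lambda>x. ?s n x - (?u x + 0))) \<longlonglongrightarrow> 0"
    using dL cutoff_L2_limit[OF uL] by (intro L2_tendsto_add cutoff_mult_L2 uL L2_zero) auto
  have "(\<lambda>n. \<integral>x. ?s n x * f x \<partial>MT) \<longlonglongrightarrow> (\<integral>x. ?u x * f x \<partial>MT)"
    using sl by (intro L2_integral_mult_tendsto sL uL fL) simp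
  moreover have "(\<integral>x. ?s n x * f x \<partial>MT) = - ((\<integral>x. (of_real (cutoff n x) * \<phi> x) * F i x \<partial>MT)
      + (\<integral>x. (of_real (cutoff n x) * ?\<psi> x) * F (flip i) x \<partial>MT))" for n
  proof -
    let ?a = "\<lambda>x. of_real (cutoff n x) * partial i \<phi> x + of_real (cutoff_deriv i n x) * \<phi> x"
    let ?b = "\<lambda>x. of_real (cutoff n x) * partial (flip i) ?\<psi> x + of_real (cutoff_deriv (flip i) n x) * ?\<psi> x"
    have "?a \<in> L2 MT"
      using test_fun_L2_T[OF test_fun_T_Q[OF test_fun_partial[OF cutoff_test_fun[OF \<phi>] i]], of n]
      by (subst L2_cong[OF cutoff_partial[OF \<phi> i, symmetric]]) auto
    moreover have "?b \<in> L2 MT"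
      using test_fun_L2_T[OF test_fun_T_Q[OF test_fun_partial[OF cutoff_test_fun[OF \<psi>] j]], of n]
      by (subst L2_cong[OF cutoff_partial[OF \<psi> j, symmetric]]) auto
    ultimately have "(\<integral>x. f x * ?a x + f x * ?b x \<partial>MT) = (\<integral>x. f x * ?a x \<partial>MT) + (\<integral>x. f x * ?b x \<partial>MT)"
      by (intro Bochner_Integration.integral_add L2_mult_integrable fL)
    also have "\<dots> = - (\<integral>x. F i x * (of_real (cutoff n x) * \<phi> x) \<partial>MT)
        + - (\<integral>x. F (flip i) x * (of_real (cutoff n x) * ?\<psi> x) \<partial>MT)"
      by (simp only: cutoff_weak_gradient[OF f \<phi> i] cutoff_weak_gradient[OF f \<psi> j])
    also have "(\<lambda>x. f x * ?a x + f x * ?b x) = (\<lambda>x. ?s n x * f x)"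
      by (simp add: cutoff_deriv_flip fun_eq_iff algebra_simps)
    finally show ?thesis by (simp add: mult.commute)
  qed
  moreover have "(\<lambda>n. - ((\<integral>x. (of_real (cutoff n x) * \<phi> x) * F i x \<partial>MT)
      + (\<integral>x. (of_real (cutoff n x) * ?\<psi> x) * F (flip i) x \<partial>MT)))
    \<longlonglongrightarrow> - ((\<integral>x. \<phi> x * F i x \<partial>MT) + (\<integral>x. ?\<psi> x * F (flip i) x \<partial>MT))"
    by (intro tendsto_minus tendsto_add L2_integral_mult_tendsto cutoff_mult_L2 cutoff_L2_limit
        test_fun_L2_T \<phi> \<psi> FL i j)
  ultimately have key: "(\<integral>x. ?u x * f x \<partial>MT) = - ((\<integral>x. \<phi> x * F i x \<partial>MT) + (\<integral>x. ?\<psi> x * F (flip i) x \<partial>MT))"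
    using LIMSEQ_unique by (metis (no_types, lifting) ext)
  \<comment> \<open>\<open>key\<close> is an identity on \<open>T\<close> alone; transposing
    \<open>V\<close> on the left and \<open>grad_V\<close> on the right brings both sides of the
    claim to it.\<close>
  have "(\<integral>x. V f x * partial i \<phi> x \<partial>MQ) = (\<integral>x. f x * W (partial i \<phi>) x \<partial>MT)"
    by (rule integral_V_mult[OF fL test_fun_L2_Q[OF test_fun_partial[OF \<phi> i]]])
  also have "\<dots> = (\<integral>x. c * (?u x * f x) \<partial>MT)"
  proof (intro Bochner_Integration.integral_cong refl)
    fix x assume "x \<in> space MT"
    then have "x \<in> euclid d" using T_euclid by auto
    then show "f x * W (partial i \<phi>) x = c * (?u x * f x)"
      using partial_swap[OF test_fun_smooth[OF \<phi>] d j] even unfolding W_def by simp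
  qed
  also have "\<dots> = - (c * (\<integral>x. \<phi> x * F i x \<partial>MT) + c * (\<integral>x. ?\<psi> x * F (flip i) x \<partial>MT))"
    unfolding integral_mult_right_zero key by (simp only: mult_minus_right distrib_left)
  also have "c * (\<integral>x. \<phi> x * F i x \<partial>MT) + c * (\<integral>x. ?\<psi> x * F (flip i) x \<partial>MT) = (\<integral>x. grad_V F i x * \<phi> x \<partial>MQ)"
  proof -
    have "c * (\<integral>x. \<phi> x * F i x \<partial>MT) = (\<integral>x. F i x * (c * \<phi> x) \<partial>MT)"
      unfolding integral_mult_right_zero[symmetric]
      by (intro Bochner_Integration.integral_cong refl) (simp only: mult_ac)
    moreover have "c * (\<integral>x. ?\<psi> x * F (flip i) x \<partial>MT) = (\<integral>x. F (flip i) x * (c * \<epsilon> * ?\<psi> x) \<partial>MT)"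
      unfolding integral_mult_right_zero[symmetric] even
      by (intro Bochner_Integration.integral_cong refl) (simp only: mult_ac mult_1)
    ultimately show ?thesis
      unfolding integral_grad_V_mult[OF FL[OF i] FL[OF j] test_fun_L2_Q[OF \<phi>]] by (simp only:)
  qed
  finally show "(\<integral>x. V f x * partial i \<phi> x \<partial>MQ) = - (\<integral>x. grad_V F i x * \<phi> x \<partial>MQ)" .
qed

section \<open>Dirichlet form domains under extension and averaging\<close>

lemma cmod_c_le_1: "cmod c \<le> 1"
  by (simp add: c_def)

lemma L2_norm_c_add:
  assumes "f \<in> L2 M" "g \<in> L2 M"
  shows "L2_norm M (\<lambda>x. c * (f x + \<epsilon> * g x)) \<le> L2_norm M f + L2_norm M g"
proof -
  have "L2_norm M (\<lambda>x. c * (f x + \<epsilon> * g x)) \<le> 1 * L2_norm M (\<lambda>x. f x + \<epsilon> * g x)"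
    unfolding L2_norm_scale by (intro mult_right_mono cmod_c_le_1) simp
  also have "\<dots> \<le> L2_norm M f + L2_norm M (\<lambda>x. \<epsilon> * g x)"
    using L2_norm_triangle[OF assms(1) L2_scale[OF assms(2)]] by simp
  finally show ?thesis by (simp add: L2_norm_scale)
qed

lemma L2_norm_grad_V:
  assumes "F i \<in> L2 MT" "F (flip i) \<in> L2 MT"
  shows "L2_norm MQ (grad_V F i) \<le> L2_norm MT (F i) + L2_norm MT (F (flip i))"
  using L2_norm_c_add[OF extend_L2[OF assms(1)] L2_swap_Q[OF extend_L2[OF assms(2)]]]
  by (simp add: grad_V_def[abs_def] L2_norm_swap[OF extend_L2[OF assms(2)]] L2_norm_extend)

lemma L2_norm_grad_W:
  assumes "G i \<in> L2 MQ" "G (flip i) \<in> L2 MQ"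
  shows "L2_norm MT (grad_W G i) \<le> L2_norm MQ (G i) + L2_norm MQ (G (flip i))"
proof -
  have "L2_norm MT (grad_W G i) \<le> L2_norm MQ (grad_W G i)"
    unfolding grad_W_def[abs_def]
    by (intro L2_norm_leb_on_mono[OF _ T_sets cube_sets T_subset] L2_scale L2_add L2_swap_Q assms)
  also have "\<dots> \<le> L2_norm MQ (G i) + L2_norm MQ (G (flip i))"
    using L2_norm_c_add[OF assms(1) L2_swap_Q[OF assms(2)]]
    by (simp add: grad_W_def[abs_def] L2_norm_swap[OF assms(2)])
  finally show ?thesis .
qed

lemma W_test_fun:
  assumes "\<phi> \<in> test_fun d Q" shows "W \<phi> \<in> test_fun d Q"
  unfolding W_def[abs_def]
  by (intro test_fun_mult test_fun_linear test_fun_swap_Q assms smooth_const)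

lemma partial_W:
  assumes "\<phi> \<in> test_fun d Q" "i < d" "x \<in> euclid d"
  shows "partial i (W \<phi>) x = grad_W (\<lambda>i. partial i \<phi>) i x"
  unfolding W_def grad_W_def using assms d
  by (intro partial_eqI has_vector_derivative_mult_right has_vector_derivative_add
      smooth_has_partial has_partial_swap test_fun_smooth) auto

text \<open>A test function \<open>\<phi>\<close> of \<open>T\<close> is its own extension by zero,
  so \<open>V \<phi>\<close> and \<open>W \<phi>\<close> coincide on the cube. Hence the smooth
  functions \<open>W (\<phi> n)\<close> are test functions of the cube that approximate
  \<open>V f\<close> together with the first derivatives.\<close>

lemma H10_V:
  assumes "f \<in> H10 d T"
  obtains F where "weak_gradient d T f F" "V f \<in> H10 d Q" "weak_gradient d Q (V f) (grad_V F)"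
proof -
  obtain F \<phi> where F: "weak_gradient d T f F" and \<phi>: "\<And>n::nat. \<phi> n \<in> test_fun d T"
    and lim: "(\<lambda>n. L2_norm MT (\<lambda>x. \<phi> n x - f x)) \<longlonglongrightarrow> 0"
      "\<And>i. i < d \<Longrightarrow> (\<lambda>n. L2_norm MT (\<lambda>x. partial i (\<phi> n) x - F i x)) \<longlonglongrightarrow> 0"
    using assms unfolding H10_def by blast
  note fL = weak_gradientD(1)[OF F] and FL = weak_gradientD(2)[OF F]
  note \<phi>Q = test_fun_T_Q[OF \<phi>]
  have W: "W (\<phi> n) \<in> test_fun d Q" for n by (rule W_test_fun[OF \<phi>Q])
  have ext: "extend \<psi> x = \<psi> x" "extend \<psi> (swap x) = \<psi> (swap x)" if "\<psi> \<in> test_fun d T" "x \<in> Q" for \<psi> x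
    using extend_test_fun[OF that(1), of x] extend_test_fun[OF that(1), of "swap x"] that(2) by simp_all
  have l1: "(\<lambda>n. L2_norm MQ (\<lambda>x. W (\<phi> n) x - V f x)) \<longlonglongrightarrow> 0"
  proof (rule Lim_null_comparison[OF always_eventually[OF allI] lim(1)])
    fix n
    have "L2_norm MQ (\<lambda>x. W (\<phi> n) x - V f x) = L2_norm MQ (\<lambda>x. V (\<phi> n) x - V f x)"
      by (intro L2_norm_cong) (simp add: W_def V_def ext[OF \<phi>])
    also have "\<dots> \<le> L2_norm MT (\<lambda>x. \<phi> n x - f x)"
      by (intro V.dist test_fun_L2_T \<phi>Q fL)
    finally show "norm (L2_norm MQ (\<lambda>x. W (\<phi> n) x - V f x)) \<le> L2_norm MT (\<lambda>x. \<phi> n x - f x)" by simp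
  qed
  have l2: "(\<lambda>n. L2_norm MQ (\<lambda>x. partial i (W (\<phi> n)) x - grad_V F i x)) \<longlonglongrightarrow> 0" if i: "i < d" for i
  proof -
    note j = flip_less[OF i]
    let ?D = "\<lambda>n i x. partial i (\<phi> n) x - F i x"
    have DL: "?D n k \<in> L2 MT" if "k < d" for n k
      by (intro L2_diff test_fun_L2_T test_fun_partial \<phi>Q FL that)
    have "(\<lambda>n. L2_norm MT (?D n i) + L2_norm MT (?D n (flip i))) \<longlonglongrightarrow> 0"
      using tendsto_add[OF lim(2)[OF i] lim(2)[OF j]] by simp
    then show ?thesis
    proof (rule Lim_null_comparison[OF always_eventually[OF allI], rotated])
      fix n
      have "L2_norm MQ (\<lambda>x. partial i (W (\<phi> n)) x - grad_V F i x) = L2_norm MQ (grad_V (?D n) i)"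
      proof (rule L2_norm_cong)
        fix x assume "x \<in> space MQ"
        then have x: "x \<in> Q" "x \<in> euclid d" using cube_subset_euclid[of d L] by auto
        have e: "extend (?D n i) x = partial i (\<phi> n) x - extend (F i) x"
          "extend (?D n (flip i)) (swap x) = partial (flip i) (\<phi> n) (swap x) - extend (F (flip i)) (swap x)"
          using ext[OF test_fun_partial[OF \<phi> i, of n] x(1)] ext[OF test_fun_partial[OF \<phi> j, of n] x(1)]
          by (auto simp: extend_def split: if_splits)
        then show "partial i (W (\<phi> n)) x - grad_V F i x = grad_V (?D n) i x"
          unfolding partial_W[OF \<phi>Q i x(2)] grad_W_def grad_V_def e by (simp add: algebra_simps)
      qed
      also have "\<dots> \<le> L2_norm MT (?D n i) + L2_norm MT (?D n (flip i))"
        by (intro L2_norm_grad_V DL i j)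
      finally show "norm (L2_norm MQ (\<lambda>x. partial i (W (\<phi> n)) x - grad_V F i x))
          \<le> L2_norm MT (?D n i) + L2_norm MT (?D n (flip i))" by simp
    qed
  qed
  have wg: "weak_gradient d Q (V f) (grad_V F)"
    using FL flip_less by (intro weak_gradient_limit[OF L W V_L2[OF fL] _ l1 l2] grad_V_L2) auto
  moreover have "V f \<in> H10 d Q"
    unfolding H10_def using wg W l1 l2
    by (intro CollectI exI[of _ "grad_V F"] exI[of _ "\<lambda>n. W (\<phi> n)"]) auto
  ultimately show thesis using that F by blast
qed

text \<open>Density on the cube, applied to the extension by zero, gives a test function of the
  cube; a cut-off then moves its support off the diagonal at small cost in
  \<open>L2\<close>.\<close>

lemma test_fun_dense_T:
  assumes u: "u \<in> L2 MT" and e: "0 < e"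
  obtains \<phi> where "\<phi> \<in> test_fun d T" "L2_norm MT (\<lambda>x. u x - \<phi> x) < e"
proof -
  obtain \<phi> where \<phi>: "\<phi> \<in> test_fun d Q" "L2_norm MQ (\<lambda>x. extend u x - \<phi> x) < e / 2"
    using test_fun_dense_cube[OF extend_L2[OF u]] e unfolding approximable_def by (meson half_gt_zero)
  obtain n where n: "L2_norm MT (\<lambda>x. of_real (cutoff n x) * \<phi> x - \<phi> x) < e / 2"
    using eventually_happens'[OF _ order_tendstoD(2)[OF cutoff_L2_limit[OF test_fun_L2_T[OF \<phi>(1)]], of "e / 2"]] e
    by auto
  have "L2_norm MT (\<lambda>x. u x - \<phi> x) = L2_norm MT (\<lambda>x. extend u x - \<phi> x)"
    by (intro L2_norm_cong) (simp add: extend_T)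
  also have "\<dots> \<le> L2_norm MQ (\<lambda>x. extend u x - \<phi> x)"
    by (intro L2_norm_leb_on_mono[OF _ T_sets cube_sets T_subset] L2_diff extend_L2 u test_fun_L2_Q \<phi>)
  finally have "L2_norm MT (\<lambda>x. u x - \<phi> x) < e / 2" using \<phi>(2) by simp
  moreover have "L2_norm MT (\<lambda>x. u x - of_real (cutoff n x) * \<phi> x)
      \<le> L2_norm MT (\<lambda>x. u x - \<phi> x) + L2_norm MT (\<lambda>x. \<phi> x - of_real (cutoff n x) * \<phi> x)"
    by (intro L2_norm_triangle3 u test_fun_L2_T \<phi> cutoff_mult_L2)
  ultimately have "L2_norm MT (\<lambda>x. u x - of_real (cutoff n x) * \<phi> x) < e"
    using n L2_norm_minus_commute[of MT \<phi>] by simp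
  then show thesis using that cutoff_test_fun[OF \<phi>(1)] by blast
qed

text \<open>The difference \<open>?D\<close> of two gradients annihilates all test functions.
  Pairing it with its conjugate, and approximating the latter by a test function up to
  \<open>e\<close>, bounds the squared norm by \<open>e\<close> times the norm.\<close>

lemma weak_gradient_unique:
  assumes F: "weak_gradient d T f F" and F': "weak_gradient d T f F'" and i: "i < d"
  shows "AE x in MT. F i x = F' i x"
proof -
  let ?D = "\<lambda>x. F i x - F' i x"
  have L2s: "F i \<in> L2 MT" "F' i \<in> L2 MT" using weak_gradientD(2)[OF F i] weak_gradientD(2)[OF F' i] .
  have D: "?D \<in> L2 MT" by (intro L2_diff L2s)
  have orth: "(\<integral>x. ?D x * \<phi> x \<partial>MT) = 0" if \<phi>: "\<phi> \<in> test_fun d T" for \<phi>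
  proof -
    have "(\<integral>x. ?D x * \<phi> x \<partial>MT) = (\<integral>x. F i x * \<phi> x \<partial>MT) - (\<integral>x. F' i x * \<phi> x \<partial>MT)"
      unfolding left_diff_distrib
      by (intro Bochner_Integration.integral_diff L2_mult_integrable L2s test_fun_L2_T test_fun_T_Q \<phi>)
    then show ?thesis using weak_gradientD(3)[OF F i \<phi>] weak_gradientD(3)[OF F' i \<phi>] by simp
  qed
  have small: "L2_norm MT ?D \<le> e" if e: "e > 0" for e
  proof (cases "L2_norm MT ?D = 0")
    case False
    obtain \<phi> where \<phi>: "\<phi> \<in> test_fun d T" "L2_norm MT (\<lambda>x. cnj (?D x) - \<phi> x) < e"
      using test_fun_dense_T[OF L2_cnj[OF D] e] .
    have \<phi>L: "\<phi> \<in> L2 MT" by (intro test_fun_L2_T test_fun_T_Q \<phi>)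
    have "complex_of_real ((L2_norm MT ?D)\<^sup>2) = (\<integral>x. ?D x * cnj (?D x) \<partial>MT)"
      unfolding L2_norm_power2 integral_complex_of_real[symmetric] complex_norm_square ..
    also have "(\<lambda>x. ?D x * cnj (?D x)) = (\<lambda>x. ?D x * (cnj (?D x) - \<phi> x) + ?D x * \<phi> x)"
      by (simp add: right_diff_distrib)
    also have "(\<integral>x. ?D x * (cnj (?D x) - \<phi> x) + ?D x * \<phi> x \<partial>MT)
        = (\<integral>x. ?D x * (cnj (?D x) - \<phi> x) \<partial>MT) + (\<integral>x. ?D x * \<phi> x \<partial>MT)"
      by (intro Bochner_Integration.integral_add L2_mult_integrable D L2_diff L2_cnj \<phi>L)
    finally have "complex_of_real ((L2_norm MT ?D)\<^sup>2) = (\<integral>x. ?D x * (cnj (?D x) - \<phi> x) \<partial>MT)"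
      using orth[OF \<phi>(1)] by simp
    then have "(L2_norm MT ?D)\<^sup>2 = cmod (\<integral>x. ?D x * (cnj (?D x) - \<phi> x) \<partial>MT)"
      by (metis abs_of_nonneg norm_of_real zero_le_power2)
    also have "\<dots> \<le> L2_norm MT ?D * L2_norm MT (\<lambda>x. cnj (?D x) - \<phi> x)"
      by (intro L2_Cauchy_Schwarz D L2_diff L2_cnj \<phi>L)
    also have "\<dots> \<le> L2_norm MT ?D * e" using \<phi>(2) by (intro mult_left_mono) auto
    finally show ?thesis
      using False L2_norm_nonneg[of MT ?D] by (simp add: power2_eq_square)
  qed (use e in simp)
  have "L2_norm MT ?D \<le> 0" by (rule field_le_epsilon) (use small in simp)
  then have "L2_norm MT ?D = 0" by (rule order_antisym) simp
  then show ?thesis using L2_dist_eq_0_iff[OF L2s] by simp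
qed

text \<open>\<open>H10_V\<close> supplies the gradient attached to one approximating sequence,
  whereas the form identity in \<open>laplacian\<close> ranges over all weak gradients; uniqueness
  almost everywhere bridges the two.\<close>

lemma V_weak_gradient_H10:
  assumes f: "f \<in> H10 d T" and F: "weak_gradient d T f F"
  shows "weak_gradient d Q (V f) (grad_V F)"
proof -
  obtain F' where F': "weak_gradient d T f F'" "weak_gradient d Q (V f) (grad_V F')"
    using H10_V[OF f] by metis
  note FL = weak_gradientD(2)[OF F] and FL' = weak_gradientD(2)[OF F'(1)]
  show ?thesis
  proof (rule weak_gradient_cong_AE[OF F'(2)])
    fix i assume i: "i < d"
    note j = flip_less[OF i]
    let ?D = "\<lambda>i x. F' i x - F i x"
    have D0: "L2_norm MT (?D k) = 0" if k: "k < d" for k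
      using L2_dist_eq_0_iff[OF FL'[OF k] FL[OF k]] weak_gradient_unique[OF F'(1) F k] by simp
    show g: "grad_V F i \<in> L2 MQ" by (intro grad_V_L2 FL i j)
    have g': "grad_V F' i \<in> L2 MQ" by (intro grad_V_L2 FL' i j)
    have "(\<lambda>x. grad_V F' i x - grad_V F i x) = grad_V ?D i"
      by (auto simp: grad_V_def extend_def fun_eq_iff algebra_simps)
    then have "L2_norm MQ (\<lambda>x. grad_V F' i x - grad_V F i x) \<le> 0"
      using L2_norm_grad_V[of ?D i, OF L2_diff[OF FL'[OF i] FL[OF i]] L2_diff[OF FL'[OF j] FL[OF j]]]
        D0[OF i] D0[OF j] by simp
    then have "L2_norm MQ (\<lambda>x. grad_V F' i x - grad_V F i x) = 0" by (rule order_antisym) simp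
    then show "AE x in MQ. grad_V F' i x = grad_V F i x" using L2_dist_eq_0_iff[OF g' g] by simp
  qed
qed

text \<open>Averaged with the odd sign, test functions of the cube vanish on the diagonal, but their
  supports may still reach it. Because they vanish linearly there, the cut-off changes them little
  even in the norm of \<open>H1\<close>, and a diagonal sequence gives test functions of
  \<open>T\<close> that approximate \<open>W g\<close>.\<close>

lemma W_H10_odd:
  assumes odd: "\<epsilon> = -1" and g: "g \<in> H10 d Q"
  shows "W g \<in> H10 d T"
proof -
  obtain G \<phi> where G: "weak_gradient d Q g G" and \<phi>: "\<And>n::nat. \<phi> n \<in> test_fun d Q"
    and lim: "(\<lambda>n. L2_norm MQ (\<lambda>x. \<phi> n x - g x)) \<longlonglongrightarrow> 0"
      "\<And>i. i < d \<Longrightarrow> (\<lambda>n. L2_norm MQ (\<lambda>x. partial i (\<phi> n) x - G i x)) \<longlonglongrightarrow> 0"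
    using g unfolding H10_def by blast
  note gL = weak_gradientD(1)[OF G] and GL = weak_gradientD(2)[OF G]
  let ?w = "\<lambda>n. W (\<phi> n)"
  let ?c = "\<lambda>n m x. of_real (cutoff m x) * ?w n x"
  have w: "?w n \<in> test_fun d Q" for n by (rule W_test_fun[OF \<phi>])
  note wL = test_fun_L2_T[OF w]
  note pL = test_fun_L2_T[OF test_fun_partial[OF w]]
  have cT: "?c n m \<in> test_fun d T" for n m by (rule cutoff_test_fun[OF w])
  note cL = test_fun_L2_T[OF test_fun_T_Q[OF cT]]
  note cpL = test_fun_L2_T[OF test_fun_T_Q[OF test_fun_partial[OF cT]]]
  have l1: "(\<lambda>n. L2_norm MT (\<lambda>x. ?w n x - W g x)) \<longlonglongrightarrow> 0"
    using W.dist[OF test_fun_L2_Q[OF \<phi>] gL]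
    by (intro Lim_null_comparison[OF always_eventually[OF allI] lim(1)]) simp
  have l2: "(\<lambda>n. L2_norm MT (\<lambda>x. partial i (?w n) x - grad_W G i x)) \<longlonglongrightarrow> 0" if i: "i < d" for i
  proof -
    note j = flip_less[OF i]
    let ?D = "\<lambda>n i x. partial i (\<phi> n) x - G i x"
    have DL: "?D n k \<in> L2 MQ" if "k < d" for n k
      by (intro L2_diff test_fun_L2_Q test_fun_partial \<phi> GL that)
    have "(\<lambda>n. L2_norm MQ (?D n i) + L2_norm MQ (?D n (flip i))) \<longlonglongrightarrow> 0"
      using tendsto_add[OF lim(2)[OF i] lim(2)[OF j]] by simp
    then show ?thesis
    proof (rule Lim_null_comparison[OF always_eventually[OF allI], rotated])
      fix n
      have "L2_norm MT (\<lambda>x. partial i (?w n) x - grad_W G i x) = L2_norm MT (grad_W (?D n) i)"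
        using T_euclid by (intro L2_norm_cong) (auto simp: partial_W[OF \<phi> i] subset_iff grad_W_def algebra_simps)
      also have "\<dots> \<le> L2_norm MQ (?D n i) + L2_norm MQ (?D n (flip i))"
        by (intro L2_norm_grad_W DL i j)
      finally show "norm (L2_norm MT (\<lambda>x. partial i (?w n) x - grad_W G i x))
          \<le> L2_norm MQ (?D n i) + L2_norm MQ (?D n (flip i))" by simp
    qed
  qed
  have d2: "(\<lambda>m. L2_norm MT (\<lambda>x. partial i (?c n m) x - partial i (?w n) x)) \<longlonglongrightarrow> 0" if i: "i < d" for i n
  proof -
    obtain B where B: "\<And>x. x \<in> euclid d \<Longrightarrow> cmod (\<phi> n x - \<phi> n (swap x)) \<le> B * \<bar>x 0 - x 1\<bar>"
      using test_fun_swap_Lipschitz[OF \<phi> cube_subset_euclid d] by metis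
    \<comment> \<open>For the sign -1, \<open>W\<close> is \<open>c\<close> times the difference of
      a function and its reflection, so the Lipschitz bound applies.\<close>
    have BT: "cmod (?w n x) \<le> B * \<bar>x 0 - x 1\<bar>" if "x \<in> T" for x
    proof -
      have "cmod (?w n x) = cmod c * cmod (\<phi> n x - \<phi> n (swap x))" using odd unfolding W_def by (simp add: norm_mult)
      also have "\<dots> \<le> 1 * cmod (\<phi> n x - \<phi> n (swap x))" by (intro mult_right_mono cmod_c_le_1) simp
      also have "\<dots> \<le> B * \<bar>x 0 - x 1\<bar>" using B that T_euclid by auto
      finally show ?thesis .
    qed
    note dL = cutoff_deriv_L2_limit[OF L2_measurable[OF wL] i BT]
    have "(\<lambda>m. L2_norm MT (\<lambda>x. (of_real (cutoff m x) * partial i (?w n) x + of_real (cutoff_deriv i m x) * ?w n x)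
        - (partial i (?w n) x + 0))) \<longlonglongrightarrow> 0"
      using dL cutoff_L2_limit[OF pL[OF i]] by (intro L2_tendsto_add cutoff_mult_L2 pL[OF i] L2_zero) auto
    moreover have "L2_norm MT (\<lambda>x. (of_real (cutoff m x) * partial i (?w n) x + of_real (cutoff_deriv i m x) * ?w n x)
        - (partial i (?w n) x + 0)) = L2_norm MT (\<lambda>x. partial i (?c n m) x - partial i (?w n) x)" for m
      by (intro L2_norm_cong) (simp add: cutoff_partial[OF w i])
    ultimately show ?thesis by simp
  qed
  \<comment> \<open>For each \<open>n\<close> one cut-off index serves the function and its finitely
    many partial derivatives; the error \<open>1 / (n + 1)\<close> vanishes along the resulting
    sequence.\<close>
  have "\<exists>m. L2_norm MT (\<lambda>x. ?c n m x - ?w n x) < 1 / real (Suc n) \<and>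
      (\<forall>i\<in>{..<d}. L2_norm MT (\<lambda>x. partial i (?c n m) x - partial i (?w n) x) < 1 / real (Suc n))" for n
  proof -
    have pos: "1 / real (Suc n) > 0" by simp
    have "\<forall>\<^sub>F m in sequentially. L2_norm MT (\<lambda>x. ?c n m x - ?w n x) < 1 / real (Suc n) \<and>
      (\<forall>i\<in>{..<d}. L2_norm MT (\<lambda>x. partial i (?c n m) x - partial i (?w n) x) < 1 / real (Suc n))"
      using d2 by (intro eventually_conj eventually_ball_finite ballI
          order_tendstoD(2)[OF _ pos] cutoff_L2_limit wL) auto
    then show ?thesis by (rule eventually_happens'[rotated]) simp
  qed
  then have "\<forall>n. \<exists>m. L2_norm MT (\<lambda>x. ?c n m x - ?w n x) < 1 / real (Suc n) \<and>
      (\<forall>i\<in>{..<d}. L2_norm MT (\<lambda>x. partial i (?c n m) x - partial i (?w n) x) < 1 / real (Suc n))"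
    by (rule allI)
  from choice[OF this]
  obtain m where m: "\<And>n. L2_norm MT (\<lambda>x. ?c n (m n) x - ?w n x) < 1 / real (Suc n)"
    "\<And>n i. i < d \<Longrightarrow> L2_norm MT (\<lambda>x. partial i (?c n (m n)) x - partial i (?w n) x) < 1 / real (Suc n)"
    by blast
  have inv: "(\<lambda>n. 1 / real (Suc n)) \<longlonglongrightarrow> 0" using LIMSEQ_inverse_real_of_nat by (simp add: inverse_eq_divide)
  have diag: "(\<lambda>n. L2_norm MT (\<lambda>x. p n x - v x)) \<longlonglongrightarrow> 0"
    if "\<And>n. p n \<in> L2 MT" "\<And>n. q n \<in> L2 MT" "v \<in> L2 MT"
      "\<And>n. L2_norm MT (\<lambda>x. p n x - q n x) < 1 / real (Suc n)" "(\<lambda>n. L2_norm MT (\<lambda>x. q n x - v x)) \<longlonglongrightarrow> 0"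
    for p q :: "nat \<Rightarrow> point \<Rightarrow> complex" and v
  proof (rule Lim_null_comparison[OF always_eventually[OF allI]])
    show "(\<lambda>n. 1 / real (Suc n) + L2_norm MT (\<lambda>x. q n x - v x)) \<longlonglongrightarrow> 0"
      using tendsto_add[OF inv that(5)] by simp
    show "norm (L2_norm MT (\<lambda>x. p n x - v x)) \<le> 1 / real (Suc n) + L2_norm MT (\<lambda>x. q n x - v x)" for n
      using L2_norm_triangle3[OF that(1)[of n] that(2)[of n] that(3)] that(4)[of n] by simp
  qed
  have "(\<lambda>n. L2_norm MT (\<lambda>x. ?c n (m n) x - W g x)) \<longlonglongrightarrow> 0"
    by (rule diag[OF cL wL W_L2[OF gL] m(1) l1])
  moreover have "\<forall>i<d. (\<lambda>n. L2_norm MT (\<lambda>x. partial i (?c n (m n)) x - grad_W G i x)) \<longlonglongrightarrow> 0"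
    using GL flip_less by (intro allI impI diag[OF cpL pL grad_W_L2 m(2) l2]) auto
  ultimately show ?thesis
    unfolding H10_def using W_weak_gradient[OF G] cT
    by (intro CollectI exI[of _ "grad_W G"] exI[of _ "\<lambda>n. ?c n (m n)"]) auto
qed

end

definition boundary_sign :: "boundary_cond \<Rightarrow> complex" where
  "boundary_sign bc = (case bc of Dirichlet \<Rightarrow> -1 | Neumann \<Rightarrow> 1)"

section \<open>Transfer of the Laplacians\<close>

locale reflected_laplacian = reflected_cube d L "boundary_sign bc" for d L bc
begin

lemma V_form_domain:
  assumes "f \<in> form_domain bc d T" "weak_gradient d T f F"
  shows "V f \<in> form_domain bc d Q" "weak_gradient d Q (V f) (grad_V F)"
proof -
  have "V f \<in> form_domain bc d Q \<and> weak_gradient d Q (V f) (grad_V F)"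
  proof (cases bc)
    case Dirichlet
    then show ?thesis using assms V_weak_gradient_H10 H10_V by auto
  next
    case Neumann
    then show ?thesis using V_weak_gradient_even[OF _ assms(2)] by (auto simp: H1_def boundary_sign_def)
  qed
  then show "V f \<in> form_domain bc d Q" "weak_gradient d Q (V f) (grad_V F)" by auto
qed

lemma W_form_domain:
  assumes "g \<in> form_domain bc d Q" "weak_gradient d Q g G"
  shows "W g \<in> form_domain bc d T" "weak_gradient d T (W g) (grad_W G)"
proof -
  show wg: "weak_gradient d T (W g) (grad_W G)" by (rule W_weak_gradient[OF assms(2)])
  then show "W g \<in> form_domain bc d T"
    using assms W_H10_odd by (cases bc) (auto simp: H1_def boundary_sign_def)
qed

lemma cnj_W: "cnj (W g x) = W (\<lambda>x. cnj (g x)) x"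
  and cnj_V: "cnj (V f x) = V (\<lambda>x. cnj (f x)) x"
  and cnj_grad_W: "cnj (grad_W G i x) = grad_W (\<lambda>i x. cnj (G i x)) i x"
  and cnj_grad_V: "cnj (grad_V F i x) = grad_V (\<lambda>i x. cnj (F i x)) i x"
  by (simp_all add: W_def V_def grad_W_def grad_V_def extend_def)

lemma inner_V: "f \<in> L2 MT \<Longrightarrow> g \<in> L2 MQ \<Longrightarrow> L2_inner MQ (V f) g = L2_inner MT f (W g)"
  unfolding L2_inner_def cnj_W by (rule integral_V_mult[OF _ L2_cnj])

lemma inner_W:
  assumes "g \<in> L2 MQ" "f \<in> L2 MT" shows "L2_inner MQ g (V f) = L2_inner MT (W g) f"
  using integral_V_mult[OF L2_cnj[OF assms(2)] assms(1)]
  by (simp add: L2_inner_def cnj_V mult.commute)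

text \<open>In the weak formulation \<open>V\<close> moves onto the test element as
  \<open>W\<close>: \<open>gradient_duality\<close> does this for the form and
  \<open>inner_V\<close> for the right-hand side, and \<open>W g\<close> is admissible by
  \<open>W_form_domain\<close>. In \<open>W_laplacian\<close> the two maps exchange roles.\<close>

lemma V_laplacian:
  assumes f: "f \<in> L2 MT" and h: "h \<in> L2 MT" and fh: "(f, h) \<in> laplacian bc d T"
  shows "(V f, V h) \<in> laplacian bc d Q"
proof -
  obtain F where F: "weak_gradient d T f F" and fD: "f \<in> form_domain bc d T"
    and id: "\<And>g G. g \<in> form_domain bc d T \<Longrightarrow> weak_gradient d T g G \<Longrightarrow>
      (\<integral>x. (\<Sum>i<d. F i x * cnj (G i x)) \<partial>MT) = - L2_inner MT h g"
    using fh unfolding laplacian_def by blast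
  have "(\<integral>x. (\<Sum>i<d. grad_V F i x * cnj (G i x)) \<partial>MQ) = - L2_inner MQ (V h) g"
    if g: "g \<in> form_domain bc d Q" and G: "weak_gradient d Q g G" for g G
  proof -
    have "(\<integral>x. (\<Sum>i<d. grad_V F i x * cnj (G i x)) \<partial>MQ) = (\<integral>x. (\<Sum>i<d. F i x * cnj (grad_W G i x)) \<partial>MT)"
      unfolding cnj_grad_W
      by (intro gradient_duality L2_cnj weak_gradientD(2)[OF F] weak_gradientD(2)[OF G])
    also have "\<dots> = - L2_inner MT h (W g)" by (intro id W_form_domain[OF g G])
    finally show ?thesis using inner_V[OF h weak_gradientD(1)[OF G]] by simp
  qed
  then show ?thesis
    unfolding laplacian_def using V_form_domain[OF fD F] V_L2[OF h] by blast
qed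

lemma W_laplacian:
  assumes f: "f \<in> L2 MQ" and h: "h \<in> L2 MQ" and fh: "(f, h) \<in> laplacian bc d Q"
  shows "(W f, W h) \<in> laplacian bc d T"
proof -
  obtain F where F: "weak_gradient d Q f F" and fD: "f \<in> form_domain bc d Q"
    and id: "\<And>g G. g \<in> form_domain bc d Q \<Longrightarrow> weak_gradient d Q g G \<Longrightarrow>
      (\<integral>x. (\<Sum>i<d. F i x * cnj (G i x)) \<partial>MQ) = - L2_inner MQ h g"
    using fh unfolding laplacian_def by blast
  have "(\<integral>x. (\<Sum>i<d. grad_W F i x * cnj (G i x)) \<partial>MT) = - L2_inner MT (W h) g"
    if g: "g \<in> form_domain bc d T" and G: "weak_gradient d T g G" for g G
  proof -
    have "(\<integral>x. (\<Sum>i<d. grad_W F i x * cnj (G i x)) \<partial>MT) = (\<integral>x. (\<Sum>i<d. F i x * cnj (grad_V G i x)) \<partial>MQ)"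
      using gradient_duality[of "\<lambda>i x. cnj (G i x)" F] weak_gradientD(2)[OF F] weak_gradientD(2)[OF G]
      by (simp add: cnj_grad_V L2_cnj mult.commute)
    also have "\<dots> = - L2_inner MQ h (V g)" by (intro id V_form_domain[OF g G])
    finally show ?thesis using inner_W[OF h weak_gradientD(1)[OF G]] by simp
  qed
  then show ?thesis
    unfolding laplacian_def using W_form_domain[OF fD F] W_L2[OF h] by blast
qed

lemma weak_gradient_cong:
  assumes "\<And>x. x \<in> T \<Longrightarrow> f x = f' x"
  shows "weak_gradient d T f F \<longleftrightarrow> weak_gradient d T f' F"
proof -
  have "(\<integral>x. f x * u x \<partial>MT) = (\<integral>x. f' x * u x \<partial>MT)" for u
    using assms by (intro Bochner_Integration.integral_cong) auto
  then show ?thesis unfolding weak_gradient_def using assms L2_cong[of MT f f'] by simp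
qed

lemma form_domain_cong:
  assumes "\<And>x. x \<in> T \<Longrightarrow> f x = f' x"
  shows "f \<in> form_domain bc d T \<longleftrightarrow> f' \<in> form_domain bc d T"
proof -
  have "L2_norm MT (\<lambda>x. \<phi> x - f x) = L2_norm MT (\<lambda>x. \<phi> x - f' x)" for \<phi>
    using assms by (intro L2_norm_cong) auto
  moreover have "weak_gradient d T f = weak_gradient d T f'"
    using weak_gradient_cong[of f f', OF assms] by (intro ext)
  ultimately show ?thesis by (cases bc) (simp_all add: H1_def H10_def)
qed

text \<open>Values outside \<open>T\<close> enter neither the integrals nor the spaces over
  \<open>T\<close>. This discharges \<open>generator_cong\<close>.\<close>

lemma laplacian_cong:
  assumes fh: "(f, h) \<in> laplacian bc d T"
    and eq: "\<And>x. x \<in> T \<Longrightarrow> f x = f' x" "\<And>x. x \<in> T \<Longrightarrow> h x = h' x"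
  shows "(f', h') \<in> laplacian bc d T"
proof -
  have "L2_inner MT h g = L2_inner MT h' g" for g
    unfolding L2_inner_def using eq by (intro Bochner_Integration.integral_cong) auto
  then show ?thesis
    using fh form_domain_cong[of f f', OF eq(1)] weak_gradient_cong[of f f', OF eq(1)] L2_cong[of MT h h'] eq(2)
    unfolding laplacian_def by simp
qed

lemma semigroup_reduction:
  assumes "heat_semigroup bc d Q E"
  shows "semigroup_reduction MQ MT V W (laplacian bc d Q) E (laplacian bc d T)"
proof
  show "generates MQ (laplacian bc d Q) E" using assms by (simp add: heat_semigroup_def)
qed (use V_laplacian W_laplacian laplacian_cong laplacian_domain_dense[OF L] in \<open>simp_all\<close>)

end

section \<open>Control and thick sets\<close>

lemma L2_norm_leb_on_subset:
  assumes "\<omega> \<in> sets (leb d)" "\<Omega> \<in> sets (leb d)" "\<omega> \<subseteq> \<Omega>"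
  shows "L2_norm (leb_on d \<omega>) f = L2_norm (leb_on d \<Omega>) (\<lambda>x. indicator \<omega> x * f x)"
proof -
  have "(L2_norm (leb_on d \<omega>) f)\<^sup>2 = (L2_norm (leb_on d \<Omega>) (\<lambda>x. indicator \<omega> x * f x))\<^sup>2"
    unfolding L2_norm_leb_on[OF assms(1)] L2_norm_leb_on[OF assms(2)]
    using assms(3) by (intro Bochner_Integration.integral_cong) (auto simp: indicator_def)
  then show ?thesis by (simp add: power2_eq_iff_nonneg)
qed

lemma indicator_contraction:
  assumes "\<omega> \<in> sets (leb d)"
  shows "L2_contraction (leb_on d \<Omega>) (leb_on d \<Omega>) (\<lambda>f x. indicator \<omega> x * f x)"
proof
  show "(\<lambda>x. indicator \<omega> x * f x) \<in> L2 (leb_on d \<Omega>)" if "f \<in> L2 (leb_on d \<Omega>)" for f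
  proof (rule L2_bounded_by[OF that])
    show "(\<lambda>x. indicator \<omega> x * f x) \<in> borel_measurable (leb_on d \<Omega>)"
      by (intro borel_measurable_times indicator_measurable_leb_on[OF assms] L2_measurable[OF that])
  qed (simp add: indicator_def)
  show "L2_norm (leb_on d \<Omega>) (\<lambda>x. indicator \<omega> x * f x) \<le> L2_norm (leb_on d \<Omega>) f"
    if "f \<in> L2 (leb_on d \<Omega>)" for f
    by (rule L2_norm_mono[OF that]) (simp add: indicator_def)
qed (simp add: fun_eq_iff algebra_simps)

context reflected_laplacian
begin

text \<open>An indicator passes through \<open>W\<close> when the set on the cube is symmetric under
  the reflection; this is why the control set has to be reflected.\<close>

lemma W_indicator:
  assumes "\<And>x. x \<in> T \<Longrightarrow> (x \<in> \<omega>' \<longleftrightarrow> x \<in> \<omega>) \<and> (swap x \<in> \<omega>' \<longleftrightarrow> x \<in> \<omega>)" "x \<in> T"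
  shows "W (\<lambda>x. indicator \<omega>' x * f x) x = indicator \<omega> x * W f x"
  using assms by (simp add: W_def indicator_def)

lemma V_cong: "(\<And>x. x \<in> T \<Longrightarrow> f x = f' x) \<Longrightarrow> V f = V f'"
  by (auto simp: V_def extend_def fun_eq_iff)

context
  fixes \<omega> \<omega>' :: "point set" and \<tau> :: real
  assumes \<omega>: "\<omega> \<in> sets (leb d)" "\<omega> \<subseteq> T" and \<omega>': "\<omega>' \<in> sets (leb d)" "\<omega>' \<subseteq> Q"
    and sym: "\<And>x. x \<in> T \<Longrightarrow> (x \<in> \<omega>' \<longleftrightarrow> x \<in> \<omega>) \<and> (swap x \<in> \<omega>' \<longleftrightarrow> x \<in> \<omega>)"
    and \<tau>: "0 < \<tau>"
begin

abbreviation "I \<equiv> lebesgue_on {0<..<\<tau>}"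

lemma finite_I: "finite_measure I"
  by (rule finite_measure_lebesgue_on) simp

lemma complete_I: "complete_measure I"
  by (rule complete_measure_lebesgue_on) simp

text \<open>Applying \<open>W\<close> to the final state on the cube gives the final state on
  \<open>T\<close>. The semigroup witnessing this is \<open>R.reduced\<close>, built from the
  semigroup \<open>E\<close> that the hypothesis provides.\<close>

lemma steers_to_zero_W:
  assumes u0: "u0 \<in> L2 MT" and v: "steers_to_zero bc d Q \<omega>' \<tau> (V u0) v"
  shows "steers_to_zero bc d T \<omega> \<tau> u0 (\<lambda>t. W (v t))"
proof -
  obtain E h where vL: "v \<in> L2_L2 I MQ" and E: "heat_semigroup bc d Q E"
    and h: "has_L2_integral I MQ (\<lambda>s. E (\<tau> - s) (\<lambda>x. indicator \<omega>' x * v s x)) h"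
    and zero: "AE x in MQ. E \<tau> (V u0) x + h x = 0"
    using v unfolding steers_to_zero_def by blast
  interpret R: semigroup_reduction MQ MT V W "laplacian bc d Q" E "laplacian bc d T"
    by (rule semigroup_reduction[OF E])
  interpret P: L2_contraction MQ MQ "\<lambda>f x. indicator \<omega>' x * f x"
    by (rule indicator_contraction[OF \<omega>'(1)])
  have vs: "v s \<in> L2 MQ" if "s \<in> space I" for s
    using vL that by (auto simp: L2_L2_def L2_strongly_measurable_def)
  have hL: "h \<in> L2 MQ" using h by (simp add: has_L2_integral_def)
  have "has_L2_integral I MT (\<lambda>s. R.reduced (\<tau> - s) (\<lambda>x. indicator \<omega> x * W (v s) x)) (W h)"
  proof (rule has_L2_integral_cong[OF W.has_integral[OF finite_I h]])
    fix s assume s: "s \<in> space I"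
    then have t: "0 \<le> \<tau> - s" by simp
    \<comment> \<open>\<open>W_indicator\<close> holds only on \<open>T\<close>, but
      \<open>R.reduced\<close> begins with \<open>V\<close>, which reads nothing else, so both sides
      are equal as functions.\<close>
    have eq: "R.reduced (\<tau> - s) (W (\<lambda>x. indicator \<omega>' x * v s x)) = R.reduced (\<tau> - s) (\<lambda>x. indicator \<omega> x * W (v s) x)"
      unfolding R.reduced_def by (subst V_cong[OF W_indicator[OF sym]]) auto
    show "R.reduced (\<tau> - s) (\<lambda>x. indicator \<omega> x * W (v s) x) \<in> L2 MT"
      unfolding eq[symmetric] by (intro R.reduced_L2 t W_L2 P.closed vs s)
    show "AE x in MT. W (E (\<tau> - s) (\<lambda>x. indicator \<omega>' x * v s x)) x = R.reduced (\<tau> - s) (\<lambda>x. indicator \<omega> x * W (v s) x) x"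
      using R.W_intertwines[OF t P.closed[OF vs[OF s]]] unfolding eq .
  qed
  moreover have "AE x in MT. R.reduced \<tau> u0 x + W h x = 0"
  proof -
    have "AE x in MT. W (\<lambda>x. E \<tau> (V u0) x + h x) x = W (\<lambda>x. 0) x"
      using \<tau> by (intro W.cong_AE zero L2_add R.E_L2 V_L2 u0 hL L2_zero) simp
    then show ?thesis unfolding R.reduced_def W.add W.zero .
  qed
  moreover have "heat_semigroup bc d T R.reduced"
    using R.generates_reduced by (simp add: heat_semigroup_def)
  ultimately show ?thesis
    unfolding steers_to_zero_def using W.L2_L2[OF complete_I vL] by blast
qed

lemma control_norm_W:
  assumes vL: "v \<in> L2_L2 I MQ"
  shows "(\<integral>t. (L2_norm (leb_on d \<omega>) (W (v t)))\<^sup>2 \<partial>I) \<le> (\<integral>t. (L2_norm (leb_on d \<omega>') (v t))\<^sup>2 \<partial>I)"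
proof (cases "integrable I (\<lambda>t. (L2_norm (leb_on d \<omega>) (W (v t)))\<^sup>2)")
  \<comment> \<open>In the other case the left integral has the default value 0 and the right one is
    nonnegative.\<close>
  case True
  interpret P: L2_contraction MQ MQ "\<lambda>f x. indicator \<omega>' x * f x"
    by (rule indicator_contraction[OF \<omega>'(1)])
  have vs: "v t \<in> L2 MQ" if "t \<in> space I" for t
    using vL that by (auto simp: L2_L2_def L2_strongly_measurable_def)
  show ?thesis
  proof (rule integral_mono[OF True])
    show "integrable I (\<lambda>t. (L2_norm (leb_on d \<omega>') (v t))\<^sup>2)"
      using P.L2_L2[OF complete_I vL] by (simp add: L2_L2_def L2_norm_leb_on_subset[OF \<omega>'(1) cube_sets \<omega>'(2)])
    fix t assume t: "t \<in> space I"
    have "L2_norm (leb_on d \<omega>) (W (v t)) = L2_norm MT (W (\<lambda>x. indicator \<omega>' x * v t x))"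
      unfolding L2_norm_leb_on_subset[OF \<omega>(1) T_sets \<omega>(2)]
      by (intro L2_norm_cong) (simp add: W_indicator[OF sym])
    also have "\<dots> \<le> L2_norm MQ (\<lambda>x. indicator \<omega>' x * v t x)"
      by (intro W.contractive P.closed vs t)
    finally show "(L2_norm (leb_on d \<omega>) (W (v t)))\<^sup>2 \<le> (L2_norm (leb_on d \<omega>') (v t))\<^sup>2"
      unfolding L2_norm_leb_on_subset[OF \<omega>'(1) cube_sets \<omega>'(2)] by (intro power_mono) auto
  qed
qed (simp add: not_integrable_integral_eq)

lemma null_controllable_T:
  assumes "null_controllable bc d Q \<omega>' \<tau>" shows "null_controllable bc d T \<omega> \<tau>"
  using assms steers_to_zero_W V_L2 unfolding null_controllable_def by blast

text \<open>\<open>V\<close> sends unit vectors to unit vectors, and each control for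
  \<open>V u0\<close> yields one for \<open>u0\<close> that costs no more; so every infimum on
  \<open>T\<close> is bounded by one on the cube.\<close>

lemma control_cost_T: "control_cost bc d T \<omega> \<tau> \<le> control_cost bc d Q \<omega>' \<tau>"
  unfolding control_cost_def
proof (rule SUP_mono)
  fix u0 assume "u0 \<in> {u0 \<in> L2 MT. L2_norm MT u0 = 1}"
  then have u0: "u0 \<in> L2 MT" "L2_norm MT u0 = 1" by auto
  show "\<exists>u\<in>{u0 \<in> L2 MQ. L2_norm MQ u0 = 1}.
      (INF v\<in>{v. steers_to_zero bc d T \<omega> \<tau> u0 v}. ennreal (sqrt (\<integral>t. (L2_norm (leb_on d \<omega>) (v t))\<^sup>2 \<partial>I)))
    \<le> (INF v\<in>{v. steers_to_zero bc d Q \<omega>' \<tau> u v}. ennreal (sqrt (\<integral>t. (L2_norm (leb_on d \<omega>') (v t))\<^sup>2 \<partial>I)))"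
  proof (intro bexI[of _ "V u0"] INF_mono)
    fix v assume "v \<in> {v. steers_to_zero bc d Q \<omega>' \<tau> (V u0) v}"
    then have v: "steers_to_zero bc d Q \<omega>' \<tau> (V u0) v" by simp
    then have "v \<in> L2_L2 I MQ" by (simp add: steers_to_zero_def)
    then show "\<exists>w\<in>{v. steers_to_zero bc d T \<omega> \<tau> u0 v}. ennreal (sqrt (\<integral>t. (L2_norm (leb_on d \<omega>) (w t))\<^sup>2 \<partial>I))
        \<le> ennreal (sqrt (\<integral>t. (L2_norm (leb_on d \<omega>') (v t))\<^sup>2 \<partial>I))"
      using steers_to_zero_W[OF u0(1) v] control_norm_W
      by (intro bexI[of _ "\<lambda>t. W (v t)"] ennreal_leI real_sqrt_le_mono) auto
  qed (use u0 V_L2 isometry in simp)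
qed

end

end

text \<open>Only the part of \<open>S\<close> below the diagonal contributes to the control set on
  the half cube. It is kept and mirrored, while the part of \<open>S\<close> above the diagonal and
  the diagonal itself are discarded.\<close>

definition reflected_set :: "nat \<Rightarrow> point set \<Rightarrow> point set" where
  "reflected_set d S = {x \<in> euclid d. (x 1 < x 0 \<and> x \<in> S) \<or> (x 0 < x 1 \<and> swap x \<in> S)}"

lemma reflected_set_sets:
  assumes "2 \<le> d" "S \<in> sets (leb d)" shows "reflected_set d S \<in> sets (leb d)"
proof -
  have m: "(\<lambda>x. x 0) \<in> borel_measurable (leb d)" "(\<lambda>x. x 1) \<in> borel_measurable (leb d)"
    using assms(1) by (auto intro!: measurable_leb coordinate_measurable)
  have "{x \<in> space (leb d). x 1 < x 0} \<in> sets (leb d)" "{x \<in> space (leb d). x 0 < x 1} \<in> sets (leb d)"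
    by (intro borel_measurable_less m)+
  moreover have "swap -` S \<inter> space (leb d) \<in> sets (leb d)"
    by (rule measurable_sets[OF swap_measurable[OF assms(1)] assms(2)])
  ultimately have "({x \<in> space (leb d). x 1 < x 0} \<inter> S)
      \<union> ({x \<in> space (leb d). x 0 < x 1} \<inter> (swap -` S \<inter> space (leb d))) \<in> sets (leb d)"
    using assms(2) by blast
  moreover have "({x \<in> space (leb d). x 1 < x 0} \<inter> S)
      \<union> ({x \<in> space (leb d). x 0 < x 1} \<inter> (swap -` S \<inter> space (leb d))) = reflected_set d S"
    by (auto simp: reflected_set_def)
  ultimately show ?thesis by simp
qed

lemma swap_reflected_set: "2 \<le> d \<Longrightarrow> swap x \<in> reflected_set d S \<longleftrightarrow> x \<in> reflected_set d S"
  by (auto simp: reflected_set_def)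

lemma measure_swap:
  assumes "2 \<le> d" "A \<in> sets (leb d)"
  shows "measure (leb d) (swap -` A \<inter> euclid d) = measure (leb d) A"
  using measure_distr[OF swap_measurable[OF assms(1)] assms(2)] by (simp add: distr_swap[OF assms(1)])

abbreviation closed_box :: "nat \<Rightarrow> point \<Rightarrow> point \<Rightarrow> point set" where
  "closed_box d x a \<equiv> {y \<in> euclid d. \<forall>j<d. x j \<le> y j \<and> y j \<le> x j + a j}"

lemma closed_box_fmeasurable: "closed_box d x a \<in> fmeasurable (leb d)"
proof (rule fmeasurableI)
  have eq: "closed_box d x a = {y \<in> euclid d. \<forall>j<d. y j \<in> {x j..x j + a j}}" by simp
  show "closed_box d x a \<in> sets (leb d)"
    unfolding eq by (intro sets_leb_if_lborel_prod box_sets) simp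
  have "emeasure (leb d) (closed_box d x a) = (\<Prod>j<d. emeasure lborel {x j..x j + a j})"
    unfolding eq by (rule emeasure_box) simp
  also have "\<dots> < \<infinity>"
    by (simp add: emeasure_lborel_Icc_eq prod_ennreal)
  finally show "emeasure (leb d) (closed_box d x a) < \<infinity>" .
qed

text \<open>
  A square of side \<open>2 r\<close>, \<open>r = \<surd>(a\<^sub>0\<^sup>2 + a\<^sub>1\<^sup>2)\<close>, with lower left corner below the diagonal contains, in
  its lower right corner, an \<open>a\<^sub>0 \<times> a\<^sub>1\<close> rectangle lying below the diagonal, because \<open>a\<^sub>0 + a\<^sub>1 < 2 r\<close>.
\<close>

lemma thick_reflected_set:
  assumes d: "2 \<le> d" and S: "thick d \<gamma> a S"
  defines "r \<equiv> sqrt ((a 0)\<^sup>2 + (a 1)\<^sup>2)"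
  defines "a' \<equiv> a(0 := 2 * r, 1 := 2 * r)"
  shows "thick d (\<gamma> * a 0 * a 1 / (4 * ((a 0)\<^sup>2 + (a 1)\<^sup>2))) a' (reflected_set d S)"
proof -
  have \<gamma>: "0 < \<gamma>" "\<gamma> \<le> 1" and a: "\<And>j. j < d \<Longrightarrow> 0 < a j" and Ss: "S \<in> sets (leb d)"
    and th: "\<And>x. x \<in> euclid d \<Longrightarrow> measure (leb d) (S \<inter> closed_box d x a) \<ge> \<gamma> * (\<Prod>j<d. a j)"
    using S by (auto simp: thick_def)
  have a01: "0 < a 0" "0 < a 1" using a d by auto
  have rr: "r * r = (a 0)\<^sup>2 + (a 1)\<^sup>2" unfolding r_def by simp
  have r: "a 0 < r" "a 1 < r" "0 < r"
    using a01 unfolding r_def by (auto intro!: real_less_rsqrt simp: add_pos_pos)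
  let ?S = "reflected_set d S" and ?\<gamma> = "\<gamma> * a 0 * a 1 / (4 * ((a 0)\<^sup>2 + (a 1)\<^sup>2))"
  have Rs: "?S \<in> sets (leb d)" by (rule reflected_set_sets[OF d Ss])
  have pos: "0 < (a 0)\<^sup>2 + (a 1)\<^sup>2" using a01 by (simp add: add_pos_pos)
  have \<gamma>': "0 < ?\<gamma>" "?\<gamma> \<le> 1"
  proof -
    show "0 < ?\<gamma>" using \<gamma> a01 pos by simp
    have "\<gamma> * (a 0 * a 1) \<le> 1 * (a 0 * a 1)" using \<gamma> a01 by (intro mult_right_mono) auto
    also have "\<dots> \<le> 4 * ((a 0)\<^sup>2 + (a 1)\<^sup>2)"
      using sum_squares_bound[of "a 0" "a 1"] pos by simp
    finally show "?\<gamma> \<le> 1" using pos by (simp add: mult.assoc)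
  qed
  \<comment> \<open>The choice of \<open>?\<gamma>\<close> makes the required measure for the large
    box the same number as for the small one: its two sides \<open>2 * r\<close> contribute
    \<open>4 * ((a 0)^2 + (a 1)^2)\<close>, which cancels the denominator.\<close>
  have prod: "?\<gamma> * (\<Prod>j<d. a' j) = \<gamma> * (\<Prod>j<d. a j)"
  proof -
    have set: "{..<d} = insert 0 (insert 1 {2..<d})" using d by auto
    have "(\<Prod>j<d. a' j) = (2 * r) * ((2 * r) * (\<Prod>j\<in>{2..<d}. a j))"
      unfolding set by (simp add: a'_def)
    also have "\<dots> = 4 * ((a 0)\<^sup>2 + (a 1)\<^sup>2) * (\<Prod>j\<in>{2..<d}. a j)"
      unfolding rr[symmetric] by simp
    finally have "?\<gamma> * (\<Prod>j<d. a' j) = \<gamma> * (a 0 * (a 1 * (\<Prod>j\<in>{2..<d}. a j)))"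
      using pos by simp
    also have "a 0 * (a 1 * (\<Prod>j\<in>{2..<d}. a j)) = (\<Prod>j<d. a j)" unfolding set by simp
    finally show ?thesis .
  qed
  have below: "measure (leb d) (?S \<inter> closed_box d x a') \<ge> \<gamma> * (\<Prod>j<d. a j)"
    if x: "x \<in> euclid d" "x 1 \<le> x 0" for x
  proof -
    \<comment> \<open>The small box is pushed to the far end of the large one in coordinate 0 and
      starts at the same corner in all others.\<close>
    define y where "y = x(0 := x 0 + 2 * r - a 0)"
    have y: "y \<in> euclid d" unfolding y_def using x d by simp
    have "S \<inter> closed_box d y a \<subseteq> ?S \<inter> closed_box d x a'"
    proof
      fix z assume z: "z \<in> S \<inter> closed_box d y a"
      then have ze: "z \<in> euclid d" and zS: "z \<in> S" and zb: "\<And>j. j < d \<Longrightarrow> y j \<le> z j \<and> z j \<le> y j + a j" by auto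
      have z0: "x 0 + 2 * r - a 0 \<le> z 0" "z 0 \<le> x 0 + 2 * r" using zb[of 0] d by (auto simp: y_def)
      have z1: "x 1 \<le> z 1" "z 1 \<le> x 1 + a 1" using zb[of 1] d by (auto simp: y_def)
      have "z 1 < z 0" using z0 z1 r x by linarith
      moreover have "x j \<le> z j \<and> z j \<le> x j + a' j" if "j < d" for j
      proof -
        consider "j = 0" | "j = 1" | "j \<ge> 2" by linarith
        then show ?thesis
        proof cases
          case 1
          then show ?thesis using z0 r by (simp add: a'_def)
        next
          case 2
          then show ?thesis using z1 r by (simp add: a'_def)
        next
          case 3
          then show ?thesis using zb[OF that] by (simp add: a'_def y_def)
        qed
      qed
      ultimately show "z \<in> ?S \<inter> closed_box d x a'" using ze zS by (auto simp: reflected_set_def)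
    qed
    moreover have "?S \<inter> closed_box d x a' \<in> fmeasurable (leb d)"
      using fmeasurable_Int_fmeasurable[OF closed_box_fmeasurable Rs] by (simp add: Int_commute)
    moreover have "S \<inter> closed_box d y a \<in> sets (leb d)"
      using Ss fmeasurableD[OF closed_box_fmeasurable] by (rule sets.Int)
    ultimately have "measure (leb d) (S \<inter> closed_box d y a) \<le> measure (leb d) (?S \<inter> closed_box d x a')"
      by (intro measure_mono_fmeasurable)
    then show ?thesis using th[OF y] by simp
  qed
  have "measure (leb d) (?S \<inter> closed_box d x a') \<ge> \<gamma> * (\<Prod>j<d. a j)" if x: "x \<in> euclid d" for x
  proof (cases "x 1 \<le> x 0")
    case False
    \<comment> \<open>A box whose corner is above the diagonal is reflected to one below. This uses
      that the first two sides are enlarged to the same length, so that the reflected box has the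
      same shape.\<close>
    have a'_flip: "a' (flip j) = a' j" for j by (auto simp: a'_def Transposition.transpose_def)
    have "closed_box d (swap x) a' = swap -` closed_box d x a' \<inter> euclid d"
    proof -
      have "(\<forall>j<d. swap x j \<le> y j \<and> y j \<le> swap x j + a' j) \<longleftrightarrow> (\<forall>j<d. x j \<le> swap y j \<and> swap y j \<le> x j + a' j)" for y
      proof -
        have "(\<forall>j<d. P j) \<longleftrightarrow> (\<forall>j<d. P (flip j))" for P
          using d by (metis flip_less_iff transpose_involutory)
        from this[of "\<lambda>j. swap x j \<le> y j \<and> y j \<le> swap x j + a' j"]
        show ?thesis by (simp add: swap_apply a'_flip)
      qed
      then show ?thesis using d by auto
    qed
    then have "?S \<inter> closed_box d (swap x) a' = swap -` (?S \<inter> closed_box d x a') \<inter> euclid d"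
      using swap_reflected_set[OF d] by auto
    moreover have "?S \<inter> closed_box d x a' \<in> sets (leb d)"
      using Rs fmeasurableD[OF closed_box_fmeasurable] by (rule sets.Int)
    ultimately have "measure (leb d) (?S \<inter> closed_box d (swap x) a') = measure (leb d) (?S \<inter> closed_box d x a')"
      using measure_swap[OF d] by (simp only:)
    then show ?thesis using below[of "swap x"] x d False by simp
  qed (rule below[OF x])
  then show ?thesis
    unfolding thick_def prod using \<gamma>' a r Rs by (auto simp: a'_def)
qed

lemma (in reflected_cube) reflected_set_T:
  assumes "x \<in> T"
  shows "(x \<in> Q \<inter> reflected_set d S \<longleftrightarrow> x \<in> T \<inter> S) \<and> (swap x \<in> Q \<inter> reflected_set d S \<longleftrightarrow> x \<in> T \<inter> S)"
  using assms T_subset T_euclid swap_reflected_set[OF d]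
  by (auto simp: reflected_set_def T_def)

text \<open>Gives the prism the same form as the triangle, a cube cut along
  \<open>x 0 = x 1\<close>, so that one locale treats both dimensions.\<close>

lemma prism_domain_eq: "prism_domain L = {x \<in> cube 3 L. x 1 < x 0}"
proof -
  have "restrict x {..<2} \<in> euclid 2" for x :: point by (simp add: euclid_def)
  moreover have "(\<forall>i<3. P i) \<longleftrightarrow> (\<forall>i<2. P i) \<and> P 2" for P :: "nat \<Rightarrow> bool"
    by (metis less_Suc_eq eval_nat_numeral(3))
  ultimately show ?thesis
    by (auto simp: prism_domain_def triangle_domain_def cube_def)
qed

theorem proposition2p8:
  fixes K L \<gamma> \<gamma>' T :: real and d :: nat and a a' :: point and \<Omega> S \<omega> :: "point set"
    and bc :: boundary_cond
  assumes K: "universal_control_constant K"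
    and L: "L > 0"
    and \<Omega>: "(d = 2 \<and> \<Omega> = triangle_domain L) \<or> (d = 3 \<and> \<Omega> = prism_domain L)"
    and S: "thick d \<gamma> a S"
    and a12: "2 * sqrt ((a 0)\<^sup>2 + (a 1)\<^sup>2) \<le> L"
    and aj: "\<forall>j\<in>{2..<d}. a j \<le> L"
    and \<omega>: "\<omega> = \<Omega> \<inter> S"
    and \<gamma>': "\<gamma>' = \<gamma> * a 0 * a 1 / (4 * ((a 0)\<^sup>2 + (a 1)\<^sup>2))"
    and a': "a' = a(0 := 2 * sqrt ((a 0)\<^sup>2 + (a 1)\<^sup>2), 1 := 2 * sqrt ((a 0)\<^sup>2 + (a 1)\<^sup>2))"
    and T: "T > 0"
  shows "null_controllable bc d \<Omega> \<omega> T \<and>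
    control_cost bc d \<Omega> \<omega> T \<le> ennreal (cost_bound K d \<gamma>' a' T)"
proof -
  have d: "2 \<le> d" using \<Omega> by auto
  interpret R: reflected_laplacian d L bc
    by unfold_locales (use d L in \<open>auto simp: boundary_sign_def split: boundary_cond.splits\<close>)
  have \<Omega>T: "\<Omega> = R.T" using \<Omega> by (auto simp: R.T_def triangle_domain_def prism_domain_eq)
  let ?S = "reflected_set d S"
  have Ss: "S \<in> sets (leb d)" using S by (simp add: thick_def)
  have sets: "\<omega> \<in> sets (leb d)" "cube d L \<inter> ?S \<in> sets (leb d)"
    unfolding \<omega> \<Omega>T by (intro sets.Int R.T_sets Ss cube_sets reflected_set_sets d)+
  have "thick d \<gamma>' a' ?S"
    unfolding \<gamma>' a' by (rule thick_reflected_set[OF d S])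
  \<comment> \<open>The side condition of the universal constant on the cube; for the two enlarged
    sides it is \<open>a12\<close>.\<close>
  moreover have "\<forall>j<d. a' j \<le> L"
    using a12 aj by (auto simp: a')
  ultimately have cube: "null_controllable bc d (cube d L) (cube d L \<inter> ?S) T"
    "control_cost bc d (cube d L) (cube d L \<inter> ?S) T \<le> ennreal (cost_bound K d \<gamma>' a' T)"
    using K d L T unfolding universal_control_constant_def by auto
  have sub: "\<omega> \<subseteq> R.T" "cube d L \<inter> ?S \<subseteq> cube d L" unfolding \<omega> \<Omega>T by auto
  have sym: "(x \<in> cube d L \<inter> ?S \<longleftrightarrow> x \<in> \<omega>) \<and> (swap x \<in> cube d L \<inter> ?S \<longleftrightarrow> x \<in> \<omega>)" if "x \<in> R.T" for x
    using R.reflected_set_T[OF that, of S] unfolding \<omega> \<Omega>T .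
  show ?thesis
    using R.null_controllable_T[OF sets(1) sub(1) sets(2) sub(2) sym T cube(1)]
      order_trans[OF R.control_cost_T[OF sets(1) sub(1) sets(2) sub(2) sym T] cube(2)]
    unfolding \<Omega>T by blast
qed

end
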